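(* Let $\Gamma=PSL_2(\mathbb{Z})$, $G=PGL_2(\mathbb{Z}[\frac1p])$ with $p$ a prime number (or $G=PGL_2(\mathbb{Q})$), and let $F$ be a fundamental domain for the action of $\Gamma$ on the upper half plane $\mathbb{H}$. Let $f_0=B^{1/2}\chi_F$, let $\eta\in H_{13}$ be the $\Gamma$-wandering vector such that $T_{f_0}$ is the orthogonal projection $p_\eta$ onto $\mathbb{C}\eta$, and let $t(\theta)=\langle\pi_{13}(\theta)\eta,\eta\rangle$ and $\varphi_0(\theta)=|t(\theta)|^2$. Then for all $\theta\in G$ $$\varphi_0(\theta)=|t(\theta)|^2=\mathrm{Tr}\big(T_{f_0}\pi_{13}(\theta)T_{f_0}\pi_{13}(\theta)^{-1}\big)=\langle B^{-1}B^{1/2}\chi_F,B^{1/2}\chi_{\theta F}\rangle_{L^2(\mathbb{H},\mu_0)}=\mu_0(\theta F\cap F).$$ Also $$t(\theta)=\mathrm{Tr}\big(\pi_{13}(\theta)T_{B^{1/2}\chi_F}\big),\qquad\theta\in G.$$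
   Context: $H_{13}=H^2(\mathbb{H},(\mathrm{Im}\,z)^{13-2}\,d\overline z\,dz)$ is the Hilbert space of square integrable holomorphic functions on $\mathbb{H}$ for the indicated measure, and $\pi_{13}$ is the 13-th element of the discrete series of $PSL_2(\mathbb{R})$, a projective unitary representation on $H_{13}$, restricted to $G$ (viewed inside $PSL_2(\mathbb{R})$); $\dim_\Gamma H_{13}=1$. $\mu_0$ is the $PSL_2(\mathbb{R})$-invariant measure on $\mathbb{H}$, normalized so that $\mu_0(F)=1$. A vector $\eta$ is $\Gamma$-wandering if $\|\eta\|=1$ and $\pi_{13}(\gamma)\eta\perp\eta$ for all $\gamma\in\Gamma\setminus\{e\}$. The paper establishes just before this corollary that $T_{f_0}$ is a rank one projection $p_\eta$ with $\eta$ a $\Gamma$-wandering vector. For a function $f$ on $\mathbb{H}$ (e.g. of compact support), $T_f$ is the Toeplitz operator with symbol $f$ on $H_{13}$. $B$ is the Berezin transform operator in the normalization of the paper: a positive operator with zero kernel on $L^2(\mathbb{H},\mu_0)$, a function of the invariant Laplacian and commuting with the action of $PSL_2(\mathbb{R})$, such that $\mathrm{Tr}(T_fT_g^* )=\langle B^{-1}f,g\rangle_{L^2(\mathbb{H},\mu_0)}$. Thus $h\mapsto T_{B^{1/2}h}$ extends to a unitary from $L^2(\mathbb{H},\mu_0)$ onto the Hilbert–Schmidt operators $\mathcal{C}_2(H_{13})$, intertwining the action of $PSL_2(\mathbb{R})$ on functions with $\mathrm{Ad}\,\pi_{13}$; $T_{B^{1/2}\chi_F}$ denotes the image of $\chi_F$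 under this unitary. *)

theory Defs
  imports "HOL-Analysis.Analysis" "HOL-Computational_Algebra.Primes"
begin

section \<open>The upper half plane and its group of isometries\<close>

definition UHP :: "complex set" where
  "UHP = {z. Im z > 0}"

type_synonym mat2 = "real ^ 2 ^ 2"

text \<open>Elements of \<open>PSL\<^sub>2(\<real>)\<close> are represented by their two lifts \<open>\<plusminus>g\<close> to \<open>SL\<^sub>2(\<real>)\<close>.\<close>

definition SL2R :: "mat2 set" where
  "SL2R = {g. det g = 1}"

definition SL2Z :: "mat2 set" where
  "SL2Z = {g \<in> SL2R. \<forall>i j. g $ i $ j \<in> \<int>}"

definition GL2 :: "real set \<Rightarrow> mat2 set" where
  "GL2 R = {M. (\<forall>i j. M $ i $ j \<in> R) \<and> (\<exists>u\<in>R. det M * u = 1)}"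

text \<open>\<open>PGL\<^sub>2(R)\<close> viewed inside \<open>PSL\<^sub>2(\<real>)\<close>, for a subring \<open>R\<close> of the reals: only the classes of
  matrices of positive determinant act on the upper half plane by elements of \<open>PSL\<^sub>2(\<real>)\<close>,
  through \<open>M \<mapsto> M / sqrt (det M)\<close>. The set consists of all lifts to \<open>SL\<^sub>2(\<real>)\<close>.\<close>

definition PGL2_lifts :: "real set \<Rightarrow> mat2 set" where
  "PGL2_lifts R = {(1 / sqrt (det M)) *\<^sub>R M |M. M \<in> GL2 R \<and> det M > 0}"

definition Z_inv :: "nat \<Rightarrow> real set" where
  "Z_inv p = {of_int a / of_nat p ^ n |a n. True}"

definition cocycle :: "mat2 \<Rightarrow> complex \<Rightarrow> complex" where
  "cocycle g z = of_real (g $ 2 $ 1) * z + of_real (g $ 2 $ 2)"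

definition mob :: "mat2 \<Rightarrow> complex \<Rightarrow> complex" where
  "mob g z = (of_real (g $ 1 $ 1) * z + of_real (g $ 1 $ 2)) / cocycle g z"

definition translate :: "mat2 \<Rightarrow> (complex \<Rightarrow> complex) \<Rightarrow> complex \<Rightarrow> complex" where
  "translate g f = (\<lambda>z. f (mob (matrix_inv g) z))"

text \<open>The invariant measure \<open>dx dy / y\<^sup>2\<close>, before normalization.\<close>

definition hyp_area :: "complex measure" where
  "hyp_area = density lborel (\<lambda>z. ennreal (indicator UHP z / (Im z)\<^sup>2))"

definition fundamental_domain :: "complex set \<Rightarrow> bool" where
  "fundamental_domain F \<longleftrightarrow>
     F \<in> sets borel \<and> F \<subseteq> UHP \<and>
     (AE z in hyp_area. \<exists>\<gamma>\<in>SL2Z. z \<in> mob \<gamma> ` F) \<and>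
     (\<forall>\<gamma>\<in>SL2Z. \<gamma> \<noteq> mat 1 \<and> \<gamma> \<noteq> - mat 1 \<longrightarrow> mob \<gamma> ` F \<inter> F \<in> null_sets hyp_area)"

section \<open>Square integrable functions; the representation\<close>

text \<open>Elements of \<open>L\<^sup>2\<close> are represented by functions; equality is equality almost everywhere.\<close>

definition L2 :: "complex measure \<Rightarrow> (complex \<Rightarrow> complex) set" where
  "L2 M = {f \<in> borel_measurable M. integrable M (\<lambda>z. (cmod (f z))\<^sup>2)}"

definition ip :: "complex measure \<Rightarrow> (complex \<Rightarrow> complex) \<Rightarrow> (complex \<Rightarrow> complex) \<Rightarrow> complex" where
  "ip M f g = (LINT z|M. f z * cnj (g z))"

definition L2_tendsto ::
  "complex measure \<Rightarrow> (nat \<Rightarrow> complex \<Rightarrow> complex) \<Rightarrow> (complex \<Rightarrow> complex) \<Rightarrow> bool" where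
  "L2_tendsto M h k \<longleftrightarrow> (\<lambda>n. LINT z|M. (cmod (h n z - k z))\<^sup>2) \<longlonglongrightarrow> 0"

definition nu13 :: "complex measure" where
  "nu13 = density lborel (\<lambda>z. ennreal (indicator UHP z * Im z ^ (13 - 2)))"

text \<open>Values outside the upper half plane are set to 0, so that in \<open>H13\<close> equality of vectors is
  equality of functions.\<close>

definition H13 :: "(complex \<Rightarrow> complex) set" where
  "H13 = {f \<in> L2 nu13. f holomorphic_on UHP \<and> (\<forall>z. z \<notin> UHP \<longrightarrow> f z = 0)}"

abbreviation ipH :: "(complex \<Rightarrow> complex) \<Rightarrow> (complex \<Rightarrow> complex) \<Rightarrow> complex" where
  "ipH \<equiv> ip nu13"

type_synonym op = "(complex \<Rightarrow> complex) \<Rightarrow> (complex \<Rightarrow> complex)"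

text \<open>The weight being odd, this is a representation of \<open>SL\<^sub>2(\<real>)\<close> with \<open>pi13 (- g) = - pi13 g\<close>,
  that is, a projective representation of \<open>PSL\<^sub>2(\<real>)\<close>.\<close>

definition pi13 :: "mat2 \<Rightarrow> op" where
  "pi13 g f = (\<lambda>z. if z \<in> UHP
     then f (mob (matrix_inv g) z) / cocycle (matrix_inv g) z ^ 13 else 0)"

definition wandering :: "(complex \<Rightarrow> complex) \<Rightarrow> bool" where
  "wandering \<eta> \<longleftrightarrow> ipH \<eta> \<eta> = 1 \<and>
     (\<forall>\<gamma>\<in>SL2Z. \<gamma> \<noteq> mat 1 \<and> \<gamma> \<noteq> - mat 1 \<longrightarrow> ipH (pi13 \<gamma> \<eta>) \<eta> = 0)"

section \<open>Operators on \<open>H13\<close>\<close>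

text \<open>Operators are functions of which only the values on \<open>H13\<close> matter.\<close>

definition onb :: "(complex \<Rightarrow> complex) set \<Rightarrow> bool" where
  "onb E \<longleftrightarrow> E \<subseteq> H13 \<and>
     (\<forall>e\<in>E. \<forall>f\<in>E. ipH e f = (if e = f then 1 else 0)) \<and>
     (\<forall>\<xi>\<in>H13. (\<forall>e\<in>E. ipH \<xi> e = 0) \<longrightarrow> \<xi> = (\<lambda>_. 0))"

text \<open>\<open>has_trace A t\<close>: the operator \<open>A\<close> is of trace class and \<open>Tr A = t\<close>. A bounded operator is of
  trace class iff the sum converges (unconditionally) in every orthonormal basis.\<close>

definition has_trace :: "op \<Rightarrow> complex \<Rightarrow> bool" where
  "has_trace A t \<longleftrightarrow> (\<forall>E. onb E \<longrightarrow> ((\<lambda>e. ipH (A e) e) has_sum t) E)"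

definition op_adjoint :: "op \<Rightarrow> op" where
  "op_adjoint A \<xi> = (THE \<zeta>. \<zeta> \<in> H13 \<and> (\<forall>\<psi>\<in>H13. ipH (A \<psi>) \<xi> = ipH \<psi> \<zeta>))"

text \<open>The square of the Hilbert--Schmidt norm; the sum does not depend on the basis.\<close>

definition hs_normsq :: "op \<Rightarrow> ennreal" where
  "hs_normsq A = (SUP E \<in> {E. onb E}. (\<Sum>\<^sub>\<infinity>e\<in>E. ennreal (Re (ipH (A e) (A e)))))"

definition C2 :: "op set" where
  "C2 = {A. (\<forall>\<xi>\<in>H13. A \<xi> \<in> H13) \<and>
     (\<forall>\<xi>\<in>H13. \<forall>\<zeta>\<in>H13. \<forall>a b. A (\<lambda>z. a * \<xi> z + b * \<zeta> z) = (\<lambda>z. a * A \<xi> z + b * A \<zeta> z)) \<and>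
     hs_normsq A < \<infinity>}"

definition bergman_proj :: op where
  "bergman_proj v = (THE \<zeta>. \<zeta> \<in> H13 \<and> (\<forall>\<psi>\<in>H13. ipH (\<lambda>z. v z - \<zeta> z) \<psi> = 0))"

text \<open>For \<open>\<xi> \<in> H13\<close> the function \<open>|\<xi>|\<^sup>2 y\<^sup>1\<^sup>3\<close> is bounded. Hence \<open>f \<xi>\<close> is in \<open>L2 nu13\<close> not only for
  bounded symbols \<open>f\<close>, but also for every \<open>f\<close> that is square integrable for the invariant measure.\<close>

definition toeplitz :: "(complex \<Rightarrow> complex) \<Rightarrow> op" where
  "toeplitz f \<xi> = bergman_proj (\<lambda>z. f z * \<xi> z)"

section \<open>Unbounded operators on \<open>L\<^sup>2\<close> and the Berezin transform\<close>

text \<open>An unbounded operator on \<open>L2 M\<close> is given by its graph \<open>S\<close>, closed under equality almost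
  everywhere: \<open>(f, g) \<in> S\<close> means that \<open>f\<close> is in the domain and is mapped to \<open>g\<close>. So \<open>S\<inverse>\<close> is the
  inverse operator and \<open>S O S\<close> the square. The first clause below says that the graph equals the
  graph of the adjoint, which entails linearity and closedness; together with the second clause
  (single-valuedness) it entails that the domain is dense.\<close>

type_synonym graph = "((complex \<Rightarrow> complex) \<times> (complex \<Rightarrow> complex)) set"

definition positive_selfadjoint :: "complex measure \<Rightarrow> graph \<Rightarrow> bool" where
  "positive_selfadjoint M S \<longleftrightarrow>
     S = {(u, v). u \<in> L2 M \<and> v \<in> L2 M \<and> (\<forall>(f, g)\<in>S. ip M g u = ip M f v)} \<and>
     (\<forall>v. (\<lambda>_. 0, v) \<in> S \<longrightarrow> (AE z in M. v z = 0)) \<and>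
     (\<forall>(f, g)\<in>S. ip M g f \<in> \<real> \<and> Re (ip M g f) \<ge> 0)"

definition positive_sqrt :: "complex measure \<Rightarrow> graph \<Rightarrow> graph \<Rightarrow> bool" where
  "positive_sqrt M S B \<longleftrightarrow> positive_selfadjoint M S \<and> S O S = B"

text \<open>The normalization of \<open>B\<close> is the one in which \<open>Tr (T\<^sub>f T\<^sub>g\<^sup>*) = \<langle>B\<^sup>-\<^sup>1 f, g\<rangle>\<close>. The
  trace formula determines \<open>B\<close>: its inverse is, up to a constant factor, the integral operator with
  the point-pair invariant kernel \<open>(Im z Im w / |z - cnj w|\<^sup>2)\<^sup>1\<^sup>3\<close>. This is bounded, so the inverse
  is defined on all of \<open>L\<^sup>2\<close> while \<open>B\<close> itself is unbounded. In particular \<open>B\<close> is automatically a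
  function of the invariant Laplacian.\<close>

definition berezin_operator :: "complex measure \<Rightarrow> graph \<Rightarrow> bool" where
  "berezin_operator M B \<longleftrightarrow>
     positive_selfadjoint M B \<and>
     (\<forall>f. (f, \<lambda>_. 0) \<in> B \<longrightarrow> (AE z in M. f z = 0)) \<and>
     (\<forall>g\<in>SL2R. \<forall>(f, h)\<in>B. (translate g f, translate g h) \<in> B) \<and>
     (\<forall>f\<in>L2 M. \<forall>g\<in>L2 M. \<exists>u. (f, u) \<in> B\<inverse> \<and>
        has_trace (toeplitz f \<circ> op_adjoint (toeplitz g)) (ip M u g))"

text \<open>For \<open>S\<close> the operator \<open>B\<^sup>1\<^sup>/\<^sup>2\<close>: the graph of the extension by continuity of
  \<open>h \<mapsto> T\<^bsub>S h\<^esub>\<close> (isometric for the Hilbert--Schmidt norm and defined on the domain of \<open>S\<close>) to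
  \<open>L2 M\<close>, that is, the closure of the graph of this map. For general \<open>h\<close> the function \<open>S h\<close>
  itself does not exist in \<open>L2 M\<close>.\<close>

definition toeplitz_half :: "complex measure \<Rightarrow> graph \<Rightarrow> ((complex \<Rightarrow> complex) \<times> op) set" where
  "toeplitz_half M S = {(h, A). h \<in> L2 M \<and> A \<in> C2 \<and>
     (\<exists>hn fn. (\<forall>n. (hn n, fn n) \<in> S) \<and> L2_tendsto M hn h \<and>
        (\<lambda>n. hs_normsq (\<lambda>\<xi> z. toeplitz (fn n) \<xi> z - A \<xi> z)) \<longlonglongrightarrow> 0)}"

text \<open>The value \<open>\<langle>B\<^sup>-\<^sup>1 S h, S k\<rangle>\<close> for \<open>S = B\<^sup>1\<^sup>/\<^sup>2\<close> and arbitrary \<open>h\<close>, \<open>k\<close> in \<open>L2 M\<close>, in the same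
  sense: the limit of \<open>\<langle>B\<^sup>-\<^sup>1 S hn, S kn\<rangle>\<close> for \<open>hn\<close>, \<open>kn\<close> in the domain of \<open>S\<close> converging to \<open>h\<close>, \<open>k\<close>.\<close>

definition binv_form ::
  "complex measure \<Rightarrow> graph \<Rightarrow> graph \<Rightarrow> (complex \<Rightarrow> complex) \<Rightarrow> (complex \<Rightarrow> complex) \<Rightarrow> complex" where
  "binv_form M B S h k = (THE v. \<exists>hn fn un kn gn.
     (\<forall>n. (hn n, fn n) \<in> S \<and> (fn n, un n) \<in> B\<inverse> \<and> (kn n, gn n) \<in> S) \<and>
     L2_tendsto M hn h \<and> L2_tendsto M kn k \<and>
     (\<lambda>n. ip M (un n) (gn n)) \<longlonglongrightarrow> v)"

end

(*
  Write K for the inverse of B, and R for the inverse of its square root S, so that R o R = K.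
  Applied to g = f, the trace formula Tr (T_f T_g^* ) = <K f, g> shows that R is bounded: its left side is
  then a Hilbert-Schmidt norm, controlled by the Bergman estimate |xi|^2 y^13 <= C ||xi||^2.
  A bounded positive square root is unique, hence R commutes with the translations by PSL_2(R) because
  K does. If h_n -> chi_F with h_n in the domain of S and T_{S h_n} -> p_eta in Hilbert-Schmidt norm, then
    Tr (T_{S h_n} pi(theta) T_{S h_n}^* pi(theta)^{-1}) = <K S h_n, theta S h_n> = <h_n, theta h_n>,
  whose right side tends to mu_0 (theta F Int F) and whose left side tends to
  Tr (p_eta p_{pi(theta) eta}) = |t(theta)|^2.
*)

theory Submission
  imports Defs "HOL-Complex_Analysis.Complex_Analysis"
begin

section \<open>Square integrable functions\<close>

text \<open>The indicator of F need not lie in the domain of S, so \<open>T\<close> is known only as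
  a Hilbert-Schmidt limit, and both the traces and the pairing with K have to be followed along
  sequences \<open>hn\<close>, \<open>fn\<close>. Translation invariance is assumed of B alone;
  functional calculus for unbounded operators is avoided by working with the inverses. The trace
  clause provides a preimage under B of every square integrable f, so R is defined everywhere, and
  conjugating R by a translation yields a second bounded positive square root of K. Uniqueness of
  such roots is proved in a bare real inner product space, with approximate eigenvectors in place of
  spectral theory. The approximants T_{S h_n} need not be self-adjoint although their limit is, so
  convergence has to be passed to the adjoints before traces can be compared. Completeness of
  \<open>H13\<close>, its bases and the Bergman projection all rest on the Bergman estimate, which
  holds at the point i by a mean value argument and elsewhere because the group moves i to any point
  and acts unitarily.\<close>

lemma mult_cnj_self: "a * cnj a = (of_real (cmod a))\<^sup>2"
  by (simp flip: complex_norm_square)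

definition nsq :: "complex measure \<Rightarrow> (complex \<Rightarrow> complex) \<Rightarrow> real" where
  "nsq M f = (LINT z|M. (cmod (f z))\<^sup>2)"

lemma nsq_nonneg [simp]: "0 \<le> nsq M f"
  unfolding nsq_def by simp

lemma L2_measurable: "f \<in> L2 M \<Longrightarrow> f \<in> borel_measurable M"
  and L2_integrable: "f \<in> L2 M \<Longrightarrow> integrable M (\<lambda>z. (cmod (f z))\<^sup>2)"
  by (simp_all add: L2_def)

lemma L2_bound:
  assumes "h \<in> borel_measurable M" "integrable M b" "\<And>z. (cmod (h z))\<^sup>2 \<le> b z"
  shows "h \<in> L2 M"
proof -
  have "integrable M (\<lambda>z. (cmod (h z))\<^sup>2)"
    by (rule Bochner_Integration.integrable_bound[OF assms(2)])
      (use assms order_trans[OF assms(3) abs_ge_self] in \<open>auto intro!: always_eventually\<close>)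
  thus ?thesis using assms by (simp add: L2_def)
qed

lemma L2_lin:
  assumes f: "f \<in> L2 M" and g: "g \<in> L2 M"
  shows "(\<lambda>z. a * f z + b * g z) \<in> L2 M"
proof (rule L2_bound)
  show "(\<lambda>z. a * f z + b * g z) \<in> borel_measurable M"
    using L2_measurable[OF f] L2_measurable[OF g] by measurable
  show "integrable M (\<lambda>z. 2 * (cmod a)\<^sup>2 * (cmod (f z))\<^sup>2 + 2 * (cmod b)\<^sup>2 * (cmod (g z))\<^sup>2)"
    using L2_integrable[OF f] L2_integrable[OF g] by auto
  fix z
  have "(cmod (a * f z + b * g z))\<^sup>2 \<le> (cmod (a * f z) + cmod (b * g z))\<^sup>2"
    by (intro power_mono norm_triangle_ineq norm_ge_zero)
  also have "\<dots> \<le> 2 * (cmod (a * f z))\<^sup>2 + 2 * (cmod (b * g z))\<^sup>2"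
    using sum_squares_bound[of "cmod (a * f z)" "cmod (b * g z)"] by (simp add: power2_sum)
  finally show "(cmod (a * f z + b * g z))\<^sup>2 \<le>
      2 * (cmod a)\<^sup>2 * (cmod (f z))\<^sup>2 + 2 * (cmod b)\<^sup>2 * (cmod (g z))\<^sup>2"
    by (simp add: norm_mult power_mult_distrib)
qed

lemma L2_0 [simp]: "(\<lambda>_. 0) \<in> L2 M"
  by (simp add: L2_def)

lemma L2_scale: "f \<in> L2 M \<Longrightarrow> (\<lambda>z. a * f z) \<in> L2 M"
  using L2_lin[of f M f a 0] by simp

lemma L2_add: "f \<in> L2 M \<Longrightarrow> g \<in> L2 M \<Longrightarrow> (\<lambda>z. f z + g z) \<in> L2 M"
  using L2_lin[of f M g 1 1] by simp

lemma L2_diff: "f \<in> L2 M \<Longrightarrow> g \<in> L2 M \<Longrightarrow> (\<lambda>z. f z - g z) \<in> L2 M"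
  using L2_lin[of f M g 1 "-1"] by simp

lemma L2_sum: "(\<And>i. i \<in> I \<Longrightarrow> f i \<in> L2 M) \<Longrightarrow> (\<lambda>z. \<Sum>i\<in>I. f i z) \<in> L2 M"
  by (induction I rule: infinite_finite_induct) (auto intro: L2_add)

lemma L2_cnj: "f \<in> L2 M \<Longrightarrow> (\<lambda>z. cnj (f z)) \<in> L2 M"
  by (auto simp: L2_def intro: borel_measurable_continuous_onI[THEN measurable_compose_rev] continuous_intros)

lemma L2_integrable_mult:
  assumes f: "f \<in> L2 M" and g: "g \<in> L2 M"
  shows "integrable M (\<lambda>z. f z * cnj (g z))"
proof (rule Bochner_Integration.integrable_bound)
  show "integrable M (\<lambda>z. (cmod (f z))\<^sup>2 + (cmod (g z))\<^sup>2)"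
    using L2_integrable[OF f] L2_integrable[OF g] by auto
  show "(\<lambda>z. f z * cnj (g z)) \<in> borel_measurable M"
    using L2_measurable[OF f] L2_measurable[OF L2_cnj[OF g]] by measurable
  have "cmod (f z * cnj (g z)) \<le> (cmod (f z))\<^sup>2 + (cmod (g z))\<^sup>2" for z
    using sum_squares_bound[of "cmod (f z)" "cmod (g z)"]
      zero_le_power2[of "cmod (f z)"] zero_le_power2[of "cmod (g z)"]
    unfolding norm_mult complex_mod_cnj by linarith
  thus "AE z in M. norm (f z * cnj (g z)) \<le> norm ((cmod (f z))\<^sup>2 + (cmod (g z))\<^sup>2)"
    by auto
qed

lemma ip_lin_left:
  assumes "f \<in> L2 M" "g \<in> L2 M" "h \<in> L2 M"
  shows "ip M (\<lambda>z. a * f z + b * g z) h = a * ip M f h + b * ip M g h"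
proof -
  have "ip M (\<lambda>z. a * f z + b * g z) h =
      (LINT z|M. a * (f z * cnj (h z)) + b * (g z * cnj (h z)))"
    unfolding ip_def by (simp add: algebra_simps)
  also have "\<dots> = a * ip M f h + b * ip M g h"
    using L2_integrable_mult[of f M h] L2_integrable_mult[of g M h] assms by (simp add: ip_def)
  finally show ?thesis .
qed

lemma ip_commute: "ip M g f = cnj (ip M f g)"
  unfolding ip_def by (simp add: mult.commute flip: Bochner_Integration.integral_cnj)

lemma ip_lin_right:
  assumes "f \<in> L2 M" "g \<in> L2 M" "h \<in> L2 M"
  shows "ip M h (\<lambda>z. a * f z + b * g z) = cnj a * ip M h f + cnj b * ip M h g"
  using ip_lin_left[OF assms, of a b]
  by (simp add: ip_commute[of M h "\<lambda>z. a * f z + b * g z"] ip_commute[of M h f] ip_commute[of M h g])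

lemma ip_diff_left:
  "f \<in> L2 M \<Longrightarrow> g \<in> L2 M \<Longrightarrow> h \<in> L2 M \<Longrightarrow> ip M (\<lambda>z. f z - g z) h = ip M f h - ip M g h"
  using ip_lin_left[of f M g h 1 "-1"] by simp

lemma ip_diff_right:
  "f \<in> L2 M \<Longrightarrow> g \<in> L2 M \<Longrightarrow> h \<in> L2 M \<Longrightarrow> ip M h (\<lambda>z. f z - g z) = ip M h f - ip M h g"
  using ip_lin_right[of f M g h 1 "-1"] by simp

lemma ip_add_left:
  "f \<in> L2 M \<Longrightarrow> g \<in> L2 M \<Longrightarrow> h \<in> L2 M \<Longrightarrow> ip M (\<lambda>z. f z + g z) h = ip M f h + ip M g h"
  using ip_lin_left[of f M g h 1 1] by simp

lemma ip_scale_left: "f \<in> L2 M \<Longrightarrow> h \<in> L2 M \<Longrightarrow> ip M (\<lambda>z. a * f z) h = a * ip M f h"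
  using ip_lin_left[of f M f h a 0] by simp

lemma ip_scale_right: "f \<in> L2 M \<Longrightarrow> h \<in> L2 M \<Longrightarrow> ip M h (\<lambda>z. a * f z) = cnj a * ip M h f"
  using ip_lin_right[of f M f h a 0] by simp

lemma ip_0_left [simp]: "ip M (\<lambda>_. 0) h = 0" and ip_0_right [simp]: "ip M h (\<lambda>_. 0) = 0"
  by (simp_all add: ip_def)

lemma ip_sum_left:
  assumes "\<And>i. i \<in> I \<Longrightarrow> f i \<in> L2 M" "h \<in> L2 M"
  shows "ip M (\<lambda>z. \<Sum>i\<in>I. f i z) h = (\<Sum>i\<in>I. ip M (f i) h)"
  using assms(1)
  by (induction I rule: infinite_finite_induct) (auto simp: ip_add_left L2_sum assms(2))

lemma ip_sum_right:
  assumes "\<And>i. i \<in> I \<Longrightarrow> f i \<in> L2 M" "h \<in> L2 M"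
  shows "ip M h (\<lambda>z. \<Sum>i\<in>I. f i z) = (\<Sum>i\<in>I. ip M h (f i))"
  by (subst ip_commute, subst ip_sum_left[OF assms]) (auto simp: ip_commute[of M h])

lemma ip_self: "ip M f f = of_real (nsq M f)"
  unfolding ip_def nsq_def by (simp add: complex_norm_square[symmetric] flip: integral_complex_of_real)

lemma nsq_eq_ip: "nsq M f = Re (ip M f f)"
  by (simp add: ip_self)

lemma nsq_lin:
  assumes "f \<in> L2 M" "g \<in> L2 M"
  shows "nsq M (\<lambda>z. a * f z + b * g z) =
    (cmod a)\<^sup>2 * nsq M f + (cmod b)\<^sup>2 * nsq M g + 2 * Re (a * cnj b * ip M f g)"
proof -
  have "complex_of_real (nsq M (\<lambda>z. a * f z + b * g z)) =
      (a * cnj a) * nsq M f + (b * cnj b) * nsq M g + (a * cnj b * ip M f g + cnj (a * cnj b * ip M f g))"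
    using assms
    by (simp add: ip_self[symmetric] ip_lin_left ip_lin_right L2_lin ip_commute[of M g f] algebra_simps)
  also have "\<dots> = complex_of_real ((cmod a)\<^sup>2 * nsq M f + (cmod b)\<^sup>2 * nsq M g + 2 * Re (a * cnj b * ip M f g))"
    by (subst complex_add_cnj) (simp add: mult_cnj_self)
  finally show ?thesis by (simp only: of_real_eq_iff)
qed

lemma nsq_scale: "nsq M (\<lambda>z. a * f z) = (cmod a)\<^sup>2 * nsq M f"
  unfolding nsq_def by (simp add: norm_mult power_mult_distrib)

lemma nsq_diff:
  assumes "f \<in> L2 M" "g \<in> L2 M"
  shows "nsq M (\<lambda>z. f z - g z) = nsq M f + nsq M g - 2 * Re (ip M f g)"
  using nsq_lin[OF assms, of 1 "-1"] by simp

lemma ip_Cauchy_Schwarz: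
  assumes "f \<in> L2 M" "g \<in> L2 M"
  shows "(cmod (ip M f g))\<^sup>2 \<le> nsq M f * nsq M g"
proof -
  define a A B where "a = ip M f g" and "A = nsq M f" and "B = nsq M g"
  \<comment> \<open>The right side is the squared norm of s f - r a g. Taking s = B and r = 1 gives
    the inequality when B > 0; when B = 0, a large r forces a = 0.\<close>
  have e: "0 \<le> s\<^sup>2 * A + r\<^sup>2 * (cmod a)\<^sup>2 * B - 2 * s * r * (cmod a)\<^sup>2" for s r :: real
  proof -
    have "of_real s * cnj (- of_real r * a) * a = - of_real (s * r * (cmod a)\<^sup>2)"
      by (simp add: mult_cnj_self[symmetric] mult_ac)
    hence "Re (of_real s * cnj (- of_real r * a) * a) = - (s * r * (cmod a)\<^sup>2)"
      by (simp only: uminus_complex.sel Re_complex_of_real)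
    moreover have "(cmod (- of_real r * a))\<^sup>2 = r\<^sup>2 * (cmod a)\<^sup>2"
      by (simp add: norm_mult power_mult_distrib)
    ultimately have "nsq M (\<lambda>z. of_real s * f z + (- of_real r * a) * g z) =
        s\<^sup>2 * A + r\<^sup>2 * (cmod a)\<^sup>2 * B - 2 * s * r * (cmod a)\<^sup>2"
      using nsq_lin[OF assms, of "of_real s" "- of_real r * a"]
      unfolding a_def[symmetric] A_def[symmetric] B_def[symmetric] by (simp add: power2_abs)
    thus ?thesis using nsq_nonneg by metis
  qed
  have "B \<ge> 0" "A \<ge> 0" by (simp_all add: A_def B_def)
  show ?thesis
  proof (cases "B = 0")
    case True
    have "(cmod a)\<^sup>2 = 0"
    proof (rule ccontr)
      assume n: "(cmod a)\<^sup>2 \<noteq> 0"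
      have "0 \<le> A - 2 * ((A + 1) / (2 * (cmod a)\<^sup>2)) * (cmod a)\<^sup>2"
        using e[of 1 "(A + 1) / (2 * (cmod a)\<^sup>2)"] True by simp
      thus False using n by (simp add: field_simps)
    qed
    thus ?thesis using \<open>A \<ge> 0\<close> \<open>B \<ge> 0\<close> unfolding a_def A_def B_def by auto
  next
    case False
    hence "B > 0" using \<open>B \<ge> 0\<close> by simp
    have "0 \<le> B * (A * B - (cmod a)\<^sup>2)"
      using e[of B 1] by (simp add: power2_eq_square algebra_simps)
    hence "0 \<le> A * B - (cmod a)\<^sup>2" using \<open>B > 0\<close> by (simp add: zero_le_mult_iff)
    thus ?thesis unfolding a_def A_def B_def by simp
  qed
qed

lemma cmod_ip_le:
  assumes "f \<in> L2 M" "g \<in> L2 M"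
  shows "cmod (ip M f g) \<le> sqrt (nsq M f) * sqrt (nsq M g)"
  using real_le_rsqrt[OF ip_Cauchy_Schwarz[OF assms]] by (simp add: real_sqrt_mult)

lemma nsq_eq_0_iff:
  assumes "f \<in> L2 M"
  shows "nsq M f = 0 \<longleftrightarrow> (AE z in M. f z = 0)"
  unfolding nsq_def using integral_nonneg_eq_0_iff_AE[OF L2_integrable[OF assms]] by simp

lemma ip_cong_AE:
  assumes "AE z in M. f z = f' z" "AE z in M. g z = g' z"
    "f \<in> L2 M" "f' \<in> L2 M" "g \<in> L2 M" "g' \<in> L2 M"
  shows "ip M f g = ip M f' g'"
  unfolding ip_def using assms(1,2)
  by (intro integral_cong_AE borel_measurable_integrable L2_integrable_mult assms) auto

lemma nsq_cong_AE:
  assumes "AE z in M. f z = f' z" "f \<in> L2 M" "f' \<in> L2 M"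
  shows "nsq M f = nsq M f'"
  using ip_cong_AE[OF assms(1,1,2,3,2,3)] by (simp add: nsq_eq_ip)

section \<open>Holomorphic change of variables\<close>

text \<open>The Jacobian formula \<open>has_measure_differentiable_image\<close> concerns maps of
  real vectors; this map and its inverse carry it over to the complex plane.\<close>

definition vec_of_complex :: "complex \<Rightarrow> real^2" where
  "vec_of_complex z = vector [Re z, Im z]"

definition complex_of_vec :: "real^2 \<Rightarrow> complex" where
  "complex_of_vec v = Complex (v $ 1) (v $ 2)"

lemma vec_of_complex_inverse [simp]: "complex_of_vec (vec_of_complex z) = z"
  and complex_of_vec_inverse [simp]: "vec_of_complex (complex_of_vec v) = v"
  by (simp_all add: vec_of_complex_def complex_of_vec_def vec_eq_iff forall_2)

lemma bounded_linear_vec_of_complex: "bounded_linear vec_of_complex"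
proof -
  have "linear vec_of_complex"
    by (rule linearI) (simp_all add: vec_of_complex_def vec_eq_iff forall_2)
  thus ?thesis by (rule linear_conv_bounded_linear[THEN iffD1])
qed

lemma bounded_linear_complex_of_vec: "bounded_linear complex_of_vec"
proof -
  have "linear complex_of_vec"
    by (rule linearI) (simp_all add: complex_of_vec_def complex_eq_iff)
  thus ?thesis by (rule linear_conv_bounded_linear[THEN iffD1])
qed

lemma measurable_vec_of_complex [measurable]: "vec_of_complex \<in> borel_measurable borel"
  and measurable_complex_of_vec [measurable]: "complex_of_vec \<in> borel_measurable borel"
  by (auto intro!: borel_measurable_continuous_onI linear_continuous_on
      bounded_linear_vec_of_complex bounded_linear_complex_of_vec)

text \<open>Lebesgue measure is determined by the volumes of boxes, and
  \<open>complex_of_vec\<close> matches boxes with equal side lengths.\<close>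

lemma lborel_complex_eq: "(lborel :: complex measure) = distr lborel borel complex_of_vec"
proof (rule lborel_eqI)
  fix l u :: complex
  assume le: "\<And>b. b \<in> Basis \<Longrightarrow> l \<bullet> b \<le> u \<bullet> b"
  have "Re l \<le> Re u" "Im l \<le> Im u" using le[of 1] le[of \<i>] by (auto simp: Basis_complex_def)
  have "complex_of_vec -` box l u = box (vec_of_complex l) (vec_of_complex u)"
    by (auto simp: complex_of_vec_def vec_of_complex_def in_box_complex_iff box_def
        Basis_complex_def Basis_vec_def inner_axis axis_eq_axis forall_2)
  hence "emeasure (distr lborel borel complex_of_vec) (box l u) =
      emeasure lborel (box (vec_of_complex l) (vec_of_complex u))"
    by (simp add: emeasure_distr)
  also have "\<dots> = (\<Prod>b\<in>Basis. (vec_of_complex u - vec_of_complex l) \<bullet> b)"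
  proof (rule emeasure_lborel_box)
    have "\<forall>i. vec_of_complex l $ i \<le> vec_of_complex u $ i"
      using \<open>Re l \<le> Re u\<close> \<open>Im l \<le> Im u\<close> by (simp add: vec_of_complex_def forall_2)
    thus "vec_of_complex l \<bullet> b \<le> vec_of_complex u \<bullet> b" if "b \<in> Basis" for b
      using that by (auto simp: Basis_vec_def inner_axis)
  qed
  also have "(\<Prod>b\<in>Basis. (vec_of_complex u - vec_of_complex l) \<bullet> b) = (Re u - Re l) * (Im u - Im l)"
  proof -
    have B: "(Basis :: (real^2) set) = {axis 1 1, axis 2 1}"
      by (auto simp: Basis_vec_def) (metis exhaust_2)
    have ne: "axis 1 1 \<noteq> (axis 2 1 :: real^2)" by (simp add: axis_eq_axis)
    show ?thesis unfolding B using ne by (simp add: inner_axis vec_of_complex_def)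
  qed
  also have "\<dots> = (\<Prod>b\<in>Basis. (u - l) \<bullet> b)"
    by (simp add: Basis_complex_def)
  finally show "emeasure (distr lborel borel complex_of_vec) (box l u) = (\<Prod>b\<in>Basis. (u - l) \<bullet> b)" .
qed simp

text \<open>Multiplication by a + ib has the real matrix with rows (a, -b) and (b, a).\<close>

lemma det_complex_mult:
  "det (matrix (\<lambda>v. vec_of_complex (d * complex_of_vec v))) = (cmod d)\<^sup>2"
  unfolding det_2 matrix_def cmod_power2
  by (simp add: vec_of_complex_def complex_of_vec_def axis_def power2_eq_square)

lemma emeasure_lborel_complex_vec:
  "A \<in> sets borel \<Longrightarrow> emeasure lborel (A :: complex set) = emeasure lborel (complex_of_vec -` A)"
  by (subst lborel_complex_eq) (simp add: emeasure_distr)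

lemma vimage_complex_of_vec: "complex_of_vec -` A = vec_of_complex ` A"
  by (auto simp: image_iff) (metis complex_of_vec_inverse)

text \<open>The real Jacobian of a holomorphic map is the squared modulus of its derivative.\<close>

lemma emeasure_holomorphic_image:
  fixes f :: "complex \<Rightarrow> complex"
  assumes A: "A \<in> sets borel" and fA: "f ` A \<in> sets borel"
    and der: "\<And>z. z \<in> A \<Longrightarrow> (f has_field_derivative f' z) (at z within A)"
    and inj: "inj_on f A"
    and int: "integrable lborel (\<lambda>z. indicator A z * (cmod (f' z))\<^sup>2)"
  shows "emeasure lborel (f ` A) = (\<integral>\<^sup>+z. indicator A z * ennreal ((cmod (f' z))\<^sup>2) \<partial>lborel)"
proof -
  define S where "S = complex_of_vec -` A"
  define g where "g v = vec_of_complex (f (complex_of_vec v))" for v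
  define D where "D v = (cmod (f' (complex_of_vec v)))\<^sup>2" for v
  have S: "S \<in> sets borel" unfolding S_def using A measurable_sets_borel by measurable
  have gS: "g ` S = complex_of_vec -` (f ` A)"
    unfolding vimage_complex_of_vec S_def g_def by (simp add: image_image)
  have SA: "complex_of_vec ` S = A" unfolding S_def vimage_complex_of_vec by (simp add: image_image)
  have "g ` S \<in> sets borel" unfolding gS using fA measurable_sets_borel by measurable
  have der': "(g has_derivative (\<lambda>v. vec_of_complex (f' (complex_of_vec x) * complex_of_vec v))) (at x within S)"
    if "x \<in> S" for x
  proof -
    have "(f has_derivative (*) (f' (complex_of_vec x))) (at (complex_of_vec x) within complex_of_vec ` S)"
      using der[of "complex_of_vec x"] that SA by (auto simp: has_field_derivative_def)
    moreover have "(complex_of_vec has_derivative complex_of_vec) (at x within S)"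
      by (rule bounded_linear_imp_has_derivative[OF bounded_linear_complex_of_vec])
    ultimately have "((\<lambda>v. f (complex_of_vec v)) has_derivative
        (\<lambda>v. f' (complex_of_vec x) * complex_of_vec v)) (at x within S)"
      by (rule has_derivative_in_compose[rotated])
    from bounded_linear.has_derivative[OF bounded_linear_vec_of_complex this]
    show ?thesis unfolding g_def .
  qed
  have inj': "inj_on g S"
    using inj unfolding inj_on_def g_def S_def
    by (metis complex_of_vec_inverse vec_of_complex_inverse vimageE)
  have "integrable lborel (\<lambda>v. indicator A (complex_of_vec v) * (cmod (f' (complex_of_vec v)))\<^sup>2)"
    by (rule integrable_distr[where M' = borel and f = "\<lambda>z. indicator A z * (cmod (f' z))\<^sup>2"])
      (use int in \<open>simp_all flip: lborel_complex_eq\<close>)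
  hence intD: "set_integrable lborel S D"
    unfolding set_integrable_def D_def S_def by (simp add: indicator_def mult_ac if_distrib cong: if_cong)
  have hi: "(D has_integral (LINT v:S|lborel. D v)) S"
    using set_borel_integral_eq_integral[OF intD] by (simp add: has_integral_iff)
  have "\<bar>det (matrix (\<lambda>v. vec_of_complex (f' (complex_of_vec x) * complex_of_vec v)))\<bar> = D x" for x
    by (simp add: det_complex_mult D_def)
  hence *: "g ` S \<in> lmeasurable \<and> measure lebesgue (g ` S) = (LINT v:S|lborel. D v)"
    using has_measure_differentiable_image[of S g, OF _ der' inj'] hi S by simp
  have "emeasure lborel (f ` A) = emeasure lebesgue (g ` S)"
    using \<open>g ` S \<in> sets borel\<close> fA by (simp add: emeasure_lborel_complex_vec gS)
  also have "\<dots> = ennreal (LINT v:S|lborel. D v)"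
    by (simp only: emeasure_eq_measure2[OF conjunct1[OF *]] conjunct2[OF *])
  also have "\<dots> = (\<integral>\<^sup>+v. ennreal (indicator S v *\<^sub>R D v) \<partial>lborel)"
    using intD unfolding set_integrable_def set_lebesgue_integral_def
    by (intro nn_integral_eq_integral[symmetric]) (auto simp: D_def)
  also have "\<dots> = (\<integral>\<^sup>+v. ennreal (indicator A (complex_of_vec v) * (cmod (f' (complex_of_vec v)))\<^sup>2) \<partial>lborel)"
    by (simp add: S_def D_def indicator_def)
  also have "\<dots> = (\<integral>\<^sup>+z. ennreal (indicator A z * (cmod (f' z))\<^sup>2) \<partial>lborel)"
    using borel_measurable_integrable[OF int]
    by (subst lborel_complex_eq) (simp add: nn_integral_distr)
  also have "\<dots> = (\<integral>\<^sup>+z. indicator A z * ennreal ((cmod (f' z))\<^sup>2) \<partial>lborel)"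
    by (intro nn_integral_cong) (simp add: indicator_def)
  finally show ?thesis .
qed

section \<open>Moebius transformations and the invariant measure\<close>

lemma open_UHP: "open UHP" unfolding UHP_def by (intro open_Collect_less continuous_intros)

lemma UHP_borel [measurable]: "UHP \<in> sets borel"
  using open_UHP by (rule borel_open)

lemma matrix_inv_mult:
  assumes "g \<in> SL2R"
  shows "g ** matrix_inv g = mat 1" "matrix_inv g ** g = mat 1"
proof -
  have "invertible g" using assms by (simp add: SL2R_def invertible_det_nz)
  hence "g ** matrix_inv g = mat 1 \<and> matrix_inv g ** g = mat 1"
    unfolding invertible_def matrix_inv_def by (rule someI_ex)
  thus "g ** matrix_inv g = mat 1" "matrix_inv g ** g = mat 1" by auto
qed

lemma SL2R_inv: "g \<in> SL2R \<Longrightarrow> matrix_inv g \<in> SL2R"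
  using matrix_inv_mult(1)[of g] det_mul[of g "matrix_inv g"] by (simp add: SL2R_def)

lemma matrix_inv_inv:
  assumes "g \<in> SL2R"
  shows "matrix_inv (matrix_inv g) = g"
proof -
  have "matrix_inv (matrix_inv g) = (g ** matrix_inv g) ** matrix_inv (matrix_inv g)"
    by (simp add: matrix_inv_mult(1)[OF assms])
  also have "\<dots> = g"
    by (simp add: matrix_mul_assoc[symmetric] matrix_inv_mult(1)[OF SL2R_inv[OF assms]])
  finally show ?thesis .
qed

lemma PGL2_lifts_subset: "PGL2_lifts R \<subseteq> SL2R"
proof
  fix g assume "g \<in> PGL2_lifts R"
  then obtain M :: mat2 where M: "g = (1 / sqrt (det M)) *\<^sub>R M" "det M > 0"
    by (auto simp: PGL2_lifts_def)
  have "det g = (1 / sqrt (det M))\<^sup>2 * det M"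
    by (simp only: M(1) det_2 vector_scaleR_component real_scaleR_def power2_eq_square algebra_simps)
  thus "g \<in> SL2R" using M(2) by (simp add: SL2R_def power_divide)
qed

lemma cocycle_nonzero:
  assumes "g \<in> SL2R" "z \<in> UHP"
  shows "cocycle g z \<noteq> 0"
proof
  assume 0: "cocycle g z = 0"
  have "Im (cocycle g z) = g $ 2 $ 1 * Im z" "Re (cocycle g z) = g $ 2 $ 1 * Re z + g $ 2 $ 2"
    by (simp_all add: cocycle_def)
  with 0 assms(2) have "g $ 2 $ 1 = 0" "g $ 2 $ 2 = 0" by (auto simp: UHP_def)
  thus False using assms(1) by (simp add: SL2R_def det_2)
qed

lemma Im_mob:
  assumes "g \<in> SL2R"
  shows "Im (mob g z) = Im z / (cmod (cocycle g z))\<^sup>2"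
proof -
  let ?a = "g $ 1 $ 1" and ?b = "g $ 1 $ 2" and ?c = "g $ 2 $ 1" and ?d = "g $ 2 $ 2"
  have d: "?a * ?d - ?b * ?c = 1" using assms by (simp add: SL2R_def det_2)
  have "?a * Im z * (?c * Re z + ?d) - (?a * Re z + ?b) * (?c * Im z) = (?a * ?d - ?b * ?c) * Im z"
    by (simp add: algebra_simps)
  thus ?thesis unfolding mob_def by (simp add: Im_divide cocycle_def cmod_power2 d)
qed

lemma mob_UHP: "g \<in> SL2R \<Longrightarrow> z \<in> UHP \<Longrightarrow> mob g z \<in> UHP"
  using cocycle_nonzero[of g z] by (simp add: UHP_def Im_mob)

lemma Im_pos: "z \<in> UHP \<Longrightarrow> Im z > 0"
  by (simp add: UHP_def)

lemma mat_mult_nth2: "((A :: mat2) ** B) $ i $ j = A $ i $ 1 * B $ 1 $ j + A $ i $ 2 * B $ 2 $ j"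
  by (simp add: matrix_matrix_mult_def sum_2)

lemma cocycle_mult:
  assumes "h \<in> SL2R" "z \<in> UHP"
  shows "cocycle (g ** h) z = cocycle g (mob h z) * cocycle h z"
  using cocycle_nonzero[OF assms]
  by (simp add: mob_def cocycle_def mat_mult_nth2 field_simps)

lemma mob_mult:
  assumes "g \<in> SL2R" "h \<in> SL2R" "z \<in> UHP"
  shows "mob (g ** h) z = mob g (mob h z)"
proof -
  have n: "cocycle h z \<noteq> 0" "cocycle g (mob h z) \<noteq> 0"
    using cocycle_nonzero assms mob_UHP by auto
  have "of_real ((g ** h) $ 1 $ 1) * z + of_real ((g ** h) $ 1 $ 2) =
    (of_real (g $ 1 $ 1) * mob h z + of_real (g $ 1 $ 2)) * cocycle h z"
    using n(1) by (simp add: mob_def mat_mult_nth2 field_simps) (simp add: cocycle_def algebra_simps)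
  thus ?thesis using n
    by (simp add: mob_def[of "g ** h"] mob_def[of g] cocycle_mult[OF assms(2,3)])
qed

lemma mob_1 [simp]: "mob (mat 1) z = z" and cocycle_1 [simp]: "cocycle (mat 1) z = 1"
  by (simp_all add: mob_def cocycle_def mat_def)

lemma mob_inv:
  assumes "g \<in> SL2R" "z \<in> UHP"
  shows "mob g (mob (matrix_inv g) z) = z" "mob (matrix_inv g) (mob g z) = z"
  using mob_mult[of g "matrix_inv g" z] mob_mult[of "matrix_inv g" g z] assms
  by (simp_all add: SL2R_inv matrix_inv_mult)

lemma cocycle_inv:
  assumes "g \<in> SL2R" "z \<in> UHP"
  shows "cocycle (matrix_inv g) (mob g z) * cocycle g z = 1"
  using cocycle_mult[OF assms, of "matrix_inv g"] assms by (simp add: matrix_inv_mult)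

lemma DERIV_mob:
  assumes "g \<in> SL2R" "z \<in> UHP"
  shows "(mob g has_field_derivative 1 / (cocycle g z)\<^sup>2) (at z within S)"
proof -
  let ?a = "g $ 1 $ 1" and ?b = "g $ 1 $ 2" and ?c = "g $ 2 $ 1" and ?d = "g $ 2 $ 2"
  have n: "of_real ?c * z + of_real ?d \<noteq> 0"
    using cocycle_nonzero[OF assms] by (simp add: cocycle_def)
  have d: "?a * ?d - ?b * ?c = 1" using assms(1) by (simp add: SL2R_def det_2)
  have "((\<lambda>z. (of_real ?a * z + of_real ?b) / (of_real ?c * z + of_real ?d)) has_field_derivative
      (of_real ?a * (of_real ?c * z + of_real ?d) - (of_real ?a * z + of_real ?b) * of_real ?c) /
      ((of_real ?c * z + of_real ?d) * (of_real ?c * z + of_real ?d))) (at z within S)"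
    by (rule DERIV_divide) (use n in \<open>auto intro!: derivative_eq_intros\<close>)
  also have "of_real ?a * (of_real ?c * z + of_real ?d) - (of_real ?a * z + of_real ?b) * of_real ?c =
      complex_of_real (?a * ?d - ?b * ?c)"
    by (simp add: algebra_simps)
  finally show ?thesis by (simp add: mob_def[abs_def] cocycle_def d power2_eq_square)
qed

lemma holomorphic_mob: "g \<in> SL2R \<Longrightarrow> mob g holomorphic_on UHP"
  using DERIV_mob by (auto simp: holomorphic_on_def field_differentiable_def)

lemma inj_on_mob: "g \<in> SL2R \<Longrightarrow> inj_on (mob g) UHP"
  by (metis inj_on_inverseI mob_inv(2))

lemma measurable_cocycle [measurable]: "cocycle g \<in> borel_measurable borel"
  unfolding cocycle_def by (intro borel_measurable_continuous_onI continuous_intros)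

lemma measurable_mob [measurable]: "mob g \<in> borel_measurable borel"
  unfolding mob_def by (intro borel_measurable_divide) (auto intro!: borel_measurable_continuous_onI continuous_intros)

lemma mob_image_eq:
  assumes "g \<in> SL2R" "A \<subseteq> UHP"
  shows "mob g ` A = {z \<in> UHP. mob (matrix_inv g) z \<in> A}"
proof (intro equalityI subsetI)
  fix z assume "z \<in> mob g ` A"
  thus "z \<in> {z \<in> UHP. mob (matrix_inv g) z \<in> A}"
    using assms mob_inv(2)[OF assms(1)] mob_UHP[OF assms(1)] by (auto simp: subset_iff)
next
  fix z assume "z \<in> {z \<in> UHP. mob (matrix_inv g) z \<in> A}"
  thus "z \<in> mob g ` A" using mob_inv(1)[OF assms(1)] by (auto intro!: image_eqI[of _ _ "mob (matrix_inv g) z"])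
qed

lemma mob_image_borel:
  assumes "g \<in> SL2R" "A \<subseteq> UHP" "A \<in> sets borel"
  shows "mob g ` A \<in> sets borel"
proof -
  have "{z \<in> UHP. mob (matrix_inv g) z \<in> A} = UHP \<inter> (mob (matrix_inv g) -` A \<inter> space borel)" by auto
  also have "\<dots> \<in> sets borel"
    using measurable_sets[OF measurable_mob assms(3)] by (intro sets.Int UHP_borel) auto
  finally show ?thesis by (simp add: mob_image_eq assms)
qed

text \<open>Compact rectangles on which the Jacobian of a Moebius map is bounded, so that the
  integrability hypothesis of \<open>emeasure_holomorphic_image\<close> can be met on each of
  them.\<close>

definition UHP_exh :: "nat \<Rightarrow> complex set" where
  "UHP_exh n = {z. \<bar>Re z\<bar> \<le> real n \<and> 1 / real (Suc n) \<le> Im z \<and> Im z \<le> real n}"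

lemma UHP_exh:
  shows "UHP_exh n \<subseteq> UHP" "UHP_exh n \<in> sets borel" "incseq UHP_exh" "(\<Union>n. UHP_exh n) = UHP"
    "emeasure lborel (UHP_exh n) < \<infinity>" "compact (UHP_exh n)"
proof -
  show sub: "UHP_exh n \<subseteq> UHP" for n
  proof
    fix z assume "z \<in> UHP_exh n"
    have "0 < 1 / real (Suc n)" by simp
    have "1 / real (Suc n) \<le> Im z" using \<open>z \<in> _\<close> by (simp add: UHP_exh_def)
    with \<open>0 < 1 / real (Suc n)\<close> have "0 < Im z" by (rule less_le_trans)
    thus "z \<in> UHP" by (simp add: UHP_def)
  qed
  have eq: "UHP_exh n = cbox (Complex (- real n) (1 / real (Suc n))) (Complex (real n) (real n))"
    by (auto simp: UHP_exh_def in_cbox_complex_iff)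
  show "compact (UHP_exh n)" "UHP_exh n \<in> sets borel" unfolding eq by auto
  show "emeasure lborel (UHP_exh n) < \<infinity>" unfolding eq by (rule emeasure_lborel_cbox_finite)
  show "incseq UHP_exh"
  proof (rule incseq_SucI)
    fix n
    have "1 / real (Suc (Suc n)) \<le> 1 / real (Suc n)" by (simp add: frac_le)
    thus "UHP_exh n \<subseteq> UHP_exh (Suc n)"
      unfolding UHP_exh_def by (auto intro: order_trans)
  qed
  show "(\<Union>n. UHP_exh n) = UHP"
  proof (intro equalityI subsetI)
    fix z assume "z \<in> UHP"
    hence "Im z > 0" by (simp add: UHP_def)
    obtain n where n: "max (max \<bar>Re z\<bar> (Im z)) (1 / Im z) \<le> real n" using real_arch_simple by blast
    have "1 / Im z \<le> real (Suc n)" using n by simp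
    hence "1 / real (Suc n) \<le> Im z" using \<open>Im z > 0\<close> by (simp add: field_simps)
    thus "z \<in> (\<Union>n. UHP_exh n)" using n by (auto simp: UHP_exh_def)
  qed (use sub in blast)
qed

lemma continuous_on_cocycle: "continuous_on S (cocycle g)"
  unfolding cocycle_def by (intro continuous_intros)

text \<open>The Jacobian need not be integrable over all of A, so the area formula is applied to the
  pieces of A in \<open>UHP_exh n\<close>, and both sides are continuous along this increasing
  sequence.\<close>

lemma emeasure_mob_image:
  assumes g: "g \<in> SL2R" and A: "A \<subseteq> UHP" "A \<in> sets borel"
  shows "emeasure lborel (mob g ` A) = (\<integral>\<^sup>+z. indicator A z * ennreal (1 / cmod (cocycle g z) ^ 4) \<partial>lborel)"
proof -
  let ?A = "\<lambda>n. A \<inter> UHP_exh n"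
  have eq: "emeasure lborel (mob g ` ?A n) =
      (\<integral>\<^sup>+z. indicator (?A n) z * ennreal (1 / cmod (cocycle g z) ^ 4) \<partial>lborel)" for n
  proof -
    have "compact ((\<lambda>z. 1 / cmod (cocycle g z) ^ 4) ` UHP_exh n)"
      using UHP_exh(1)[of n] cocycle_nonzero[OF g]
      by (intro compact_continuous_image continuous_intros continuous_on_cocycle UHP_exh) auto
    then obtain B where "\<forall>x\<in>(\<lambda>z. 1 / cmod (cocycle g z) ^ 4) ` UHP_exh n. norm x \<le> B"
      using compact_imp_bounded bounded_iff by metis
    hence B: "1 / cmod (cocycle g z) ^ 4 \<le> B" if "z \<in> UHP_exh n" for z
      using that by (auto dest!: bspec)
    have 4: "(cmod (1 / (cocycle g z)\<^sup>2))\<^sup>2 = 1 / cmod (cocycle g z) ^ 4" for z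
      by (simp add: norm_divide norm_power power_divide)
    have "emeasure lborel (mob g ` ?A n) =
        (\<integral>\<^sup>+z. indicator (?A n) z * ennreal ((cmod (1 / (cocycle g z)\<^sup>2))\<^sup>2) \<partial>lborel)"
    proof (rule emeasure_holomorphic_image)
      show "?A n \<in> sets borel" using A UHP_exh by auto
      thus "mob g ` ?A n \<in> sets borel" using A by (intro mob_image_borel g) auto
      show "(mob g has_field_derivative 1 / (cocycle g z)\<^sup>2) (at z within ?A n)" if "z \<in> ?A n" for z
        using A that by (intro DERIV_mob g) auto
      show "inj_on (mob g) (?A n)" using inj_on_mob[OF g] A by (meson inf.coboundedI1 inj_on_subset)
      show "integrable lborel (\<lambda>z. indicator (?A n) z * (cmod (1 / (cocycle g z)\<^sup>2))\<^sup>2)"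
        unfolding 4
      proof (rule Bochner_Integration.integrable_bound)
        show "integrable lborel (\<lambda>z. B * indicator (UHP_exh n) z)"
          using UHP_exh(2,5)[of n] by (intro integrable_mult_right integrable_real_indicator) auto
        show "(\<lambda>z. indicator (?A n) z * (1 / cmod (cocycle g z) ^ 4)) \<in> borel_measurable lborel"
          using A UHP_exh(2)[of n] by measurable
      next
        show "AE z in lborel. norm (indicator (?A n) z * (1 / cmod (cocycle g z) ^ 4)) \<le> norm (B * indicator (UHP_exh n) z)"
          using order_trans[OF B abs_ge_self] by (auto simp: indicator_def)
      qed
    qed
    thus ?thesis unfolding 4 .
  qed
  have inc: "incseq ?A" using UHP_exh(3) by (auto simp: incseq_def)
  have U: "A \<inter> (\<Union>n. UHP_exh n) = A" using A(1) UHP_exh(4) by blast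
  have "(SUP n. emeasure lborel (mob g ` ?A n)) = emeasure lborel (\<Union>n. mob g ` ?A n)"
  proof (rule SUP_emeasure_incseq)
    show "range (\<lambda>n. mob g ` ?A n) \<subseteq> sets lborel"
      using mob_image_borel[OF g] A UHP_exh(2) by (auto simp: subset_iff)
    show "incseq (\<lambda>n. mob g ` ?A n)" using inc by (auto simp: incseq_def)
  qed
  also have "(\<Union>n. mob g ` ?A n) = mob g ` A" using U by blast
  finally have 1: "emeasure lborel (mob g ` A) = (SUP n. emeasure lborel (mob g ` ?A n))" by simp
  \<comment> \<open>Regarding the right-hand side as a measure makes continuity from below available
    for it as well.\<close>
  define \<nu> where "\<nu> = density lborel (\<lambda>z. ennreal (1 / cmod (cocycle g z) ^ 4))"
  have \<nu>: "emeasure \<nu> X = (\<integral>\<^sup>+z. indicator X z * ennreal (1 / cmod (cocycle g z) ^ 4) \<partial>lborel)"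
    if "X \<in> sets borel" for X
    using that unfolding \<nu>_def by (subst emeasure_density) (auto simp: mult.commute)
  have "(SUP n. emeasure \<nu> (?A n)) = emeasure \<nu> (\<Union>n. ?A n)"
    using A UHP_exh(2) inc by (intro SUP_emeasure_incseq) (auto simp: \<nu>_def)
  thus ?thesis using 1 eq A UHP_exh(2) by (simp add: \<nu> U)
qed

lemma sets_hyp [simp, measurable_cong]: "sets hyp_area = sets borel"
  and space_hyp [simp]: "space hyp_area = UNIV"
  by (simp_all add: hyp_area_def)

lemma nn_integral_hyp:
  assumes [measurable]: "f \<in> borel_measurable borel"
  shows "(\<integral>\<^sup>+z. f z \<partial>hyp_area) = (\<integral>\<^sup>+z. ennreal (indicator UHP z / (Im z)\<^sup>2) * f z \<partial>lborel)"
  unfolding hyp_area_def by (intro nn_integral_density) auto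

text \<open>The map inverse to g has Jacobian |cocycle|^(-4) and multiplies Im by |cocycle|^(-2), so
  the factors cancel in dx dy / y^2.\<close>

lemma distr_mob_hyp:
  assumes g: "g \<in> SL2R"
  shows "distr hyp_area borel (mob g) = hyp_area"
proof (rule measure_eqI)
  fix A assume "A \<in> sets (distr hyp_area borel (mob g))"
  hence A [measurable]: "A \<in> sets borel" by simp
  let ?h = "matrix_inv g"
  have h: "?h \<in> SL2R" by (rule SL2R_inv[OF g])
  \<comment> \<open>\<nu>1 is the image of Lebesgue measure on the half plane and \<nu>2 has the
    Jacobian of the inverse map as density. Their equality extends \<open>emeasure_mob_image\<close>
    from areas of sets to integrals of functions.\<close>
  define \<nu>1 where "\<nu>1 = distr (density lborel (indicator UHP)) borel (mob g)"
  define \<nu>2 where "\<nu>2 = density lborel (\<lambda>z. indicator UHP z * ennreal (1 / cmod (cocycle ?h z) ^ 4))"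
  have "\<nu>1 = \<nu>2"
  proof (rule measure_eqI)
    fix X assume "X \<in> sets \<nu>1"
    hence X [measurable]: "X \<in> sets borel" by (simp add: \<nu>1_def)
    have "emeasure \<nu>1 X = emeasure lborel (UHP \<inter> mob g -` X)"
      using measurable_sets[OF measurable_mob[of g] X]
      by (simp add: \<nu>1_def emeasure_distr emeasure_density nn_integral_indicator
          flip: indicator_inter_arith)
    also have "UHP \<inter> mob g -` X = mob ?h ` (X \<inter> UHP)"
      using mob_image_eq[OF h, of "X \<inter> UHP"] mob_UHP[OF g] by (auto simp: matrix_inv_inv[OF g])
    also have "emeasure lborel (mob ?h ` (X \<inter> UHP)) =
        (\<integral>\<^sup>+z. indicator (X \<inter> UHP) z * ennreal (1 / cmod (cocycle ?h z) ^ 4) \<partial>lborel)"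
      by (rule emeasure_mob_image[OF h]) auto
    also have "\<dots> = emeasure \<nu>2 X"
      unfolding \<nu>2_def by (subst emeasure_density) (auto intro!: nn_integral_cong simp: indicator_def)
    finally show "emeasure \<nu>1 X = emeasure \<nu>2 X" .
  qed (simp add: \<nu>1_def \<nu>2_def)
  \<comment> \<open>Since \<open>mob ?h\<close> undoes \<open>mob g\<close>, composing \<phi> with
    \<open>mob g\<close> reproduces the factor 1 / (Im z)^2 of the invariant measure.\<close>
  define \<phi> where "\<phi> w = indicator A w * ennreal (1 / (Im (mob ?h w))\<^sup>2)" for w
  have [measurable]: "\<phi> \<in> borel_measurable borel" unfolding \<phi>_def by measurable
  have "emeasure (distr hyp_area borel (mob g)) A = (\<integral>\<^sup>+z. indicator A (mob g z) \<partial>hyp_area)"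
    by (subst nn_integral_indicator[symmetric], simp, subst nn_integral_distr) auto
  also have "\<dots> = (\<integral>\<^sup>+z. indicator UHP z * \<phi> (mob g z) \<partial>lborel)"
    by (subst nn_integral_hyp)
      (auto intro!: nn_integral_cong simp: \<phi>_def mob_inv[OF g] indicator_def)
  also have "\<dots> = (\<integral>\<^sup>+w. \<phi> w \<partial>\<nu>1)"
    unfolding \<nu>1_def by (subst nn_integral_distr) (auto simp: nn_integral_density)
  also have "\<dots> = (\<integral>\<^sup>+w. indicator UHP w * ennreal (1 / cmod (cocycle ?h w) ^ 4) * \<phi> w \<partial>lborel)"
    unfolding \<open>\<nu>1 = \<nu>2\<close> \<nu>2_def by (subst nn_integral_density) auto
  also have "\<dots> = (\<integral>\<^sup>+w. ennreal (indicator UHP w / (Im w)\<^sup>2) * indicator A w \<partial>lborel)"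
  proof (intro nn_integral_cong)
    fix w
    show "indicator UHP w * ennreal (1 / cmod (cocycle ?h w) ^ 4) * \<phi> w =
        ennreal (indicator UHP w / (Im w)\<^sup>2) * indicator A w"
    proof (cases "w \<in> UHP \<and> w \<in> A")
      case True
      have "1 / cmod (cocycle ?h w) ^ 4 * (1 / (Im (mob ?h w))\<^sup>2) = 1 / (Im w)\<^sup>2"
        using True cocycle_nonzero[OF h, of w]
        by (simp add: Im_mob[OF h] power_divide flip: power_mult)
      thus ?thesis using True by (simp add: \<phi>_def flip: ennreal_mult')
    qed (auto simp: \<phi>_def)
  qed
  also have "\<dots> = emeasure hyp_area A"
    by (subst nn_integral_hyp[symmetric]) auto
  finally show "emeasure (distr hyp_area borel (mob g)) A = emeasure hyp_area A" .
qed simp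

section \<open>Bergman estimate and the unitary representation\<close>

lemma distr_lborel_rotation:
  fixes \<omega> :: complex
  assumes "cmod \<omega> = 1"
  shows "distr lborel borel ((*) \<omega>) = lborel"
proof (rule lborel_eqI[symmetric])
  have \<omega>: "\<omega> \<noteq> 0" using assms by auto
  fix l u :: complex
  assume le: "\<And>b. b \<in> Basis \<Longrightarrow> l \<bullet> b \<le> u \<bullet> b"
  have eq: "(*) \<omega> -` box l u = (*) (inverse \<omega>) ` box l u"
    using \<omega> by (auto simp: image_iff field_simps intro!: bexI[of _ "\<omega> * _"])
  have "emeasure (distr lborel borel ((*) \<omega>)) (box l u) = emeasure lborel ((*) \<omega> -` box l u)"
    by (simp add: emeasure_distr)
  also have "\<dots> = emeasure lborel ((*) (inverse \<omega>) ` box l u)" by (simp only: eq)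
  also have "\<dots> = (\<integral>\<^sup>+z. indicator (box l u) z * ennreal ((cmod (inverse \<omega>))\<^sup>2) \<partial>lborel)"
  proof (rule emeasure_holomorphic_image)
    have "(*) \<omega> -` box l u \<in> sets borel"
      by (intro borel_open continuous_open_vimage open_box continuous_intros)
    thus "(*) (inverse \<omega>) ` box l u \<in> sets borel" by (simp only: eq)
    show "integrable lborel (\<lambda>z. indicator (box l u) z * (cmod (inverse \<omega>))\<^sup>2)"
      by (intro integrable_mult_left integrable_real_indicator) (auto simp: emeasure_lborel_box_finite[unfolded infinity_ennreal_def])
  qed (use \<omega> in \<open>auto intro!: derivative_eq_intros simp: inj_on_def\<close>)
  also have "\<dots> = emeasure lborel (box l u)" using assms by (simp add: norm_inverse)
  also have "\<dots> = (\<Prod>b\<in>Basis. (u - l) \<bullet> b)" using le by (rule emeasure_lborel_box)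
  finally show "emeasure (distr lborel borel ((*) \<omega>)) (box l u) = (\<Prod>b\<in>Basis. (u - l) \<bullet> b)" .
qed simp

text \<open>This is Cauchy's formula on the unit circle for the function sending \<zeta> to f (a +
  \<zeta> w). Fixing w rather than a radius prepares for integration over w and covers w =
  0.\<close>

lemma cmod_le_circle_mean:
  assumes "f holomorphic_on cball a r" "cmod w \<le> r"
  shows "ennreal (cmod (f a)) \<le>
    (\<integral>\<^sup>+s. ennreal (cmod (f (a + exp (2 * of_real pi * \<i> * of_real s) * w))) * indicator {0..1} s \<partial>lborel)"
proof -
  define h where "h \<zeta> = f (a + \<zeta> * w)" for \<zeta>
  define e where "e s = exp (2 * of_real pi * \<i> * of_real s)" for s :: real
  have ne: "cmod (e s) = 1" for s by (simp add: e_def)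
  have "h holomorphic_on cball 0 1"
    unfolding h_def
  proof (rule holomorphic_on_compose_gen[unfolded o_def, of _ _ f])
    show "(\<lambda>\<zeta>. a + \<zeta> * w) ` cball 0 1 \<subseteq> cball a r"
    proof clarsimp
      fix x :: complex assume "cmod x \<le> 1"
      hence "cmod x * cmod w \<le> 1 * r" using assms(2) by (intro mult_mono) auto
      thus "dist a (a + x * w) \<le> r" by (simp add: dist_norm norm_mult)
    qed
  qed (use assms in \<open>auto intro!: holomorphic_intros\<close>)
  hence hc: "continuous_on (cball 0 1) h" by (rule holomorphic_on_imp_continuous_on)
  have "((\<lambda>u. h u / (u - 0)) has_contour_integral (2 * of_real pi * \<i> * h 0)) (circlepath 0 1)"
    using \<open>h holomorphic_on cball 0 1\<close> by (intro Cauchy_integral_circlepath_simple) auto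
  hence "((\<lambda>s. (2 * of_real pi * \<i>) * h (e s)) has_integral (2 * of_real pi * \<i> * h 0)) {0..1}"
    unfolding has_contour_integral
    by (rule has_integral_eq[rotated])
      (unfold vector_derivative_circlepath, simp add: circlepath e_def field_simps)
  from has_integral_mult_right[OF this, of "1 / (2 * of_real pi * \<i>)"]
  have int: "((\<lambda>s. h (e s)) has_integral h 0) {0..1}" by simp
  have "continuous_on {0..1} (\<lambda>s. cmod (h (e s)))"
    by (intro continuous_on_norm continuous_on_compose2[OF hc]) (auto simp: ne e_def[abs_def] intro!: continuous_intros)
  hence in2: "(\<lambda>s. cmod (h (e s))) integrable_on {0..1}" by (rule integrable_continuous_interval)
  have "cmod (h 0) \<le> integral {0..1} (\<lambda>s. cmod (h (e s)))"
    using integral_norm_bound_integral[OF has_integral_integrable[OF int] in2] int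
    by (simp add: integral_unique)
  hence "ennreal (cmod (h 0)) \<le> ennreal (integral {0..1} (\<lambda>s. cmod (h (e s))))" by (rule ennreal_leI)
  also have "\<dots> = (\<integral>\<^sup>+s. ennreal (cmod (h (e s))) * indicator {0..1} s \<partial>lborel)"
    using in2 by (intro nn_integral_has_integral_lebesgue'[symmetric]) auto
  finally show ?thesis unfolding h_def e_def by simp
qed

text \<open>Polar coordinates are avoided: the circle means are integrated over all w in the disc,
  and after Fubini the rotation by \<open>e s\<close> leaves the inner integral unchanged.\<close>

lemma cmod_le_disc_integral:
  assumes f: "f holomorphic_on cball a r"
  shows "ennreal (cmod (f a)) * emeasure lborel (cball (0 :: complex) r) \<le>
    (\<integral>\<^sup>+z. indicator (cball a r) z * ennreal (cmod (f z)) \<partial>lborel)"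
proof -
  \<comment> \<open>Extension by 0 outside the disc lets rotations and translations act on integrals
    over the whole plane.\<close>
  define F where "F z = cmod (indicator (cball a r) z *\<^sub>R f z)" for z
  define e where "e s = exp (2 * of_real pi * \<i> * of_real s)" for s :: real
  have [measurable]: "e \<in> borel_measurable borel"
    unfolding e_def by (intro borel_measurable_continuous_onI continuous_intros)
  have ne: "cmod (e s) = 1" for s by (simp add: e_def)
  have [measurable]: "F \<in> borel_measurable borel"
    unfolding F_def using holomorphic_on_imp_continuous_on[OF f]
    by (intro borel_measurable_norm[THEN measurable_compose[rotated]] borel_measurable_continuous_on_indicator measurable_compose[OF _ borel_measurable_norm]) auto
  have "ennreal (cmod (f a)) * emeasure lborel (cball (0 :: complex) r) =
      (\<integral>\<^sup>+w. ennreal (cmod (f a)) * indicator (cball (0 :: complex) r) w \<partial>lborel)"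
    by (subst nn_integral_cmult_indicator) auto
  also have "\<dots> \<le> (\<integral>\<^sup>+w. (\<integral>\<^sup>+s. ennreal (F (a + e s * w)) * indicator {0..1} s \<partial>lborel) \<partial>lborel)"
  proof (rule nn_integral_mono)
    fix w :: complex
    show "ennreal (cmod (f a)) * indicator (cball 0 r) w \<le>
        (\<integral>\<^sup>+s. ennreal (F (a + e s * w)) * indicator {0..1} s \<partial>lborel)"
    proof (cases "w \<in> cball 0 r")
      case True
      have "F (a + e s * w) = cmod (f (a + e s * w))" for s
        using True by (simp add: F_def dist_norm norm_mult ne)
      thus ?thesis using cmod_le_circle_mean[OF f, of w] True by (simp add: e_def)
    qed simp
  qed
  also have "\<dots> = (\<integral>\<^sup>+s. (\<integral>\<^sup>+w. ennreal (F (a + e s * w)) * indicator {0..1} s \<partial>lborel) \<partial>lborel)"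
    by (rule lborel_pair.Fubini') measurable
  also have "\<dots> = (\<integral>\<^sup>+s. (\<integral>\<^sup>+z. ennreal (F z) \<partial>lborel) * indicator {0..1 :: real} s \<partial>lborel)"
  proof (intro nn_integral_cong)
    fix s :: real
    have "(\<integral>\<^sup>+w. ennreal (F (a + e s * w)) \<partial>lborel) = (\<integral>\<^sup>+w. ennreal (F (a + w)) \<partial>lborel)"
      by (subst (2) distr_lborel_rotation[OF ne[of s], symmetric], subst nn_integral_distr) auto
    also have "\<dots> = (\<integral>\<^sup>+w. ennreal (F w) \<partial>lborel)"
      by (subst (2) lborel_distr_plus[of a, symmetric], subst nn_integral_distr) auto
    finally show "(\<integral>\<^sup>+w. ennreal (F (a + e s * w)) * indicator {0..1} s \<partial>lborel) =
        (\<integral>\<^sup>+z. ennreal (F z) \<partial>lborel) * indicator {0..1} s"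
      by (subst nn_integral_multc) auto
  qed
  also have "\<dots> = (\<integral>\<^sup>+z. ennreal (F z) \<partial>lborel)" by (subst nn_integral_cmult_indicator) auto
  also have "\<dots> = (\<integral>\<^sup>+z. indicator (cball a r) z * ennreal (cmod (f z)) \<partial>lborel)"
    by (intro nn_integral_cong) (simp add: F_def indicator_def)
  finally show ?thesis .
qed

section \<open>The weighted measure relative to the invariant one\<close>

lemma sets_nu13 [simp, measurable_cong]: "sets nu13 = sets borel"
  and space_nu13 [simp]: "space nu13 = UNIV"
  by (simp_all add: nu13_def)

text \<open>The weight exponent 11 = 13 - 2 becomes 13 relative to the invariant measure, which is
  what the automorphy factor in \<open>pi13\<close> compensates.\<close>

lemma nu13_hyp: "nu13 = density hyp_area (\<lambda>z. ennreal (indicator UHP z * Im z ^ 13))"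
proof -
  have [measurable]: "(\<lambda>z. ennreal (indicator UHP z * Im z ^ 13)) \<in> borel_measurable lborel"
    "(\<lambda>z. ennreal (indicator UHP z / (Im z)\<^sup>2)) \<in> borel_measurable lborel" by measurable
  have "ennreal (indicator UHP z / (Im z)\<^sup>2) * ennreal (indicator UHP z * Im z ^ 13) =
      ennreal (indicator UHP z * Im z ^ (13 - 2))" for z
  proof (cases "z \<in> UHP")
    case True
    hence "Im z > 0" by (rule Im_pos)
    have "1 / (Im z)\<^sup>2 * Im z ^ 13 = Im z ^ (13 - 2)"
      using \<open>Im z > 0\<close> by (simp add: field_simps flip: power_add)
    thus ?thesis using True \<open>Im z > 0\<close> by (simp flip: ennreal_mult)
  qed simp
  thus ?thesis unfolding hyp_area_def nu13_def
    by (subst density_density_eq) auto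
qed

lemma AE_hyp_UHP: "AE z in hyp_area. z \<in> UHP"
  unfolding hyp_area_def by (subst AE_density) (auto simp: indicator_def)

lemma integral_nu13:
  fixes f :: "complex \<Rightarrow> 'a :: {banach, second_countable_topology}"
  assumes "f \<in> borel_measurable borel"
  shows "(LINT z|nu13. f z) = (LINT z|hyp_area. (indicator UHP z * Im z ^ 13) *\<^sub>R f z)"
    and "integrable nu13 f \<longleftrightarrow> integrable hyp_area (\<lambda>z. (indicator UHP z * Im z ^ 13) *\<^sub>R f z)"
proof -
  have [measurable]: "(\<lambda>z. indicator UHP z * Im z ^ 13) \<in> borel_measurable hyp_area"
    "f \<in> borel_measurable hyp_area"
    using assms by measurable
  have nn: "AE z in hyp_area. 0 \<le> indicator UHP z * Im z ^ 13"
    by (intro AE_I2) (auto simp: indicator_def dest: Im_pos)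
  show "(LINT z|nu13. f z) = (LINT z|hyp_area. (indicator UHP z * Im z ^ 13) *\<^sub>R f z)"
    unfolding nu13_hyp by (rule integral_density[OF _ _ nn]) auto
  show "integrable nu13 f \<longleftrightarrow> integrable hyp_area (\<lambda>z. (indicator UHP z * Im z ^ 13) *\<^sub>R f z)"
    unfolding nu13_hyp by (rule integrable_density[OF _ _ nn]) auto
qed

lemma integral_mob_hyp:
  fixes f :: "complex \<Rightarrow> 'a :: {banach, second_countable_topology}"
  assumes "g \<in> SL2R" "f \<in> borel_measurable borel"
  shows "(LINT z|hyp_area. f (mob g z)) = (LINT z|hyp_area. f z)"
    and "integrable hyp_area (\<lambda>z. f (mob g z)) \<longleftrightarrow> integrable hyp_area f"
proof -
  have m: "mob g \<in> measurable hyp_area borel" by measurable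
  show "(LINT z|hyp_area. f (mob g z)) = (LINT z|hyp_area. f z)"
    using integral_distr[OF m assms(2)] by (simp add: distr_mob_hyp[OF assms(1)])
  show "integrable hyp_area (\<lambda>z. f (mob g z)) \<longleftrightarrow> integrable hyp_area f"
    using integrable_distr_eq[OF m assms(2)] by (simp add: distr_mob_hyp[OF assms(1)])
qed

lemma H13_L2: "f \<in> H13 \<Longrightarrow> f \<in> L2 nu13"
  and H13_holomorphic: "f \<in> H13 \<Longrightarrow> f holomorphic_on UHP"
  and H13_outside: "f \<in> H13 \<Longrightarrow> z \<notin> UHP \<Longrightarrow> f z = 0"
  by (auto simp: H13_def)

lemma L2_nu13_measurable: "f \<in> L2 nu13 \<Longrightarrow> f \<in> borel_measurable borel"
  using L2_measurable[of f nu13] by (simp cong: measurable_cong_sets)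

lemma L2_hyp_measurable: "f \<in> L2 hyp_area \<Longrightarrow> f \<in> borel_measurable borel"
  using L2_measurable[of f hyp_area] by (simp cong: measurable_cong_sets)

lemma H13_measurable: "f \<in> H13 \<Longrightarrow> f \<in> borel_measurable borel"
  by (rule L2_nu13_measurable[OF H13_L2])

section \<open>Unitarity of the representation\<close>

lemma pi13_apply:
  assumes "g \<in> SL2R" "z \<in> UHP"
  shows "pi13 g f z = f (mob (matrix_inv g) z) / cocycle (matrix_inv g) z ^ 13"
  using assms by (simp add: pi13_def)

lemma pi13_measurable:
  assumes [measurable]: "f \<in> borel_measurable borel"
  shows "pi13 g f \<in> borel_measurable borel"
  unfolding pi13_def by measurable

lemma pi13_weight:
  assumes "g \<in> SL2R" "z \<in> UHP"
  shows "(Im z ^ 13) *\<^sub>R (pi13 g \<xi> z * cnj (pi13 g \<psi> z)) =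
    (Im (mob (matrix_inv g) z) ^ 13) *\<^sub>R (\<xi> (mob (matrix_inv g) z) * cnj (\<psi> (mob (matrix_inv g) z)))"
proof -
  let ?c = "cocycle (matrix_inv g) z"
  have "?c \<noteq> 0" using cocycle_nonzero[OF SL2R_inv] assms by auto
  have "Im (mob (matrix_inv g) z) ^ 13 = Im z ^ 13 / (cmod ?c)\<^sup>2 ^ 13"
    using Im_mob[OF SL2R_inv[OF assms(1)], of z] by (simp add: power_divide)
  moreover have "complex_of_real ((cmod ?c)\<^sup>2 ^ 13) = ?c ^ 13 * cnj ?c ^ 13"
    by (simp add: power_mult_distrib[symmetric] mult_cnj_self)
  ultimately show ?thesis using \<open>?c \<noteq> 0\<close>
    by (simp add: pi13_apply[OF assms] scaleR_conv_of_real)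
qed

text \<open>The multiplier f is carried along because two cases are wanted: f = 1 gives unitarity of
  \<open>pi13\<close>, and a symbol f gives the covariance of Toeplitz operators.\<close>

lemma pi13_transfer:
  assumes g: "g \<in> SL2R" and [measurable]: "f \<in> borel_measurable borel"
    "\<xi> \<in> borel_measurable borel" "\<psi> \<in> borel_measurable borel"
  shows "(LINT z|nu13. f (mob (matrix_inv g) z) * (pi13 g \<xi> z * cnj (pi13 g \<psi> z))) =
      (LINT z|nu13. f z * (\<xi> z * cnj (\<psi> z)))" (is ?A)
    and "integrable nu13 (\<lambda>z. f (mob (matrix_inv g) z) * (pi13 g \<xi> z * cnj (pi13 g \<psi> z))) \<longleftrightarrow>
      integrable nu13 (\<lambda>z. f z * (\<xi> z * cnj (\<psi> z)))" (is ?B)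
proof -
  note [measurable] = pi13_measurable
  have cnj [measurable]: "cnj \<in> borel_measurable borel"
    by (intro borel_measurable_continuous_onI continuous_intros)
  define \<Phi> where "\<Phi> z = (indicator UHP z * Im z ^ 13) *\<^sub>R (f z * (\<xi> z * cnj (\<psi> z)))" for z
  have [measurable]: "\<Phi> \<in> borel_measurable borel" unfolding \<Phi>_def by measurable
  have "AE z in hyp_area. (indicator UHP z * Im z ^ 13) *\<^sub>R (f (mob (matrix_inv g) z) * (pi13 g \<xi> z * cnj (pi13 g \<psi> z)))
      = \<Phi> (mob (matrix_inv g) z)"
    using AE_hyp_UHP
  proof eventually_elim
    case (elim z)
    thus ?case using pi13_weight[OF g elim, of \<xi> \<psi>] mob_UHP[OF SL2R_inv[OF g] elim]
      by (simp add: \<Phi>_def) (metis mult_scaleR_right)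
  qed
  note c = this
  show ?A
    by (subst (1 2) integral_nu13, measurable, subst integral_cong_AE[OF _ _ c], measurable)
      (simp add: integral_mob_hyp(1)[OF SL2R_inv[OF g]] flip: \<Phi>_def)
  show ?B
    by (subst (1 2) integral_nu13, measurable, subst integrable_cong_AE[OF _ _ c], measurable)
      (simp add: integral_mob_hyp(2)[OF SL2R_inv[OF g]] flip: \<Phi>_def)
qed

lemma pi13_H13:
  assumes g: "g \<in> SL2R" and \<xi>: "\<xi> \<in> H13"
  shows "pi13 g \<xi> \<in> H13"
  unfolding H13_def
proof (intro CollectI conjI allI impI)
  have [measurable]: "\<xi> \<in> borel_measurable borel" using \<xi> by (rule H13_measurable)
  have "integrable nu13 (\<lambda>z. 1 * (pi13 g \<xi> z * cnj (pi13 g \<xi> z)))"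
    by (subst pi13_transfer(2)[OF g]) (use L2_integrable_mult[OF H13_L2[OF \<xi>] H13_L2[OF \<xi>]] in auto)
  hence "integrable nu13 (\<lambda>z. cmod (pi13 g \<xi> z * cnj (pi13 g \<xi> z)))" by simp
  thus "pi13 g \<xi> \<in> L2 nu13"
    by (auto simp: L2_def norm_mult power2_eq_square pi13_measurable cong: measurable_cong_sets)
  have "(\<lambda>z. \<xi> (mob (matrix_inv g) z) / cocycle (matrix_inv g) z ^ 13) holomorphic_on UHP"
  proof (intro holomorphic_on_divide holomorphic_on_power)
    show "(\<lambda>z. \<xi> (mob (matrix_inv g) z)) holomorphic_on UHP"
      using holomorphic_on_compose_gen[OF holomorphic_mob[OF SL2R_inv[OF g]] H13_holomorphic[OF \<xi>]]
        mob_UHP[OF SL2R_inv[OF g]] by (auto simp: o_def)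
    show "cocycle (matrix_inv g) holomorphic_on UHP"
      unfolding cocycle_def by (intro holomorphic_intros)
  qed (use cocycle_nonzero[OF SL2R_inv[OF g]] in auto)
  thus "pi13 g \<xi> holomorphic_on UHP"
    by (rule holomorphic_transform) (simp add: pi13_def)
qed (simp add: pi13_def)

lemma pi13_ip:
  assumes "g \<in> SL2R" "\<xi> \<in> H13" "\<psi> \<in> H13"
  shows "ipH (pi13 g \<xi>) (pi13 g \<psi>) = ipH \<xi> \<psi>"
  using pi13_transfer(1)[of g "\<lambda>_. 1" \<xi> \<psi>] assms by (simp add: ip_def H13_measurable)

lemma pi13_inverse:
  assumes g: "g \<in> SL2R" and \<xi>: "\<xi> \<in> H13"
  shows "pi13 g (pi13 (matrix_inv g) \<xi>) = \<xi>"
proof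
  fix z
  show "pi13 g (pi13 (matrix_inv g) \<xi>) z = \<xi> z"
  proof (cases "z \<in> UHP")
    case True
    have w: "mob (matrix_inv g) z \<in> UHP" using mob_UHP[OF SL2R_inv[OF g] True] .
    have "cocycle g (mob (matrix_inv g) z) * cocycle (matrix_inv g) z = 1"
      using cocycle_inv[OF SL2R_inv[OF g] True] by (simp add: matrix_inv_inv[OF g])
    hence "cocycle g (mob (matrix_inv g) z) ^ 13 * cocycle (matrix_inv g) z ^ 13 = 1"
      by (simp flip: power_mult_distrib)
    thus ?thesis
      by (simp add: pi13_apply[OF g True] pi13_apply[OF SL2R_inv[OF g] w] matrix_inv_inv[OF g]
          mob_inv[OF g True])
  qed (use H13_outside[OF \<xi>] in \<open>simp add: pi13_def\<close>)
qed

lemma pi13_inverse':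
  assumes g: "g \<in> SL2R" and \<xi>: "\<xi> \<in> H13"
  shows "pi13 (matrix_inv g) (pi13 g \<xi>) = \<xi>"
  using pi13_inverse[OF SL2R_inv[OF g] \<xi>] by (simp add: matrix_inv_inv[OF g])

lemma pi13_adjoint:
  assumes g: "g \<in> SL2R" and "\<xi> \<in> H13" "\<psi> \<in> H13"
  shows "ipH (pi13 (matrix_inv g) \<xi>) \<psi> = ipH \<xi> (pi13 g \<psi>)"
  using pi13_ip[OF g pi13_H13[OF SL2R_inv[OF g] assms(2)] assms(3)]
  by (simp add: pi13_inverse[OF g assms(2)])

lemma inv_into_pi13:
  assumes g: "g \<in> SL2R" and "\<xi> \<in> H13"
  shows "inv_into H13 (pi13 g) \<xi> = pi13 (matrix_inv g) \<xi>"
proof (rule inv_into_f_eq)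
  show "inj_on (pi13 g) H13" by (metis g inj_on_inverseI pi13_inverse')
qed (use pi13_inverse pi13_H13 SL2R_inv assms in auto)

section \<open>The pointwise Bergman bound\<close>

lemma H13_lin:
  assumes "f \<in> H13" "h \<in> H13"
  shows "(\<lambda>z. a * f z + b * h z) \<in> H13"
  using assms by (auto simp: H13_def intro!: L2_lin holomorphic_intros)

lemma H13_0 [simp]: "(\<lambda>_. 0) \<in> H13" by (simp add: H13_def)

lemma H13_diff: "f \<in> H13 \<Longrightarrow> h \<in> H13 \<Longrightarrow> (\<lambda>z. f z - h z) \<in> H13"
  using H13_lin[of f h 1 "-1"] by simp

lemma H13_scale: "f \<in> H13 \<Longrightarrow> (\<lambda>z. a * f z) \<in> H13"
  using H13_lin[of f f a 0] by simp

lemma H13_sum: "(\<And>i. i \<in> I \<Longrightarrow> f i \<in> H13) \<Longrightarrow> (\<lambda>z. \<Sum>i\<in>I. f i z) \<in> H13"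
  by (induction I rule: infinite_finite_induct) (use H13_lin[of _ _ 1 1] in auto)

text \<open>On the disc of radius 1/2 about i one has Im z \<ge> 1/2, so the weight Im z ^ 11 is at
  least 2^(-11); the division by the area of the disc comes from the mean value inequality.\<close>

definition bergman_const :: real where
  "bergman_const = 2 ^ 11 / measure lborel (cball (0 :: complex) (1/2))"

lemma bergman_const_nonneg: "bergman_const \<ge> 0" by (simp add: bergman_const_def)

text \<open>The mean value inequality is applied to the square of f, so that the norm of f appears
  without Cauchy-Schwarz.\<close>

lemma H13_bound_at_i:
  assumes f: "f \<in> H13"
  shows "(cmod (f \<i>))\<^sup>2 \<le> bergman_const * nsq nu13 f"
proof -
  let ?m = "measure lborel (cball (0 :: complex) (1/2))"
  have Im: "Im z \<ge> 1/2" if "z \<in> cball \<i> (1/2)" for z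
    using that abs_Im_le_cmod[of "\<i> - z"] by (auto simp: dist_norm)
  have sub: "cball \<i> (1/2) \<subseteq> UHP" using Im by (force simp: UHP_def)
  have [measurable]: "f \<in> borel_measurable borel" using H13_measurable[OF f] .
  have hol: "(\<lambda>z. (f z)\<^sup>2) holomorphic_on cball \<i> (1/2)"
    using holomorphic_on_subset[OF H13_holomorphic[OF f] sub] by (rule holomorphic_on_power)
  have mm: "emeasure lborel (cball (0 :: complex) (1/2)) = ennreal ?m"
    using emeasure_lborel_cball_finite[of "0 :: complex" "1/2"]
    by (intro emeasure_eq_ennreal_measure) auto
  have "?m > 0" by simp
  have "ennreal ((cmod (f \<i>))\<^sup>2 * ?m) = ennreal (cmod ((f \<i>)\<^sup>2)) * emeasure lborel (cball (0 :: complex) (1/2))"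
    by (simp add: mm norm_power ennreal_mult)
  also have "\<dots> \<le> (\<integral>\<^sup>+z. indicator (cball \<i> (1/2)) z * ennreal (cmod ((f z)\<^sup>2)) \<partial>lborel)"
    by (rule cmod_le_disc_integral[OF hol])
  also have "\<dots> \<le> (\<integral>\<^sup>+z. ennreal (2 ^ 11) * (ennreal (indicator UHP z * Im z ^ (13 - 2)) * ennreal ((cmod (f z))\<^sup>2)) \<partial>lborel)"
  proof (rule nn_integral_mono)
    fix z
    show "indicator (cball \<i> (1/2)) z * ennreal (cmod ((f z)\<^sup>2)) \<le>
        ennreal (2 ^ 11) * (ennreal (indicator UHP z * Im z ^ (13 - 2)) * ennreal ((cmod (f z))\<^sup>2))"
    proof (cases "z \<in> cball \<i> (1/2)")
      case True
      have "1 \<le> (2 * Im z) ^ 11" using Im[OF True] by (intro one_le_power) auto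
      hence "1 \<le> 2 ^ 11 * Im z ^ 11" by (simp only: power_mult_distrib)
      hence "1 * (cmod (f z))\<^sup>2 \<le> (2 ^ 11 * Im z ^ 11) * (cmod (f z))\<^sup>2" by (intro mult_right_mono) auto
      moreover have "Im z \<ge> 0" using Im[OF True] by auto
      ultimately have "ennreal ((cmod (f z))\<^sup>2) \<le> ennreal (2 ^ 11 * (Im z ^ (13 - 2) * (cmod (f z))\<^sup>2))"
        by (intro ennreal_leI) (simp add: mult.assoc)
      also have "\<dots> = ennreal (2 ^ 11) * (ennreal (Im z ^ (13 - 2)) * ennreal ((cmod (f z))\<^sup>2))"
        using \<open>Im z \<ge> 0\<close> by (subst ennreal_mult, simp, simp, subst ennreal_mult) auto
      finally show ?thesis using True sub by (auto simp: norm_power subset_iff)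
    qed simp
  qed
  also have "\<dots> = ennreal (2 ^ 11) * (\<integral>\<^sup>+z. ennreal ((cmod (f z))\<^sup>2) \<partial>nu13)"
    unfolding nu13_def by (subst nn_integral_cmult, measurable, subst nn_integral_density) auto
  also have "(\<integral>\<^sup>+z. ennreal ((cmod (f z))\<^sup>2) \<partial>nu13) = ennreal (nsq nu13 f)"
    unfolding nsq_def using L2_integrable[OF H13_L2[OF f]] by (intro nn_integral_eq_integral) auto
  also have "ennreal (2 ^ 11) * ennreal (nsq nu13 f) = ennreal (2 ^ 11 * nsq nu13 f)"
    by (rule ennreal_mult[symmetric]) auto
  finally have "(cmod (f \<i>))\<^sup>2 * ?m \<le> 2 ^ 11 * nsq nu13 f" by (subst (asm) ennreal_le_iff) auto
  thus ?thesis using \<open>?m > 0\<close> by (simp add: bergman_const_def field_simps)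
qed

lemma H13_bound:
  assumes f: "f \<in> H13" and z: "z \<in> UHP"
  shows "(cmod (f z))\<^sup>2 * Im z ^ 13 \<le> bergman_const * nsq nu13 f"
proof -
  define y where "y = Im z"
  have y: "y > 0" using z by (simp add: y_def UHP_def)
  \<comment> \<open>This matrix acts as the affine map sending w to y w + Re z, so it takes i to z;
    its cocycle at i is 1 / sqrt y, whence the factor y ^ 13.\<close>
  define g :: mat2 where "g = vector [vector [sqrt y, Re z / sqrt y], vector [0, 1 / sqrt y]]"
  have g: "g \<in> SL2R" using y by (simp add: SL2R_def g_def det_2)
  have gi: "mob g \<i> = z" using y
    by (simp add: mob_def cocycle_def g_def complex_eq_iff y_def flip: of_real_mult)
  have i: "\<i> \<in> UHP" by (simp add: UHP_def)
  let ?h = "matrix_inv g"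
  have h: "?h \<in> SL2R" by (rule SL2R_inv[OF g])
  have "cmod (pi13 ?h f \<i>) = cmod (f z) * sqrt y ^ 13"
    using y unfolding pi13_apply[OF h i] matrix_inv_inv[OF g] gi
    by (simp add: cocycle_def g_def norm_divide norm_mult norm_power power_divide)
  hence "(cmod (pi13 ?h f \<i>))\<^sup>2 = (cmod (f z))\<^sup>2 * (sqrt y ^ 13)\<^sup>2" by (simp add: power_mult_distrib)
  also have "(sqrt y ^ 13)\<^sup>2 = (sqrt y ^ 2) ^ 13" by (simp flip: power_mult)
  also have "sqrt y ^ 2 = y" using y by simp
  finally have "(cmod (f z))\<^sup>2 * y ^ 13 = (cmod (pi13 ?h f \<i>))\<^sup>2" by simp
  also have "\<dots> \<le> bergman_const * nsq nu13 (pi13 ?h f)" by (rule H13_bound_at_i[OF pi13_H13[OF h f]])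
  also have "nsq nu13 (pi13 ?h f) = nsq nu13 f" by (simp add: nsq_eq_ip pi13_ip[OF h f f])
  finally show ?thesis by (simp add: y_def)
qed

lemma H13_eq_0:
  assumes "f \<in> H13" "nsq nu13 f = 0"
  shows "f = (\<lambda>_. 0)"
proof
  fix z show "f z = 0"
  proof (cases "z \<in> UHP")
    case True
    hence "Im z ^ 13 > 0" by (simp add: UHP_def)
    thus ?thesis using H13_bound[OF assms(1) True] assms(2) by (simp add: mult_le_0_iff)
  qed (use H13_outside[OF assms(1)] in auto)
qed

lemma H13_eqI:
  assumes "f \<in> H13" "h \<in> H13" "\<And>\<psi>. \<psi> \<in> H13 \<Longrightarrow> ipH f \<psi> = ipH h \<psi>"
  shows "f = h"
proof -
  have "nsq nu13 (\<lambda>z. f z - h z) = 0"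
    using assms H13_diff[OF assms(1,2)] by (simp add: nsq_eq_ip ip_diff_left H13_L2)
  from H13_eq_0[OF H13_diff[OF assms(1,2)] this] show ?thesis by (simp add: fun_eq_iff)
qed

section \<open>Completeness and orthonormal bases\<close>

text \<open>By the Bergman bound a norm Cauchy sequence is uniformly Cauchy on every half plane Im z
  \<ge> \<delta>. So the pointwise limit is holomorphic, and Fatou's lemma turns pointwise
  convergence back into convergence in norm.\<close>

lemma H13_complete:
  assumes f: "\<And>n. f n \<in> H13"
    and C: "\<And>\<epsilon>. \<epsilon> > 0 \<Longrightarrow> \<exists>N. \<forall>m\<ge>N. \<forall>n\<ge>N. nsq nu13 (\<lambda>z. f m z - f n z) \<le> \<epsilon>"
  shows "\<exists>\<zeta>\<in>H13. (\<lambda>n. nsq nu13 (\<lambda>z. f n z - \<zeta> z)) \<longlonglongrightarrow> 0"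
proof -
  define \<zeta> where "\<zeta> z = lim (\<lambda>n. f n z)" for z
  have unif: "\<exists>N. \<forall>m\<ge>N. \<forall>n\<ge>N. \<forall>z. Im z \<ge> \<delta> \<longrightarrow> cmod (f m z - f n z) \<le> e"
    if "e > 0" "\<delta> > 0" for e \<delta>
  proof -
    \<comment> \<open>Chosen so that the Bergman bound at height at least \<delta> yields e^2;
      adding 1 keeps the denominator positive, since \<open>bergman_const\<close> is only known to
      be nonnegative here.\<close>
    define \<epsilon> where "\<epsilon> = e\<^sup>2 * \<delta> ^ 13 / (bergman_const + 1)"
    have "\<epsilon> > 0" using that bergman_const_nonneg by (simp add: \<epsilon>_def)
    then obtain N where N: "\<forall>m\<ge>N. \<forall>n\<ge>N. nsq nu13 (\<lambda>z. f m z - f n z) \<le> \<epsilon>" using C by blast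
    have "cmod (f m z - f n z) \<le> e" if "m \<ge> N" "n \<ge> N" "Im z \<ge> \<delta>" for m n z
    proof -
      have z: "z \<in> UHP" using that \<open>\<delta> > 0\<close> by (simp add: UHP_def)
      have "(cmod (f m z - f n z))\<^sup>2 * \<delta> ^ 13 \<le> (cmod (f m z - f n z))\<^sup>2 * Im z ^ 13"
        using that \<open>\<delta> > 0\<close> by (intro mult_left_mono power_mono) auto
      also have "\<dots> \<le> bergman_const * nsq nu13 (\<lambda>z. f m z - f n z)"
        by (rule H13_bound[OF H13_diff[OF f f] z])
      also have "\<dots> \<le> (bergman_const + 1) * \<epsilon>" using N that bergman_const_nonneg by (intro mult_mono) auto
      also have "\<dots> = e\<^sup>2 * \<delta> ^ 13" using bergman_const_nonneg by (simp add: \<epsilon>_def)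
      finally have "(cmod (f m z - f n z))\<^sup>2 \<le> e\<^sup>2" using \<open>\<delta> > 0\<close> by simp
      thus ?thesis using \<open>e > 0\<close> by (simp add: power2_le_iff_abs_le)
    qed
    thus ?thesis by blast
  qed
  have lim: "(\<lambda>n. f n z) \<longlonglongrightarrow> \<zeta> z" for z
  proof (cases "z \<in> UHP")
    case True
    have "Cauchy (\<lambda>n. f n z)"
    proof (rule CauchyI)
      fix e :: real assume "e > 0"
      have "e / 2 > 0" "e / 2 < e" using \<open>e > 0\<close> by auto
      obtain N where N: "\<forall>m\<ge>N. \<forall>n\<ge>N. \<forall>w. Im w \<ge> Im z \<longrightarrow> cmod (f m w - f n w) \<le> e / 2"
        using unif[OF \<open>e / 2 > 0\<close> Im_pos[OF True]] by blast
      have "norm (f m z - f n z) < e" if "m \<ge> N" "n \<ge> N" for m n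
        using N[rule_format, OF that order_refl] \<open>e / 2 < e\<close> by linarith
      thus "\<exists>M. \<forall>m\<ge>M. \<forall>n\<ge>M. norm (f m z - f n z) < e" by blast
    qed
    thus ?thesis unfolding \<zeta>_def by (simp add: Cauchy_convergent_iff convergent_LIMSEQ_iff)
  next
    case False
    hence "(\<lambda>n. f n z) = (\<lambda>_. 0)" using H13_outside[OF f] by auto
    thus ?thesis by (simp add: \<zeta>_def)
  qed
  have unif': "\<exists>N. \<forall>m\<ge>N. \<forall>z. Im z \<ge> \<delta> \<longrightarrow> cmod (f m z - \<zeta> z) \<le> e" if "e > 0" "\<delta> > 0" for e \<delta>
  proof -
    obtain N where N: "\<forall>m\<ge>N. \<forall>n\<ge>N. \<forall>z. Im z \<ge> \<delta> \<longrightarrow> cmod (f m z - f n z) \<le> e"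
      using unif[OF \<open>e > 0\<close> \<open>\<delta> > 0\<close>] by blast
    have "cmod (f m z - \<zeta> z) \<le> e" if "m \<ge> N" "Im z \<ge> \<delta>" for m z
      by (rule tendsto_upperbound[OF tendsto_norm[OF tendsto_diff[OF tendsto_const lim]]])
        (use N that in \<open>auto intro!: eventually_sequentiallyI[of N]\<close>)
    thus ?thesis by blast
  qed
  have hol: "\<zeta> holomorphic_on UHP"
  proof (rule holomorphic_uniform_sequence[OF open_UHP H13_holomorphic[OF f]])
    fix x assume "x \<in> UHP"
    define d where "d = Im x / 2"
    have d: "d > 0" using Im_pos[OF \<open>x \<in> UHP\<close>] by (simp add: d_def)
    have Im: "Im z \<ge> d" if "z \<in> cball x d" for z
      using that abs_Im_le_cmod[of "x - z"] by (auto simp: dist_norm d_def field_simps)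
    hence "cball x d \<subseteq> UHP" using d by (force simp: UHP_def)
    moreover have "uniform_limit (cball x d) f \<zeta> sequentially"
      unfolding uniform_limit_iff
    proof (intro allI impI)
      fix e :: real assume "e > 0"
      have "e / 2 > 0" "e / 2 < e" using \<open>e > 0\<close> by auto
      obtain N where N: "\<forall>m\<ge>N. \<forall>z. Im z \<ge> d \<longrightarrow> cmod (f m z - \<zeta> z) \<le> e / 2"
        using unif'[OF \<open>e / 2 > 0\<close> d] by blast
      show "\<forall>\<^sub>F n in sequentially. \<forall>z\<in>cball x d. dist (f n z) (\<zeta> z) < e"
      proof (rule eventually_sequentiallyI[of N], rule ballI)
        fix n z assume "n \<ge> N" "z \<in> cball x d"
        hence "cmod (f n z - \<zeta> z) \<le> e / 2" using N Im by blast
        thus "dist (f n z) (\<zeta> z) < e" using \<open>e / 2 < e\<close> by (simp add: dist_norm)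
      qed
    qed
    ultimately show "\<exists>d>0. cball x d \<subseteq> UHP \<and> uniform_limit (cball x d) f \<zeta> sequentially"
      using d by blast
  qed
  have [measurable]: "f n \<in> borel_measurable borel" for n using H13_measurable[OF f] .
  have [measurable]: "\<zeta> \<in> borel_measurable borel"
    unfolding \<zeta>_def by (rule borel_measurable_lim_metric) simp
  \<comment> \<open>Fatou's lemma is applied with m fixed and n tending to infinity. It supplies
    membership in L2 as well as the bound.\<close>
  have fatou: "(\<lambda>z. f m z - \<zeta> z) \<in> L2 nu13 \<and> nsq nu13 (\<lambda>z. f m z - \<zeta> z) \<le> \<epsilon>"
    if N: "\<forall>m\<ge>N. \<forall>n\<ge>N. nsq nu13 (\<lambda>z. f m z - f n z) \<le> \<epsilon>" and "m \<ge> N" for m N \<epsilon>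
  proof -
    have "0 \<le> \<epsilon>" using N \<open>m \<ge> N\<close> nsq_nonneg order_trans by blast
    have "(\<integral>\<^sup>+z. ennreal ((cmod (f m z - \<zeta> z))\<^sup>2) \<partial>nu13) =
        (\<integral>\<^sup>+z. liminf (\<lambda>n. ennreal ((cmod (f m z - f n z))\<^sup>2)) \<partial>nu13)"
    proof (intro nn_integral_cong)
      fix z
      have "(\<lambda>n. ennreal ((cmod (f m z - f n z))\<^sup>2)) \<longlonglongrightarrow> ennreal ((cmod (f m z - \<zeta> z))\<^sup>2)"
        by (intro tendsto_ennrealI tendsto_power tendsto_norm tendsto_diff tendsto_const lim)
      from lim_imp_Liminf[OF _ this]
      show "ennreal ((cmod (f m z - \<zeta> z))\<^sup>2) = liminf (\<lambda>n. ennreal ((cmod (f m z - f n z))\<^sup>2))" by simp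
    qed
    also have "\<dots> \<le> liminf (\<lambda>n. \<integral>\<^sup>+z. ennreal ((cmod (f m z - f n z))\<^sup>2) \<partial>nu13)"
      by (rule nn_integral_liminf) measurable
    also have "\<dots> = liminf (\<lambda>n. ennreal (nsq nu13 (\<lambda>z. f m z - f n z)))"
      unfolding nsq_def
      by (subst nn_integral_eq_integral) (auto intro!: L2_integrable H13_L2 H13_diff f)
    also have "\<dots> \<le> liminf (\<lambda>_::nat. ennreal \<epsilon>)"
      by (rule Liminf_mono) (use N \<open>m \<ge> N\<close> in \<open>auto intro!: eventually_sequentiallyI[of N] ennreal_leI\<close>)
    finally have le: "(\<integral>\<^sup>+z. ennreal ((cmod (f m z - \<zeta> z))\<^sup>2) \<partial>nu13) \<le> ennreal \<epsilon>"
      by (simp add: Liminf_const)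
    have int: "integrable nu13 (\<lambda>z. (cmod (f m z - \<zeta> z))\<^sup>2)"
      by (rule integrableI_bounded) (use le in \<open>auto intro: le_less_trans simp: ennreal_less_top\<close>)
    have "ennreal (nsq nu13 (\<lambda>z. f m z - \<zeta> z)) \<le> ennreal \<epsilon>"
      using le unfolding nsq_def by (subst (asm) nn_integral_eq_integral[OF int]) auto
    thus ?thesis using int \<open>0 \<le> \<epsilon>\<close> by (simp add: L2_def)
  qed
  have "\<zeta> \<in> L2 nu13"
  proof -
    obtain N where N: "\<forall>m\<ge>N. \<forall>n\<ge>N. nsq nu13 (\<lambda>z. f m z - f n z) \<le> 1"
      using C[OF zero_less_one] by blast
    have "(\<lambda>z. f N z - (f N z - \<zeta> z)) \<in> L2 nu13"
      by (rule L2_diff[OF H13_L2[OF f] conjunct1[OF fatou[OF N order_refl]]])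
    thus ?thesis by simp
  qed
  hence "\<zeta> \<in> H13"
    using hol H13_outside[OF f] by (auto simp: H13_def \<zeta>_def)
  moreover have "(\<lambda>n. nsq nu13 (\<lambda>z. f n z - \<zeta> z)) \<longlonglongrightarrow> 0"
  proof (rule LIMSEQ_I)
    fix r :: real assume "r > 0"
    hence "r / 2 > 0" "r / 2 < r" by auto
    obtain N where N: "\<forall>m\<ge>N. \<forall>n\<ge>N. nsq nu13 (\<lambda>z. f m z - f n z) \<le> r / 2"
      using C[OF \<open>r / 2 > 0\<close>] by blast
    have "norm (nsq nu13 (\<lambda>z. f n z - \<zeta> z) - 0) < r" if "n \<ge> N" for n
      using fatou[OF N that] \<open>r / 2 < r\<close> by simp
    thus "\<exists>no. \<forall>n\<ge>no. norm (nsq nu13 (\<lambda>z. f n z - \<zeta> z) - 0) < r" by blast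
  qed
  ultimately show ?thesis by blast
qed

section \<open>Orthonormal bases, Parseval and the Bergman projection\<close>

definition orthonormal :: "(complex \<Rightarrow> complex) set \<Rightarrow> bool" where
  "orthonormal E \<longleftrightarrow> E \<subseteq> H13 \<and> (\<forall>e\<in>E. \<forall>f\<in>E. ipH e f = (if e = f then 1 else 0))"

lemma onb_orthonormal: "onb E \<Longrightarrow> orthonormal E"
  by (simp add: onb_def orthonormal_def)

text \<open>A maximal orthonormal set is a basis, because a nonzero vector orthogonal to it could be
  normalized and added. Existence matters: without a basis, \<open>has_trace\<close> would hold
  vacuously and \<open>hs_normsq\<close> would vanish.\<close>

lemma onb_exists: "\<exists>E. onb E"
proof -
  let ?A = "{E. orthonormal E}"
  have "\<exists>M\<in>?A. \<forall>X\<in>?A. M \<subseteq> X \<longrightarrow> X = M"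
  proof (rule subset_Zorn_nonempty)
    show "?A \<noteq> {}" by (auto simp: orthonormal_def)
    fix \<C> assume "\<C> \<noteq> {}" "subset.chain ?A \<C>"
    hence sub: "\<C> \<subseteq> ?A" and ch: "\<And>X Y. X \<in> \<C> \<Longrightarrow> Y \<in> \<C> \<Longrightarrow> X \<subseteq> Y \<or> Y \<subseteq> X"
      by (auto simp: subset_chain_def)
    show "\<Union> \<C> \<in> ?A"
      unfolding orthonormal_def
    proof (intro CollectI conjI ballI)
      show "\<Union> \<C> \<subseteq> H13" using sub by (auto simp: orthonormal_def)
      fix e f assume "e \<in> \<Union> \<C>" "f \<in> \<Union> \<C>"
      then obtain X where "X \<in> \<C>" "e \<in> X" "f \<in> X" using ch by blast
      thus "ipH e f = (if e = f then 1 else 0)" using sub by (auto simp: orthonormal_def)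
    qed
  qed
  then obtain M where M: "orthonormal M" and max: "\<And>X. orthonormal X \<Longrightarrow> M \<subseteq> X \<Longrightarrow> X = M" by blast
  have "\<xi> = (\<lambda>_. 0)" if \<xi>: "\<xi> \<in> H13" "\<forall>e\<in>M. ipH \<xi> e = 0" for \<xi>
  proof (rule ccontr)
    assume ne: "\<xi> \<noteq> (\<lambda>_. 0)"
    hence n: "nsq nu13 \<xi> > 0" using H13_eq_0[OF \<xi>(1)] nsq_nonneg[of nu13 \<xi>] by linarith
    define \<psi> where "\<psi> = (\<lambda>z. of_real (1 / sqrt (nsq nu13 \<xi>)) * \<xi> z)"
    have \<psi>: "\<psi> \<in> H13" unfolding \<psi>_def by (rule H13_scale[OF \<xi>(1)])
    have 1: "ipH \<psi> \<psi> = 1"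
      using n unfolding ip_self \<psi>_def nsq_scale by (simp add: norm_divide power_divide)
    have 0: "ipH \<psi> e = 0" "ipH e \<psi> = 0" if "e \<in> M" for e
    proof -
      show "ipH \<psi> e = 0" using that \<xi> M unfolding \<psi>_def
        by (subst ip_scale_left) (auto intro: H13_L2 simp: orthonormal_def)
      thus "ipH e \<psi> = 0" by (subst ip_commute) simp
    qed
    have "orthonormal (insert \<psi> M)"
      using M \<psi> 1 0 unfolding orthonormal_def by auto
    hence "\<psi> \<in> M" using max[of "insert \<psi> M"] by blast
    thus False using 0 1 by auto
  qed
  thus ?thesis using M unfolding onb_def orthonormal_def by blast
qed

definition psum :: "(complex \<Rightarrow> complex) set \<Rightarrow> (complex \<Rightarrow> complex) \<Rightarrow> complex \<Rightarrow> complex" where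
  "psum J v = (\<lambda>z. \<Sum>e\<in>J. ipH v e * e z)"

lemma psum_H13: "J \<subseteq> H13 \<Longrightarrow> psum J v \<in> H13"
  unfolding psum_def by (intro H13_sum H13_scale) auto

lemma ip_psum:
  assumes "J \<subseteq> H13" "\<psi> \<in> L2 nu13"
  shows "ipH (psum J v) \<psi> = (\<Sum>e\<in>J. ipH v e * ipH e \<psi>)"
  unfolding psum_def using assms
  by (subst ip_sum_left) (auto intro!: sum.cong H13_L2 H13_scale ip_scale_left)

lemma ip_psum_basis:
  assumes "orthonormal E" "finite J" "J \<subseteq> E" "e \<in> E"
  shows "ipH (psum J v) e = (if e \<in> J then ipH v e else 0)"
proof -
  have "J \<subseteq> H13" "e \<in> H13" using assms by (auto simp: orthonormal_def)
  have "ipH (psum J v) e = (\<Sum>f\<in>J. ipH v f * ipH f e)"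
    by (rule ip_psum) (use \<open>J \<subseteq> H13\<close> \<open>e \<in> H13\<close> H13_L2 in auto)
  also have "\<dots> = (\<Sum>f\<in>J. if f = e then ipH v e else 0)"
    using assms by (intro sum.cong) (auto simp: orthonormal_def subset_iff)
  finally show ?thesis using assms(2) by simp
qed

lemma nsq_psum:
  assumes "orthonormal E" "finite J" "J \<subseteq> E"
  shows "nsq nu13 (psum J v) = (\<Sum>e\<in>J. (cmod (ipH v e))\<^sup>2)"
proof -
  have "J \<subseteq> H13" using assms by (auto simp: orthonormal_def)
  have "complex_of_real (nsq nu13 (psum J v)) = (\<Sum>e\<in>J. ipH v e * ipH e (psum J v))"
    using ip_psum[OF \<open>J \<subseteq> H13\<close> H13_L2[OF psum_H13[OF \<open>J \<subseteq> H13\<close>]], of v v] by (simp add: ip_self)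
  also have "\<dots> = (\<Sum>e\<in>J. complex_of_real ((cmod (ipH v e))\<^sup>2))"
  proof (intro sum.cong refl)
    fix e assume "e \<in> J"
    hence "ipH (psum J v) e = ipH v e" using ip_psum_basis[OF assms] assms by auto
    thus "ipH v e * ipH e (psum J v) = complex_of_real ((cmod (ipH v e))\<^sup>2)"
      by (subst (2) ip_commute) (simp add: mult_cnj_self)
  qed
  finally show ?thesis by (simp only: of_real_sum[symmetric] of_real_eq_iff)
qed

lemma nsq_diff_psum:
  assumes "orthonormal E" "finite J" "J \<subseteq> E" "v \<in> L2 nu13"
  shows "nsq nu13 (\<lambda>z. v z - psum J v z) = nsq nu13 v - (\<Sum>e\<in>J. (cmod (ipH v e))\<^sup>2)"
proof -
  have J: "J \<subseteq> H13" using assms by (auto simp: orthonormal_def)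
  have "ipH (psum J v) v = (\<Sum>e\<in>J. complex_of_real ((cmod (ipH v e))\<^sup>2))"
  proof -
    have "ipH v e * ipH e v = complex_of_real ((cmod (ipH v e))\<^sup>2)" for e
      by (subst (2) ip_commute) (simp add: mult_cnj_self)
    thus ?thesis using ip_psum[OF J assms(4)] by simp
  qed
  hence "Re (ipH v (psum J v)) = (\<Sum>e\<in>J. (cmod (ipH v e))\<^sup>2)"
    by (subst ip_commute) simp
  thus ?thesis
    using nsq_diff[OF assms(4) H13_L2[OF psum_H13[OF J]]] nsq_psum[OF assms(1-3)] by simp
qed

lemma Bessel:
  assumes "orthonormal E" "finite J" "J \<subseteq> E" "v \<in> L2 nu13"
  shows "(\<Sum>e\<in>J. (cmod (ipH v e))\<^sup>2) \<le> nsq nu13 v"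
  using nsq_diff_psum[OF assms] nsq_nonneg[of nu13 "\<lambda>z. v z - psum J v z"] by linarith

text \<open>E is not assumed countable, whereas \<open>H13_complete\<close> speaks of sequences; so
  the finite sets \<open>J n\<close> are chosen to nearly attain the supremum of the Bessel sums.
  The vector v may lie outside \<open>H13\<close>, and then \<zeta> is a projection of it.\<close>

lemma orthonormal_expansion:
  assumes E: "orthonormal E" and v: "v \<in> L2 nu13"
  shows "\<exists>\<zeta>\<in>H13. \<exists>J. (\<forall>n::nat. finite (J n) \<and> J n \<subseteq> E) \<and>
    (\<lambda>n. nsq nu13 (\<lambda>z. psum (J n) v z - \<zeta> z)) \<longlonglongrightarrow> 0 \<and> (\<forall>e\<in>E. ipH \<zeta> e = ipH v e)"
proof -
  define S where "S J = (\<Sum>e\<in>J. (cmod (ipH v e))\<^sup>2)" for J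
  define s where "s = (SUP J\<in>{J. finite J \<and> J \<subseteq> E}. S J)"
  have bdd: "bdd_above (S ` {J. finite J \<and> J \<subseteq> E})"
    using Bessel[OF E _ _ v] by (intro bdd_aboveI[of _ "nsq nu13 v"]) (auto simp: S_def)
  have S_le: "S J \<le> s" if "finite J" "J \<subseteq> E" for J
    unfolding s_def using that by (intro cSUP_upper bdd) auto
  have S_mono: "S J \<le> S J'" if "finite J'" "J \<subseteq> J'" for J J'
    unfolding S_def using that by (intro sum_mono2) auto
  have "\<exists>J. finite J \<and> J \<subseteq> E \<and> s - 1 / real (Suc n) < S J" for n
  proof -
    have "s - 1 / real (Suc n) < s" by simp
    then obtain J where "J \<in> {J. finite J \<and> J \<subseteq> E}" "s - 1 / real (Suc n) < S J"
      unfolding s_def using less_cSUP_iff[OF _ bdd] by (metis (no_types, lifting) empty_iff empty_subsetI finite.emptyI mem_Collect_eq)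
    thus ?thesis by auto
  qed
  then obtain J0 where J0: "\<And>n. finite (J0 n)" "\<And>n. J0 n \<subseteq> E" "\<And>n. s - 1 / real (Suc n) < S (J0 n)"
    by metis
  \<comment> \<open>Unions make the sets increasing, so a difference of two partial sums is the
    partial sum over \<open>J m - J n\<close>, whose norm is a gap between Bessel sums.\<close>
  define J where "J n = (\<Union>k\<le>n. J0 k)" for n
  have J: "finite (J n)" "J n \<subseteq> E" "s - 1 / real (Suc n) < S (J n)" for n
  proof -
    show "finite (J n)" "J n \<subseteq> E" using J0 by (auto simp: J_def)
    have "J0 n \<subseteq> J n" by (auto simp: J_def)
    thus "s - 1 / real (Suc n) < S (J n)" using J0(3)[of n] S_mono[of "J n" "J0 n"] \<open>finite (J n)\<close> by linarith
  qed
  have JH: "J n \<subseteq> H13" for n using J(2) E by (auto simp: orthonormal_def)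
  have d: "nsq nu13 (\<lambda>z. psum (J m) v z - psum (J n) v z) \<le> 1 / real (Suc n)" if "n \<le> m" for m n
  proof -
    have sub: "J n \<subseteq> J m" using that by (force simp: J_def)
    have "(\<lambda>z. psum (J m) v z - psum (J n) v z) = psum (J m - J n) v"
      by (rule ext) (simp add: psum_def sum.subset_diff[OF sub J(1)])
    hence "nsq nu13 (\<lambda>z. psum (J m) v z - psum (J n) v z) = S (J m - J n)"
      using nsq_psum[OF E, of "J m - J n"] J by (auto simp: S_def)
    also have "\<dots> = S (J m) - S (J n)" unfolding S_def using sum.subset_diff[OF sub J(1)] by (metis add_diff_cancel_right')
    also have "\<dots> \<le> 1 / real (Suc n)" using S_le[OF J(1,2), of m] J(3)[of n] by linarith
    finally show ?thesis .
  qed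
  have "\<exists>\<zeta>\<in>H13. (\<lambda>n. nsq nu13 (\<lambda>z. psum (J n) v z - \<zeta> z)) \<longlonglongrightarrow> 0"
  proof (rule H13_complete)
    show "psum (J n) v \<in> H13" for n by (rule psum_H13[OF JH])
    fix \<epsilon> :: real assume "\<epsilon> > 0"
    then obtain N where N: "1 / real (Suc N) < \<epsilon>" using nat_approx_posE by blast
    have "nsq nu13 (\<lambda>z. psum (J m) v z - psum (J n) v z) \<le> \<epsilon>" if "m \<ge> N" "n \<ge> N" for m n
    proof -
      have le: "1 / real (Suc k) \<le> \<epsilon>" if "k \<ge> N" for k
        using N that by (intro order_trans[OF _ less_imp_le[OF N]]) (simp add: frac_le)
      have sym: "nsq nu13 (\<lambda>z. psum (J m) v z - psum (J n) v z) = nsq nu13 (\<lambda>z. psum (J n) v z - psum (J m) v z)"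
        by (simp add: nsq_def norm_minus_commute)
      show ?thesis
        using d[of n m] d[of m n] le[OF that(1)] le[OF that(2)] sym by (cases "n \<le> m") auto
    qed
    thus "\<exists>N. \<forall>m\<ge>N. \<forall>n\<ge>N. nsq nu13 (\<lambda>z. psum (J m) v z - psum (J n) v z) \<le> \<epsilon>" by blast
  qed
  then obtain \<zeta> where \<zeta>: "\<zeta> \<in> H13" "(\<lambda>n. nsq nu13 (\<lambda>z. psum (J n) v z - \<zeta> z)) \<longlonglongrightarrow> 0" by blast
  have "ipH \<zeta> e = ipH v e" if e: "e \<in> E" for e
  proof -
    have eH: "e \<in> H13" using e E by (auto simp: orthonormal_def)
    have "(\<lambda>n. ipH (psum (J n) v) e - ipH \<zeta> e) \<longlonglongrightarrow> 0"
    proof (rule Lim_null_comparison)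
      show "\<forall>\<^sub>F n in sequentially. norm (ipH (psum (J n) v) e - ipH \<zeta> e) \<le>
          sqrt (nsq nu13 (\<lambda>z. psum (J n) v z - \<zeta> z)) * sqrt (nsq nu13 e)"
        using cmod_ip_le[OF L2_diff[OF H13_L2[OF psum_H13[OF JH]] H13_L2[OF \<zeta>(1)]] H13_L2[OF eH]]
        by (intro always_eventually) (simp add: ip_diff_left H13_L2 psum_H13 JH \<zeta>(1) eH)
      show "(\<lambda>n. sqrt (nsq nu13 (\<lambda>z. psum (J n) v z - \<zeta> z)) * sqrt (nsq nu13 e)) \<longlonglongrightarrow> 0"
        using tendsto_mult_left_zero[OF tendsto_real_sqrt[OF \<zeta>(2), unfolded real_sqrt_zero]] by simp
    qed
    hence 1: "(\<lambda>n. ipH (psum (J n) v) e) \<longlonglongrightarrow> ipH \<zeta> e" by (simp add: LIM_zero_iff)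
    have "(\<lambda>n. ipH (psum (J n) v) e - ipH v e) \<longlonglongrightarrow> 0"
    proof (rule Lim_null_comparison)
      \<comment> \<open>If e is missing from \<open>J n\<close>, adding it would raise the Bessel
        sum by |<v, e>|^2, and the supremum leaves room for at most 1 / (n + 1).\<close>
      have "(cmod (ipH (psum (J n) v) e - ipH v e))\<^sup>2 \<le> 1 / real (Suc n)" for n
      proof (cases "e \<in> J n")
        case False
        have "S (insert e (J n)) = (cmod (ipH v e))\<^sup>2 + S (J n)" using False J(1) by (simp add: S_def)
        moreover have "S (insert e (J n)) \<le> s" using J e by (intro S_le) auto
        ultimately have "(cmod (ipH v e))\<^sup>2 \<le> 1 / real (Suc n)" using J(3)[of n] by linarith
        thus ?thesis using ip_psum_basis[OF E J(1,2) e] False by simp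
      qed (simp add: ip_psum_basis[OF E J(1,2) e])
      hence "cmod (ipH (psum (J n) v) e - ipH v e) \<le> sqrt (1 / real (Suc n))" for n by (rule real_le_rsqrt)
      thus "\<forall>\<^sub>F n in sequentially. norm (ipH (psum (J n) v) e - ipH v e) \<le> sqrt (1 / real (Suc n))" by simp
      show "(\<lambda>n. sqrt (1 / real (Suc n))) \<longlonglongrightarrow> 0"
        using tendsto_real_sqrt[OF LIMSEQ_inverse_real_of_nat] by (simp add: divide_inverse)
    qed
    hence "(\<lambda>n. ipH (psum (J n) v) e) \<longlonglongrightarrow> ipH v e" by (simp add: LIM_zero_iff)
    with 1 show ?thesis by (rule LIMSEQ_unique)
  qed
  thus ?thesis using \<zeta> J by blast
qed

lemma onb_eqI:
  assumes E: "onb E" and "\<xi> \<in> H13" "\<zeta> \<in> H13" "\<And>e. e \<in> E \<Longrightarrow> ipH \<xi> e = ipH \<zeta> e"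
  shows "\<xi> = \<zeta>"
proof -
  have "\<forall>e\<in>E. ipH (\<lambda>z. \<xi> z - \<zeta> z) e = 0"
    using assms by (auto simp: ip_diff_left H13_L2 onb_def subset_iff)
  hence "(\<lambda>z. \<xi> z - \<zeta> z) = (\<lambda>_. 0)" using E H13_diff[OF assms(2,3)] by (simp add: onb_def)
  thus ?thesis by (simp add: fun_eq_iff)
qed

text \<open>The expansion attains the norm along one sequence of finite sets; monotonicity of the
  sums from below and Bessel from above upgrade this to convergence along all finite
  subsets.\<close>

lemma Parseval_nsq:
  assumes E: "onb E" and \<xi>: "\<xi> \<in> H13"
  shows "((\<lambda>e. (cmod (ipH \<xi> e))\<^sup>2) has_sum nsq nu13 \<xi>) E"
proof -
  note o = onb_orthonormal[OF E]
  obtain \<zeta> J where \<zeta>: "\<zeta> \<in> H13" "\<And>n::nat. finite (J n)" "\<And>n. J n \<subseteq> E"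
      "(\<lambda>n. nsq nu13 (\<lambda>z. psum (J n) \<xi> z - \<zeta> z)) \<longlonglongrightarrow> 0" "\<And>e. e \<in> E \<Longrightarrow> ipH \<zeta> e = ipH \<xi> e"
    using orthonormal_expansion[OF o H13_L2[OF \<xi>]] by blast
  have "\<xi> = \<zeta>" by (rule onb_eqI[OF E \<xi> \<zeta>(1)]) (simp add: \<zeta>(5))
  have "(\<lambda>n. nsq nu13 \<xi> - (\<Sum>e\<in>J n. (cmod (ipH \<xi> e))\<^sup>2)) \<longlonglongrightarrow> 0"
    using \<zeta>(4) nsq_diff_psum[OF o \<zeta>(2,3) H13_L2[OF \<xi>]]
    by (simp add: \<open>\<xi> = \<zeta>\<close>[symmetric] nsq_def norm_minus_commute)
  hence lim: "(\<lambda>n. \<Sum>e\<in>J n. (cmod (ipH \<xi> e))\<^sup>2) \<longlonglongrightarrow> nsq nu13 \<xi>"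
    using tendsto_diff[OF tendsto_const[of "nsq nu13 \<xi>"]] by force
  show ?thesis unfolding has_sum_def
  proof (rule order_tendstoI)
    fix a assume "a < nsq nu13 \<xi>"
    then obtain n where n: "a < (\<Sum>e\<in>J n. (cmod (ipH \<xi> e))\<^sup>2)"
      using order_tendstoD(1)[OF lim] by (metis eventually_sequentially order_refl)
    show "\<forall>\<^sub>F K in finite_subsets_at_top E. a < (\<Sum>e\<in>K. (cmod (ipH \<xi> e))\<^sup>2)"
      unfolding eventually_finite_subsets_at_top
    proof (intro exI[of _ "J n"] conjI allI impI)
      fix K assume "finite K \<and> J n \<subseteq> K \<and> K \<subseteq> E"
      hence "(\<Sum>e\<in>J n. (cmod (ipH \<xi> e))\<^sup>2) \<le> (\<Sum>e\<in>K. (cmod (ipH \<xi> e))\<^sup>2)"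
        by (intro sum_mono2) auto
      thus "a < (\<Sum>e\<in>K. (cmod (ipH \<xi> e))\<^sup>2)" using n by linarith
    qed (use \<zeta> in auto)
  next
    fix a assume "a > nsq nu13 \<xi>"
    thus "\<forall>\<^sub>F K in finite_subsets_at_top E. (\<Sum>e\<in>K. (cmod (ipH \<xi> e))\<^sup>2) < a"
      using Bessel[OF o _ _ H13_L2[OF \<xi>]]
      by (intro eventually_finite_subsets_at_top_weakI) (auto intro: le_less_trans)
  qed
qed

lemma psum_tendsto:
  assumes E: "onb E" and \<xi>: "\<xi> \<in> H13"
  shows "((\<lambda>J. nsq nu13 (\<lambda>z. \<xi> z - psum J \<xi> z)) \<longlongrightarrow> 0) (finite_subsets_at_top E)"
proof -
  have "((\<lambda>J. nsq nu13 \<xi> - (\<Sum>e\<in>J. (cmod (ipH \<xi> e))\<^sup>2)) \<longlongrightarrow> nsq nu13 \<xi> - nsq nu13 \<xi>) (finite_subsets_at_top E)"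
    using Parseval_nsq[OF E \<xi>] unfolding has_sum_def by (intro tendsto_diff tendsto_const)
  hence "((\<lambda>J. nsq nu13 \<xi> - (\<Sum>e\<in>J. (cmod (ipH \<xi> e))\<^sup>2)) \<longlongrightarrow> 0) (finite_subsets_at_top E)"
    by simp
  thus ?thesis
    by (rule Lim_transform_eventually)
      (intro eventually_finite_subsets_at_top_weakI nsq_diff_psum[OF onb_orthonormal[OF E] _ _ H13_L2[OF \<xi>], symmetric])
qed

lemma ip_psum_tendsto:
  assumes E: "onb E" and \<xi>: "\<xi> \<in> H13" and \<psi>: "\<psi> \<in> L2 nu13"
  shows "((\<lambda>J. ipH (psum J \<xi>) \<psi>) \<longlongrightarrow> ipH \<xi> \<psi>) (finite_subsets_at_top E)"
proof -
  have EH: "E \<subseteq> H13" using E by (simp add: onb_def)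
  have "((\<lambda>J. ipH \<xi> \<psi> - ipH (psum J \<xi>) \<psi>) \<longlongrightarrow> 0) (finite_subsets_at_top E)"
  proof (rule Lim_null_comparison)
    show "((\<lambda>J. sqrt (nsq nu13 (\<lambda>z. \<xi> z - psum J \<xi> z)) * sqrt (nsq nu13 \<psi>)) \<longlongrightarrow> 0) (finite_subsets_at_top E)"
      using tendsto_mult_left_zero[OF tendsto_real_sqrt[OF psum_tendsto[OF E \<xi>], unfolded real_sqrt_zero]] by simp
    show "\<forall>\<^sub>F J in finite_subsets_at_top E. norm (ipH \<xi> \<psi> - ipH (psum J \<xi>) \<psi>) \<le>
        sqrt (nsq nu13 (\<lambda>z. \<xi> z - psum J \<xi> z)) * sqrt (nsq nu13 \<psi>)"
    proof (rule eventually_finite_subsets_at_top_weakI)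
      fix J assume "finite J" "J \<subseteq> E"
      hence J: "psum J \<xi> \<in> L2 nu13" using EH by (intro H13_L2 psum_H13) auto
      show "norm (ipH \<xi> \<psi> - ipH (psum J \<xi>) \<psi>) \<le> sqrt (nsq nu13 (\<lambda>z. \<xi> z - psum J \<xi> z)) * sqrt (nsq nu13 \<psi>)"
        using cmod_ip_le[OF L2_diff[OF H13_L2[OF \<xi>] J] \<psi>] by (simp add: ip_diff_left H13_L2[OF \<xi>] J \<psi>)
    qed
  qed
  from tendsto_diff[OF tendsto_const[of "ipH \<xi> \<psi>"] this] show ?thesis by simp
qed

lemma Parseval:
  assumes E: "onb E" and \<xi>: "\<xi> \<in> H13" and \<psi>: "\<psi> \<in> L2 nu13"
  shows "((\<lambda>e. ipH \<xi> e * ipH e \<psi>) has_sum ipH \<xi> \<psi>) E"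
  unfolding has_sum_def
proof (rule Lim_transform_eventually[OF ip_psum_tendsto[OF assms]])
  show "\<forall>\<^sub>F J in finite_subsets_at_top E. ipH (psum J \<xi>) \<psi> = (\<Sum>e\<in>J. ipH \<xi> e * ipH e \<psi>)"
    using E by (intro eventually_finite_subsets_at_top_weakI ip_psum \<psi>) (auto simp: onb_def)
qed

text \<open>The projection is the limit of the Fourier expansion of v in a basis of
  \<open>H13\<close>; Parseval extends the agreement of coefficients from basis vectors to all
  \<psi>.\<close>

lemma bergman_proj:
  assumes v: "v \<in> L2 nu13"
  shows "bergman_proj v \<in> H13" and "\<psi> \<in> H13 \<Longrightarrow> ipH (bergman_proj v) \<psi> = ipH v \<psi>"
proof -
  obtain E where E: "onb E" using onb_exists by blast
  note o = onb_orthonormal[OF E]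
  obtain \<zeta> where \<zeta>: "\<zeta> \<in> H13" "\<And>e. e \<in> E \<Longrightarrow> ipH \<zeta> e = ipH v e"
    using orthonormal_expansion[OF o v] by blast
  have eq: "ipH \<zeta> \<psi> = ipH v \<psi>" if \<psi>: "\<psi> \<in> H13" for \<psi>
  proof -
    have "((\<lambda>e. ipH \<psi> e * ipH e \<zeta>) has_sum ipH \<psi> \<zeta>) E"
      "((\<lambda>e. ipH \<psi> e * ipH e v) has_sum ipH \<psi> v) E"
      by (rule Parseval[OF E \<psi>], simp add: H13_L2 \<zeta> v)+
    moreover have "ipH \<psi> e * ipH e v = ipH \<psi> e * ipH e \<zeta>" if "e \<in> E" for e
      using \<zeta>(2)[OF that] by (simp add: ip_commute[of nu13 e])
    ultimately have "ipH \<psi> \<zeta> = ipH \<psi> v" by (metis (no_types, lifting) has_sum_cong has_sum_unique)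
    thus ?thesis by (metis ip_commute)
  qed
  have "bergman_proj v = \<zeta>"
    unfolding bergman_proj_def
  proof (rule the_equality)
    show "\<zeta> \<in> H13 \<and> (\<forall>\<psi>\<in>H13. ipH (\<lambda>z. v z - \<zeta> z) \<psi> = 0)"
      using \<zeta>(1) eq v by (simp add: ip_diff_left H13_L2)
    fix \<zeta>' assume "\<zeta>' \<in> H13 \<and> (\<forall>\<psi>\<in>H13. ipH (\<lambda>z. v z - \<zeta>' z) \<psi> = 0)"
    thus "\<zeta>' = \<zeta>" using \<zeta>(1) eq v by (intro H13_eqI) (auto simp: ip_diff_left H13_L2)
  qed
  thus "bergman_proj v \<in> H13" and "\<psi> \<in> H13 \<Longrightarrow> ipH (bergman_proj v) \<psi> = ipH v \<psi>"
    using \<zeta>(1) eq by auto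
qed

lemma nsq_bergman_proj:
  assumes v: "v \<in> L2 nu13"
  shows "nsq nu13 (bergman_proj v) \<le> nsq nu13 v"
proof -
  note P = bergman_proj(1)[OF v]
  let ?P = "bergman_proj v"
  have "(nsq nu13 ?P)\<^sup>2 = (cmod (ipH v ?P))\<^sup>2"
    using bergman_proj(2)[OF v P, symmetric] by (simp add: ip_self)
  also have "\<dots> \<le> nsq nu13 v * nsq nu13 ?P" by (rule ip_Cauchy_Schwarz[OF v H13_L2[OF P]])
  finally have "nsq nu13 ?P * nsq nu13 ?P \<le> nsq nu13 v * nsq nu13 ?P" by (simp add: power2_eq_square)
  thus ?thesis
    using nsq_nonneg[of nu13 ?P] nsq_nonneg[of nu13 v] by (cases "nsq nu13 ?P = 0") (auto simp: mult_le_cancel_right)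
qed

section \<open>Toeplitz operators\<close>

text \<open>The sum is a partial sum of the Bergman kernel on the diagonal. The vector \<xi> is the
  corresponding truncated reproducing kernel: its value at z and its squared norm are both s, so
  \<open>H13_bound\<close> becomes a bound for s itself.\<close>

lemma orthonormal_kernel_bound:
  assumes E: "orthonormal E" "finite J" "J \<subseteq> E" and z: "z \<in> UHP"
  shows "(\<Sum>e\<in>J. (cmod (e z))\<^sup>2) * Im z ^ 13 \<le> bergman_const"
proof -
  define s where "s = (\<Sum>e\<in>J. (cmod (e z))\<^sup>2)"
  define \<xi> where "\<xi> = (\<lambda>w. \<Sum>e\<in>J. cnj (e z) * e w)"
  have J: "J \<subseteq> H13" using E by (auto simp: orthonormal_def)
  have \<xi>: "\<xi> \<in> H13" unfolding \<xi>_def using J by (intro H13_sum H13_scale) auto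
  have ipe: "ipH e \<xi> = e z" if "e \<in> J" for e
  proof -
    have "ipH e \<xi> = (\<Sum>f\<in>J. ipH e (\<lambda>w. cnj (f z) * f w))"
      unfolding \<xi>_def using J that by (intro ip_sum_right) (auto intro: H13_L2 H13_scale)
    also have "\<dots> = (\<Sum>f\<in>J. if f = e then e z else 0)"
      using J that E by (intro sum.cong refl, subst ip_scale_right) (auto intro!: H13_L2 simp: orthonormal_def subset_iff)
    finally show ?thesis using that E by simp
  qed
  have "complex_of_real (nsq nu13 \<xi>) = (\<Sum>e\<in>J. ipH (\<lambda>w. cnj (e z) * e w) \<xi>)"
    unfolding ip_self[symmetric] by (subst (1) \<xi>_def, rule ip_sum_left) (use J \<xi> in \<open>auto intro: H13_L2 H13_scale\<close>)
  also have "\<dots> = (\<Sum>e\<in>J. cnj (e z) * e z)"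
    using J \<xi> ipe by (intro sum.cong refl, subst ip_scale_left) (auto intro!: H13_L2)
  also have "\<dots> = complex_of_real s" unfolding s_def of_real_sum
    by (intro sum.cong) (simp_all add: mult.commute[of "cnj _"] mult_cnj_self)
  finally have n: "nsq nu13 \<xi> = s" by (simp only: of_real_eq_iff)
  have "\<xi> z = complex_of_real s" unfolding \<xi>_def s_def of_real_sum
    by (intro sum.cong) (simp_all add: mult.commute[of "cnj _"] mult_cnj_self)
  hence "s\<^sup>2 * Im z ^ 13 \<le> bergman_const * s" using H13_bound[OF \<xi> z] by (simp add: n)
  hence "(s * Im z ^ 13) * s \<le> bergman_const * s" by (simp add: power2_eq_square mult_ac)
  moreover have "s \<ge> 0" by (simp add: s_def sum_nonneg)
  ultimately show ?thesis using bergman_const_nonneg unfolding s_def[symmetric]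
    by (cases "s = 0") (auto simp: mult_le_cancel_right)
qed

lemma toeplitz_symbol:
  assumes f: "f \<in> L2 hyp_area" and \<xi>: "\<xi> \<in> H13"
  shows "(\<lambda>z. f z * \<xi> z) \<in> L2 nu13"
proof -
  have [measurable]: "f \<in> borel_measurable borel" "\<xi> \<in> borel_measurable borel"
    using f \<xi> by (auto intro: L2_hyp_measurable H13_measurable)
  have "integrable hyp_area (\<lambda>z. (indicator UHP z * Im z ^ 13) *\<^sub>R (cmod (f z * \<xi> z))\<^sup>2)"
  proof (rule Bochner_Integration.integrable_bound)
    show "integrable hyp_area (\<lambda>z. (cmod (f z))\<^sup>2 * (bergman_const * nsq nu13 \<xi>))"
      using L2_integrable[OF f] by (rule integrable_mult_left)
    show "(\<lambda>z. (indicator UHP z * Im z ^ 13) *\<^sub>R (cmod (f z * \<xi> z))\<^sup>2) \<in> borel_measurable hyp_area"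
      by measurable
    have "\<bar>(indicator UHP z * Im z ^ 13) * (cmod (f z * \<xi> z))\<^sup>2\<bar> \<le> (cmod (f z))\<^sup>2 * (bergman_const * nsq nu13 \<xi>)" for z
    proof (cases "z \<in> UHP")
      case True
      have "\<bar>Im z ^ 13 * (cmod (f z * \<xi> z))\<^sup>2\<bar> = (cmod (f z))\<^sup>2 * ((cmod (\<xi> z))\<^sup>2 * Im z ^ 13)"
        using Im_pos[OF True] by (simp add: norm_mult power_mult_distrib abs_mult)
      also have "\<dots> \<le> (cmod (f z))\<^sup>2 * (bergman_const * nsq nu13 \<xi>)"
        by (intro mult_left_mono H13_bound[OF \<xi> True]) auto
      finally show ?thesis using True by simp
    qed (simp add: bergman_const_nonneg)
    thus "AE z in hyp_area. norm ((indicator UHP z * Im z ^ 13) *\<^sub>R (cmod (f z * \<xi> z))\<^sup>2) \<le>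
        norm ((cmod (f z))\<^sup>2 * (bergman_const * nsq nu13 \<xi>))"
      by (intro AE_I2) (metis abs_ge_self order_trans real_norm_def real_scaleR_def)
  qed
  hence "integrable nu13 (\<lambda>z. (cmod (f z * \<xi> z))\<^sup>2)" by (subst integral_nu13(2)) measurable
  thus ?thesis by (simp add: L2_def cong: measurable_cong_sets)
qed

lemma toeplitz_H13: "f \<in> L2 hyp_area \<Longrightarrow> \<xi> \<in> H13 \<Longrightarrow> toeplitz f \<xi> \<in> H13"
  unfolding toeplitz_def by (intro bergman_proj(1) toeplitz_symbol)

lemma toeplitz_ip:
  "f \<in> L2 hyp_area \<Longrightarrow> \<xi> \<in> H13 \<Longrightarrow> \<psi> \<in> H13 \<Longrightarrow> ipH (toeplitz f \<xi>) \<psi> = ipH (\<lambda>z. f z * \<xi> z) \<psi>"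
  unfolding toeplitz_def by (intro bergman_proj(2) toeplitz_symbol)

lemma toeplitz_cnj:
  assumes "f \<in> L2 hyp_area" "\<xi> \<in> H13" "\<psi> \<in> H13"
  shows "ipH (toeplitz f \<xi>) \<psi> = ipH \<xi> (toeplitz (\<lambda>z. cnj (f z)) \<psi>)"
proof -
  have "ipH \<xi> (toeplitz (\<lambda>z. cnj (f z)) \<psi>) = cnj (ipH (\<lambda>z. cnj (f z) * \<psi> z) \<xi>)"
    using assms by (subst ip_commute) (simp add: toeplitz_ip L2_cnj)
  also have "\<dots> = ipH (\<lambda>z. f z * \<xi> z) \<psi>"
    by (subst ip_commute[symmetric]) (simp add: ip_def mult_ac)
  finally show ?thesis using toeplitz_ip[OF assms] by simp
qed

lemma op_adjoint_toeplitz: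
  assumes f: "f \<in> L2 hyp_area" and \<xi>: "\<xi> \<in> H13"
  shows "op_adjoint (toeplitz f) \<xi> = toeplitz (\<lambda>z. cnj (f z)) \<xi>"
  unfolding op_adjoint_def
proof (rule the_equality)
  show "toeplitz (\<lambda>z. cnj (f z)) \<xi> \<in> H13 \<and>
      (\<forall>\<psi>\<in>H13. ipH (toeplitz f \<psi>) \<xi> = ipH \<psi> (toeplitz (\<lambda>z. cnj (f z)) \<xi>))"
    using toeplitz_H13[OF L2_cnj[OF f] \<xi>] toeplitz_cnj[OF f _ \<xi>] by blast
  fix \<zeta> assume \<zeta>: "\<zeta> \<in> H13 \<and> (\<forall>\<psi>\<in>H13. ipH (toeplitz f \<psi>) \<xi> = ipH \<psi> \<zeta>)"
  show "\<zeta> = toeplitz (\<lambda>z. cnj (f z)) \<xi>"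
  proof (rule H13_eqI)
    fix \<psi> assume "\<psi> \<in> H13"
    hence "ipH \<psi> \<zeta> = ipH \<psi> (toeplitz (\<lambda>z. cnj (f z)) \<xi>)" using \<zeta> toeplitz_cnj[OF f _ \<xi>] by metis
    thus "ipH \<zeta> \<psi> = ipH (toeplitz (\<lambda>z. cnj (f z)) \<xi>) \<psi>" by (metis ip_commute)
  qed (use \<zeta> toeplitz_H13[OF L2_cnj[OF f] \<xi>] in auto)
qed

text \<open>After dropping the projection, the sum over e is taken inside the integral, where the
  kernel bound absorbs the weight and leaves a multiple of |f|^2. The bound is uniform in J, hence
  controls the Hilbert-Schmidt norm.\<close>

lemma toeplitz_hs_bound:
  assumes f: "f \<in> L2 hyp_area" and E: "orthonormal E" "finite J" "J \<subseteq> E"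
  shows "(\<Sum>e\<in>J. nsq nu13 (toeplitz f e)) \<le> bergman_const * nsq hyp_area f"
proof -
  have J: "e \<in> H13" if "e \<in> J" for e using E that by (auto simp: orthonormal_def)
  have [measurable]: "f \<in> borel_measurable borel" using f by (rule L2_hyp_measurable)
  have [measurable]: "e \<in> borel_measurable borel" if "e \<in> J" for e using H13_measurable[OF J[OF that]] .
  let ?w = "\<lambda>z. indicator UHP z * Im z ^ 13"
  have int: "integrable hyp_area (\<lambda>z. ?w z *\<^sub>R (cmod (f z * e z))\<^sup>2)" if "e \<in> J" for e
    using L2_integrable[OF toeplitz_symbol[OF f J[OF that]]] that by (subst (asm) integral_nu13(2)) measurable
  have "(\<Sum>e\<in>J. nsq nu13 (toeplitz f e)) \<le> (\<Sum>e\<in>J. nsq nu13 (\<lambda>z. f z * e z))"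
    unfolding toeplitz_def by (intro sum_mono nsq_bergman_proj toeplitz_symbol f J)
  also have "\<dots> = (\<Sum>e\<in>J. LINT z|hyp_area. ?w z *\<^sub>R (cmod (f z * e z))\<^sup>2)"
    unfolding nsq_def by (intro sum.cong refl integral_nu13(1)) measurable
  also have "\<dots> = (LINT z|hyp_area. (\<Sum>e\<in>J. ?w z *\<^sub>R (cmod (f z * e z))\<^sup>2))"
    by (rule Bochner_Integration.integral_sum[symmetric]) (rule int)
  also have "\<dots> \<le> (LINT z|hyp_area. bergman_const * (cmod (f z))\<^sup>2)"
  proof (rule integral_mono)
    show "integrable hyp_area (\<lambda>z. \<Sum>e\<in>J. ?w z *\<^sub>R (cmod (f z * e z))\<^sup>2)"
      by (intro Bochner_Integration.integrable_sum int)
    show "integrable hyp_area (\<lambda>z. bergman_const * (cmod (f z))\<^sup>2)"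
      using L2_integrable[OF f] by simp
    fix z
    show "(\<Sum>e\<in>J. ?w z *\<^sub>R (cmod (f z * e z))\<^sup>2) \<le> bergman_const * (cmod (f z))\<^sup>2"
    proof (cases "z \<in> UHP")
      case True
      have "(\<Sum>e\<in>J. ?w z *\<^sub>R (cmod (f z * e z))\<^sup>2) = ((\<Sum>e\<in>J. (cmod (e z))\<^sup>2) * Im z ^ 13) * (cmod (f z))\<^sup>2"
        using True by (simp add: norm_mult power_mult_distrib sum_distrib_left sum_distrib_right mult_ac)
      also have "\<dots> \<le> bergman_const * (cmod (f z))\<^sup>2"
        by (intro mult_right_mono orthonormal_kernel_bound[OF E True]) auto
      finally show ?thesis .
    qed (simp add: bergman_const_nonneg)
  qed
  also have "\<dots> = bergman_const * nsq hyp_area f" by (simp add: nsq_def)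
  finally show ?thesis .
qed

section \<open>Translation of symbols\<close>

lemma translate_L2:
  assumes g: "g \<in> SL2R" and f: "f \<in> L2 hyp_area"
  shows "translate g f \<in> L2 hyp_area"
proof -
  have [measurable]: "f \<in> borel_measurable borel" using f by (rule L2_hyp_measurable)
  have "integrable hyp_area (\<lambda>z. (cmod (f (mob (matrix_inv g) z)))\<^sup>2)"
    using integral_mob_hyp(2)[OF SL2R_inv[OF g], of "\<lambda>z. (cmod (f z))\<^sup>2"] L2_integrable[OF f] by simp
  thus ?thesis by (simp add: L2_def translate_def)
qed

lemma translate_ip:
  assumes g: "g \<in> SL2R" and f: "f \<in> L2 hyp_area" and h: "h \<in> L2 hyp_area"
  shows "ip hyp_area (translate g f) (translate g h) = ip hyp_area f h"
proof -
  have [measurable]: "f \<in> borel_measurable borel" "(\<lambda>z. cnj (h z)) \<in> borel_measurable borel"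
    using L2_hyp_measurable[OF f] L2_hyp_measurable[OF L2_cnj[OF h]] by auto
  show ?thesis unfolding ip_def translate_def
    by (rule integral_mob_hyp(1)[OF SL2R_inv[OF g], of "\<lambda>z. f z * cnj (h z)"]) measurable
qed

lemma translate_inverse:
  assumes "g \<in> SL2R" "z \<in> UHP"
  shows "translate g (translate (matrix_inv g) f) z = f z"
    "translate (matrix_inv g) (translate g f) z = f z"
  using assms by (simp_all add: translate_def matrix_inv_inv mob_inv)

text \<open>Matrix coefficients are compared: there \<open>pi13_transfer\<close> moves g from the
  vectors to the symbol.\<close>

lemma toeplitz_translate:
  assumes g: "g \<in> SL2R" and f: "f \<in> L2 hyp_area" and \<xi>: "\<xi> \<in> H13"
  shows "toeplitz (translate g f) \<xi> = pi13 g (toeplitz f (pi13 (matrix_inv g) \<xi>))"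
proof -
  let ?h = "matrix_inv g"
  have h: "?h \<in> SL2R" by (rule SL2R_inv[OF g])
  note \<xi>' = pi13_H13[OF h \<xi>]
  show ?thesis
  proof (rule H13_eqI)
    show "toeplitz (translate g f) \<xi> \<in> H13" by (intro toeplitz_H13 translate_L2 g f \<xi>)
    show "pi13 g (toeplitz f (pi13 ?h \<xi>)) \<in> H13" by (intro toeplitz_H13 pi13_H13 g h f \<xi>)
    fix \<psi> assume \<psi>: "\<psi> \<in> H13"
    note \<psi>' = pi13_H13[OF h \<psi>]
    have "ipH (pi13 g (toeplitz f (pi13 ?h \<xi>))) \<psi> = ipH (toeplitz f (pi13 ?h \<xi>)) (pi13 ?h \<psi>)"
      using pi13_ip[OF g toeplitz_H13[OF f \<xi>'] \<psi>'] by (simp add: pi13_inverse[OF g \<psi>])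
    also have "\<dots> = (LINT z|nu13. f z * (pi13 ?h \<xi> z * cnj (pi13 ?h \<psi> z)))"
      by (subst toeplitz_ip[OF f \<xi>' \<psi>']) (simp add: ip_def mult.assoc)
    also have "\<dots> = (LINT z|nu13. f (mob ?h z) * (pi13 g (pi13 ?h \<xi>) z * cnj (pi13 g (pi13 ?h \<psi>) z)))"
      by (rule pi13_transfer(1)[OF g, symmetric]) (auto intro: L2_hyp_measurable f H13_measurable \<xi>' \<psi>')
    also have "\<dots> = ipH (toeplitz (translate g f) \<xi>) \<psi>"
      by (subst toeplitz_ip[OF translate_L2[OF g f] \<xi> \<psi>])
        (simp add: pi13_inverse[OF g] \<xi> \<psi> ip_def translate_def mult.assoc)
    finally show "ipH (toeplitz (translate g f) \<xi>) \<psi> = ipH (pi13 g (toeplitz f (pi13 ?h \<xi>))) \<psi>" by simp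
  qed
qed

section \<open>Positive square roots\<close>

text \<open>Positivity is evaluated at x - t A x; with t = 1 / a the second order term cancels half
  of the first order one. The bound makes A x small once the quadratic form at x is small.\<close>

lemma positive_operator_norm_bound:
  fixes A :: "'a :: real_inner \<Rightarrow> 'a"
  assumes lin: "linear A" and sym: "\<And>x y. A x \<bullet> y = x \<bullet> A y" and pos: "\<And>x. 0 \<le> A x \<bullet> x"
    and bd: "\<And>x. norm (A x) \<le> a * norm x" and a: "a > 0"
  shows "(norm (A x))\<^sup>2 \<le> a * (A x \<bullet> x)"
proof -
  define t where "t = 1 / a"
  define n where "n = (norm (A x))\<^sup>2"
  have n: "A x \<bullet> A x = n" by (simp add: n_def power2_norm_eq_inner)
  have "0 \<le> A (x - t *\<^sub>R A x) \<bullet> (x - t *\<^sub>R A x)" by (rule pos)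
  also have "\<dots> = A x \<bullet> x - 2 * t * n + t\<^sup>2 * (A (A x) \<bullet> A x)"
    using sym[of "A x" x]
    by (simp add: linear_diff[OF lin] linear_scale[OF lin] inner_diff_left inner_diff_right n power2_eq_square
        algebra_simps)
  finally have 1: "0 \<le> A x \<bullet> x - 2 * t * n + t\<^sup>2 * (A (A x) \<bullet> A x)" .
  have "A (A x) \<bullet> A x \<le> norm (A (A x)) * norm (A x)" by (rule norm_cauchy_schwarz)
  also have "\<dots> \<le> a * norm (A x) * norm (A x)" by (intro mult_right_mono bd) auto
  finally have "t\<^sup>2 * (A (A x) \<bullet> A x) \<le> t\<^sup>2 * (a * n)"
    by (intro mult_left_mono) (simp_all add: n_def power2_eq_square)
  also have "\<dots> = t * n" using a by (simp add: t_def power2_eq_square)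
  finally have "t * n \<le> A x \<bullet> x" using 1 by linarith
  thus ?thesis using a by (simp add: t_def n_def field_simps)
qed

text \<open>With \<open>D = A - B\<close> one has \<open>D A = - B D\<close> and \<open>D B = - A D\<close>, so \<open>\<langle>A D\<^sup>2 x, x\<rangle>\<close> and \<open>\<langle>B D\<^sup>2 x, x\<rangle>\<close>
  are \<open>\<le> 0\<close>. On approximate eigenvectors of \<open>D\<^sup>2\<close> for \<open>\<lambda> = \<parallel>D\<parallel>\<^sup>2\<close> this makes \<open>\<lambda> \<langle>A x, x\<rangle>\<close> and
  \<open>\<lambda> \<langle>B x, x\<rangle>\<close> small, hence also \<open>D x\<close>, which forces \<open>\<lambda> = 0\<close>.\<close>

lemma positive_sqrt_unique:
  fixes A B :: "'a :: real_inner \<Rightarrow> 'a"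
  assumes linA: "linear A" and symA: "\<And>x y. A x \<bullet> y = x \<bullet> A y" and posA: "\<And>x. 0 \<le> A x \<bullet> x"
    and bdA: "\<And>x. norm (A x) \<le> a * norm x"
    and linB: "linear B" and symB: "\<And>x y. B x \<bullet> y = x \<bullet> B y" and posB: "\<And>x. 0 \<le> B x \<bullet> x"
    and bdB: "\<And>x. norm (B x) \<le> a * norm x"
    and sq: "\<And>x. A (A x) = B (B x)" and a: "a > 0"
  shows "A x = B x"
proof -
  define D where "D x = A x - B x" for x
  have linD: "linear D" unfolding D_def by (intro linear_compose_sub linA linB)
  have symD: "D x \<bullet> y = x \<bullet> D y" for x y
    by (simp add: D_def inner_diff_left inner_diff_right symA symB)
  have DA: "D (A x) = - B (D x)" and DB: "D (B x) = - A (D x)" for x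
    by (simp_all add: D_def linear_diff[OF linA] linear_diff[OF linB] sq)
  have negA: "A x \<bullet> D (D x) \<le> 0" and negB: "B x \<bullet> D (D x) \<le> 0" for x
    using posB[of "D x"] posA[of "D x"] symD[of "A x" "D x"] symD[of "B x" "D x"]
    by (simp_all add: DA DB)
  have bdD: "(norm (D x))\<^sup>2 \<le> (2 * a)\<^sup>2" if "norm x \<le> 1" for x
  proof (rule power_mono)
    have "norm (D x) \<le> norm (A x) + norm (B x)" unfolding D_def by (rule norm_triangle_ineq4)
    also have "\<dots> \<le> a * norm x + a * norm x" by (intro add_mono bdA bdB)
    also have "\<dots> \<le> 2 * a" using mult_left_mono[OF that less_imp_le[OF a]] by simp
    finally show "norm (D x) \<le> 2 * a" .
  qed simp
  \<comment> \<open>Its supremum l plays the role of the squared norm of D. It need not be attained,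
    which is why only approximate eigenvectors are available.\<close>
  define L where "L = (\<lambda>x. (norm (D x))\<^sup>2) ` {x. norm x \<le> 1}"
  define l where "l = Sup L"
  have bddL: "bdd_above L" unfolding L_def using bdD by (intro bdd_aboveI[of _ "(2 * a)\<^sup>2"]) auto
  have Dl: "(norm (D x))\<^sup>2 \<le> l * (norm x)\<^sup>2" for x
  proof (cases "x = 0")
    case False
    define u where "u = (1 / norm x) *\<^sub>R x"
    have "norm u \<le> 1" by (simp add: u_def)
    hence "(norm (D u))\<^sup>2 \<le> l" unfolding l_def L_def by (intro cSup_upper bddL[unfolded L_def]) auto
    moreover have "(norm (D u))\<^sup>2 = (norm (D x))\<^sup>2 / (norm x)\<^sup>2"
      by (simp add: u_def linear_scale[OF linD] power_divide)
    ultimately show ?thesis using False by (simp add: field_simps)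
  qed (simp add: linear_0[OF linD])
  have "0 \<in> L" unfolding L_def using linear_0[OF linD] by (intro image_eqI[of _ _ 0]) auto
  hence "l \<ge> 0" unfolding l_def by (intro cSup_upper bddL)
  have "l = 0"
  proof (rule ccontr)
    assume "l \<noteq> 0"
    with \<open>l \<ge> 0\<close> have l: "l > 0" by simp
    \<comment> \<open>The bound 1/2 gives |D x|^2 > 3 l / 4 for the chosen x, while l / (8 a^2) will
      give |D x|^2 \<le> 4 a^2 \<eta> \<le> l / 2, a contradiction.\<close>
    define \<eta> where "\<eta> = min (1 / 2) (l / (8 * a\<^sup>2))"
    have \<eta>: "\<eta> > 0" "\<eta> \<le> 1 / 2" "\<eta> \<le> l / (8 * a\<^sup>2)" using l a by (auto simp: \<eta>_def)
    have "l - l * \<eta>\<^sup>2 < l" using l \<eta> by simp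
    moreover have "L \<noteq> {}" using \<open>0 \<in> L\<close> by blast
    ultimately have "\<exists>v\<in>L. l - l * \<eta>\<^sup>2 < v"
      using less_cSup_iff[OF _ bddL, of "l - l * \<eta>\<^sup>2"] by (simp flip: l_def)
    then obtain x where x: "norm x \<le> 1" "l - l * \<eta>\<^sup>2 < (norm (D x))\<^sup>2"
      unfolding L_def by blast
    \<comment> \<open>w measures how far x is from being an eigenvector of D^2 for l. Its norm is at
      most l \<eta> because x nearly attains the supremum.\<close>
    define w where "w = D (D x) - l *\<^sub>R x"
    have "(norm w)\<^sup>2 = (norm (D (D x)))\<^sup>2 - 2 * l * (norm (D x))\<^sup>2 + l\<^sup>2 * (norm x)\<^sup>2"
      unfolding w_def power2_norm_eq_inner using symD[of "D x" x]
      by (simp add: inner_diff_left inner_diff_right inner_commute power2_eq_square)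
    also have "\<dots> \<le> l * (norm (D x))\<^sup>2 - 2 * l * (norm (D x))\<^sup>2 + l\<^sup>2 * 1"
      using x(1) l by (intro add_mono diff_mono Dl mult_left_mono) (auto simp: power_le_one)
    also have "\<dots> = l * (l - (norm (D x))\<^sup>2)" by (simp add: power2_eq_square algebra_simps)
    also have "\<dots> \<le> l * (l * \<eta>\<^sup>2)" using x(2) l by (intro mult_left_mono) auto
    also have "\<dots> = (l * \<eta>)\<^sup>2" by (simp add: power2_eq_square)
    finally have w: "norm w \<le> l * \<eta>" using l \<eta> by (simp add: power2_le_iff_abs_le)
    have small: "(norm (A' x))\<^sup>2 \<le> a\<^sup>2 * \<eta>"
      if lin: "linear A'" and sym: "\<And>x y. A' x \<bullet> y = x \<bullet> A' y" and pos: "\<And>x. 0 \<le> A' x \<bullet> x"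
        and bd: "\<And>x. norm (A' x) \<le> a * norm x" and neg: "A' x \<bullet> D (D x) \<le> 0" for A'
    proof -
      have "l * (A' x \<bullet> x) = A' x \<bullet> D (D x) - A' x \<bullet> w"
        by (simp add: w_def inner_diff_right)
      also have "\<dots> \<le> norm (A' x) * norm w" using neg Cauchy_Schwarz_ineq2[of "A' x" w] by linarith
      also have "\<dots> \<le> a * (l * \<eta>)"
        using order_trans[OF bd[of x] mult_left_mono[OF x(1) less_imp_le[OF a]]] w a
        by (intro mult_mono) auto
      finally have "l * (A' x \<bullet> x) \<le> l * (a * \<eta>)" by (simp add: mult_ac)
      hence "A' x \<bullet> x \<le> a * \<eta>" using l by simp
      hence "a * (A' x \<bullet> x) \<le> a * (a * \<eta>)" using a by simp
      thus ?thesis using positive_operator_norm_bound[OF lin sym pos bd a, of x]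
        by (simp add: power2_eq_square)
    qed
    have "(norm (D x))\<^sup>2 \<le> (norm (A x) + norm (B x))\<^sup>2"
      unfolding D_def by (intro power_mono norm_triangle_ineq4) auto
    also have "\<dots> \<le> 2 * (norm (A x))\<^sup>2 + 2 * (norm (B x))\<^sup>2"
      using sum_squares_bound[of "norm (A x)" "norm (B x)"] by (simp add: power2_sum)
    also have "\<dots> \<le> 4 * (a\<^sup>2 * \<eta>)"
      using small[OF linA symA posA bdA negA] small[OF linB symB posB bdB negB] by simp
    also have "\<dots> \<le> l / 2" using \<eta>(3) a by (simp add: field_simps)
    finally have "(norm (D x))\<^sup>2 \<le> l / 2" .
    moreover have "l * \<eta>\<^sup>2 \<le> l * (1 / 4)"
      using power_mono[OF \<eta>(2), of 2] \<eta>(1) l by (intro mult_left_mono) (auto simp: power2_eq_square)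
    ultimately show False using x(2) l by linarith
  qed
  thus ?thesis using Dl[of x] by (simp add: D_def)
qed

text \<open>Symmetry is assumed against every y, so linearity of y in the inner product passes to A.
  This spares a separate proof for operators defined by choosing representatives.\<close>

lemma symmetric_imp_linear:
  fixes A :: "'a :: real_inner \<Rightarrow> 'a"
  assumes "\<And>x y. A x \<bullet> y = x \<bullet> A y"
  shows "linear A"
proof (rule linearI)
  show "A (x + y) = A x + A y" for x y
    by (rule vector_eq_rdot[THEN iffD1]) (simp add: assms inner_add_left)
  show "A (r *\<^sub>R x) = r *\<^sub>R A x" for r x
    by (rule vector_eq_rdot[THEN iffD1]) (simp add: assms)
qed

section \<open>Square integrable functions modulo null sets as a real inner product space\<close>

definition l2_rel :: "(complex \<Rightarrow> complex) \<Rightarrow> (complex \<Rightarrow> complex) \<Rightarrow> bool" where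
  "l2_rel f g \<longleftrightarrow> f \<in> L2 hyp_area \<and> g \<in> L2 hyp_area \<and> (AE z in hyp_area. f z = g z)"

\<comment> \<open>On classes the inner product is definite and the inverse of S becomes a function.
  The relation is partial so as to exclude functions outside L2, and the unnormalized measure is
  used because it serves every constant c.\<close>
quotient_type l2 = "complex \<Rightarrow> complex" / partial: l2_rel
proof (rule part_equivpI)
  show "\<exists>f. l2_rel f f" by (rule exI[of _ "\<lambda>_. 0"]) (simp add: l2_rel_def)
  show "symp l2_rel" by (auto simp: symp_def l2_rel_def)
  show "transp l2_rel"
  proof (rule transpI)
    fix f g h assume "l2_rel f g" "l2_rel g h"
    thus "l2_rel f h" unfolding l2_rel_def by (auto elim: eventually_elim2)
  qed
qed

text \<open>The real part of the complex inner product is enough for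
  \<open>positive_sqrt_unique\<close>, which needs symmetry and positivity only in the real
  sense.\<close>

instantiation l2 :: real_inner
begin

lift_definition zero_l2 :: l2 is "\<lambda>_. 0" by (simp add: l2_rel_def)

lift_definition plus_l2 :: "l2 \<Rightarrow> l2 \<Rightarrow> l2" is "\<lambda>f g z. f z + g z"
  by (auto simp: l2_rel_def L2_add elim: eventually_elim2)

lift_definition minus_l2 :: "l2 \<Rightarrow> l2 \<Rightarrow> l2" is "\<lambda>f g z. f z - g z"
  by (auto simp: l2_rel_def L2_diff elim: eventually_elim2)

lift_definition scaleR_l2 :: "real \<Rightarrow> l2 \<Rightarrow> l2" is "\<lambda>r f z. of_real r * f z"
  by (auto simp: l2_rel_def L2_scale elim: eventually_mono)

lift_definition inner_l2 :: "l2 \<Rightarrow> l2 \<Rightarrow> real" is "\<lambda>f g. Re (ip hyp_area f g)"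
  by (auto simp: l2_rel_def intro!: arg_cong[of _ _ Re] ip_cong_AE)

definition uminus_l2 :: "l2 \<Rightarrow> l2" where "uminus_l2 x = (-1) *\<^sub>R x"
definition norm_l2 :: "l2 \<Rightarrow> real" where "norm_l2 x = sqrt (inner x x)"
definition sgn_l2 :: "l2 \<Rightarrow> l2" where "sgn_l2 x = inverse (norm x) *\<^sub>R x"
definition dist_l2 :: "l2 \<Rightarrow> l2 \<Rightarrow> real" where "dist_l2 x y = norm (x - y)"
definition uniformity_l2 :: "(l2 \<times> l2) filter" where
  "uniformity_l2 = (INF e\<in>{0 <..}. principal {(x, y). dist x y < e})"
definition open_l2 :: "l2 set \<Rightarrow> bool" where
  "open_l2 U \<longleftrightarrow> (\<forall>x\<in>U. eventually (\<lambda>(x', y). x' = x \<longrightarrow> y \<in> U) uniformity)"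

instance
proof
  fix x y z :: l2 and r s :: real and U :: "l2 set"
  show "x + y + z = x + (y + z)" by transfer (simp add: l2_rel_def L2_add add.assoc)
  show "x + y = y + x" by transfer (simp add: l2_rel_def L2_add add.commute)
  show "0 + x = x" by transfer (simp add: l2_rel_def)
  show "- x + x = 0" unfolding uminus_l2_def by transfer (simp add: l2_rel_def)
  show "x - y = x + - y" unfolding uminus_l2_def
    by transfer (simp add: l2_rel_def L2_diff)
  show "r *\<^sub>R (x + y) = r *\<^sub>R x + r *\<^sub>R y"
    by transfer (simp add: l2_rel_def L2_add L2_scale distrib_left)
  show "(r + s) *\<^sub>R x = r *\<^sub>R x + s *\<^sub>R x"
    by transfer (simp add: l2_rel_def L2_add L2_scale L2_lin distrib_right)
  show "r *\<^sub>R s *\<^sub>R x = (r * s) *\<^sub>R x" by transfer (simp add: l2_rel_def L2_scale mult.assoc)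
  show "1 *\<^sub>R x = x" by transfer (simp add: l2_rel_def)
  show "dist x y = norm (x - y)" by (rule dist_l2_def)
  show "sgn x = inverse (norm x) *\<^sub>R x" by (rule sgn_l2_def)
  show "uniformity = (INF e\<in>{0 <..}. principal {(x :: l2, y). dist x y < e})" by (rule uniformity_l2_def)
  show "open U = (\<forall>x\<in>U. \<forall>\<^sub>F (x', y) in uniformity. x' = x \<longrightarrow> y \<in> U)" by (rule open_l2_def)
  show "norm x = sqrt (inner x x)" by (rule norm_l2_def)
  show "inner x y = inner y x"
    by transfer (subst ip_commute, simp)
  show "inner (x + y) z = inner x z + inner y z"
    by transfer (simp add: l2_rel_def ip_add_left)
  show "inner (r *\<^sub>R x) y = r * inner x y"
    by transfer (simp add: l2_rel_def ip_scale_left)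
  show "0 \<le> inner x x" by transfer (simp add: ip_self)
  show "inner x x = 0 \<longleftrightarrow> x = 0"
    by transfer (simp add: ip_self l2_rel_def nsq_eq_0_iff)
qed

end

lemma l2_rel_refl: "l2_rel f f \<longleftrightarrow> f \<in> L2 hyp_area"
  by (simp add: l2_rel_def)

lemma abs_l2_eq_iff:
  "f \<in> L2 hyp_area \<Longrightarrow> g \<in> L2 hyp_area \<Longrightarrow> abs_l2 f = abs_l2 g \<longleftrightarrow> (AE z in hyp_area. f z = g z)"
  using Quotient_rel[OF Quotient_l2, of f g] by (simp add: l2_rel_def)

lemma l2_cases:
  obtains f where "f \<in> L2 hyp_area" "x = abs_l2 f"
  by (induct x) (auto simp: l2_rel_refl)

lemma inner_abs_l2:
  "f \<in> L2 hyp_area \<Longrightarrow> g \<in> L2 hyp_area \<Longrightarrow> abs_l2 f \<bullet> abs_l2 g = Re (ip hyp_area f g)"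
  by (simp add: inner_l2.abs_eq l2_rel_refl)

lemma norm_abs_l2: "f \<in> L2 hyp_area \<Longrightarrow> norm (abs_l2 f) = sqrt (nsq hyp_area f)"
  by (simp add: norm_eq_sqrt_inner inner_abs_l2 ip_self)

section \<open>Translations acting on classes\<close>

lemma AE_mob:
  assumes g: "g \<in> SL2R" and "AE z in hyp_area. P z"
  shows "AE z in hyp_area. P (mob g z)"
proof -
  have "AE z in distr hyp_area borel (mob g). P z" using assms(2) by (subst distr_mob_hyp[OF g])
  thus ?thesis by (rule AE_distrD[rotated]) measurable
qed

definition l2_translate :: "mat2 \<Rightarrow> l2 \<Rightarrow> l2" where
  "l2_translate g x = abs_l2 (translate g (rep_l2 x))"

lemma rep_l2_L2: "rep_l2 x \<in> L2 hyp_area"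
  using Quotient_rep_reflp[OF Quotient_l2, of x] by (simp add: l2_rel_refl)

lemma abs_rep_l2: "abs_l2 (rep_l2 x) = x"
  by (rule Quotient_abs_rep[OF Quotient_l2])

lemma rep_abs_l2:
  "f \<in> L2 hyp_area \<Longrightarrow> AE z in hyp_area. rep_l2 (abs_l2 f) z = f z"
  using abs_l2_eq_iff[OF rep_l2_L2, of f "abs_l2 f"] by (simp add: abs_rep_l2)

lemma l2_translate_abs:
  assumes g: "g \<in> SL2R" and f: "f \<in> L2 hyp_area"
  shows "l2_translate g (abs_l2 f) = abs_l2 (translate g f)"
  unfolding l2_translate_def
  by (subst abs_l2_eq_iff[OF translate_L2[OF g rep_l2_L2] translate_L2[OF g f]])
    (use AE_mob[OF SL2R_inv[OF g] rep_abs_l2[OF f]] in \<open>simp add: translate_def\<close>)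

lemma l2_translate_inner:
  assumes g: "g \<in> SL2R"
  shows "l2_translate g x \<bullet> l2_translate g y = x \<bullet> y"
proof -
  obtain f h where "f \<in> L2 hyp_area" "x = abs_l2 f" "h \<in> L2 hyp_area" "y = abs_l2 h"
    by (metis l2_cases)
  thus ?thesis using g by (simp add: l2_translate_abs inner_abs_l2 translate_L2 translate_ip)
qed

lemma l2_translate_inverse:
  assumes g: "g \<in> SL2R"
  shows "l2_translate g (l2_translate (matrix_inv g) x) = x"
proof -
  obtain f where f: "f \<in> L2 hyp_area" "x = abs_l2 f" by (metis l2_cases)
  have "AE z in hyp_area. translate g (translate (matrix_inv g) f) z = f z"
    using AE_hyp_UHP by eventually_elim (rule translate_inverse[OF g])
  thus ?thesis using f g SL2R_inv[OF g] by (simp add: l2_translate_abs translate_L2 abs_l2_eq_iff)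
qed

lemma l2_translate_inner_inv:
  assumes g: "g \<in> SL2R"
  shows "l2_translate g x \<bullet> y = x \<bullet> l2_translate (matrix_inv g) y"
  using l2_translate_inner[OF g, of x "l2_translate (matrix_inv g) y"] by (simp add: l2_translate_inverse[OF g])

lemma norm_l2_translate: "g \<in> SL2R \<Longrightarrow> norm (l2_translate g x) = norm x"
  by (simp add: norm_eq_sqrt_inner l2_translate_inner)

section \<open>Hilbert--Schmidt convergence\<close>

text \<open>Replaces the extended real supremum of infinite sums by finite real sums, the form in
  which the Hilbert-Schmidt estimates below are carried out.\<close>

lemma hs_normsq_finite_sum:
  assumes le: "hs_normsq A \<le> ennreal \<epsilon>" and "0 \<le> \<epsilon>" and E: "onb E" "finite J" "J \<subseteq> E"
  shows "(\<Sum>e\<in>J. nsq nu13 (A e)) \<le> \<epsilon>"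
proof -
  have "ennreal (\<Sum>e\<in>J. nsq nu13 (A e)) = (\<Sum>e\<in>J. ennreal (Re (ipH (A e) (A e))))"
    by (simp add: ip_self sum_ennreal)
  also have "\<dots> \<le> (\<Sum>\<^sub>\<infinity>e\<in>E. ennreal (Re (ipH (A e) (A e))))"
    unfolding infsum_finite[OF E(2), symmetric]
    using E by (intro infsum_mono_neutral nonneg_summable_on_complete) auto
  also have "\<dots> \<le> hs_normsq A"
    unfolding hs_normsq_def using E(1) by (intro SUP_upper) auto
  finally show ?thesis using le \<open>0 \<le> \<epsilon>\<close> by (meson ennreal_le_iff order_trans)
qed

text \<open>An operator and its adjoint have conjugate transposed matrices. The norms of
  \<open>D' e\<close> are expanded by Parseval, the two sums are exchanged, and Bessel bounds the
  rows by the norms of \<open>D e'\<close>.\<close>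

lemma hs_adjoint_finite_sum:
  assumes E: "onb E" and D: "\<And>\<xi>. \<xi> \<in> H13 \<Longrightarrow> D \<xi> \<in> H13" and D': "\<And>\<xi>. \<xi> \<in> H13 \<Longrightarrow> D' \<xi> \<in> H13"
    and adj: "\<And>\<xi> \<psi>. \<xi> \<in> H13 \<Longrightarrow> \<psi> \<in> H13 \<Longrightarrow> ipH (D \<xi>) \<psi> = ipH \<xi> (D' \<psi>)"
    and bd: "\<And>K. finite K \<Longrightarrow> K \<subseteq> E \<Longrightarrow> (\<Sum>e\<in>K. nsq nu13 (D e)) \<le> \<epsilon>"
    and J: "finite J" "J \<subseteq> E"
  shows "(\<Sum>e\<in>J. nsq nu13 (D' e)) \<le> \<epsilon>"
proof -
  have EH: "E \<subseteq> H13" using E by (simp add: onb_def)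
  have "((\<lambda>e'. \<Sum>e\<in>J. (cmod (ipH (D' e) e'))\<^sup>2) has_sum (\<Sum>e\<in>J. nsq nu13 (D' e))) E"
  proof -
    have "((\<lambda>K. \<Sum>e\<in>J. \<Sum>e'\<in>K. (cmod (ipH (D' e) e'))\<^sup>2) \<longlongrightarrow> (\<Sum>e\<in>J. nsq nu13 (D' e))) (finite_subsets_at_top E)"
      using Parseval_nsq[OF E] D' J EH unfolding has_sum_def by (intro tendsto_sum) auto
    moreover have "(\<lambda>K. \<Sum>e\<in>J. \<Sum>e'\<in>K. (cmod (ipH (D' e) e'))\<^sup>2) = sum (\<lambda>e'. \<Sum>e\<in>J. (cmod (ipH (D' e) e'))\<^sup>2)"
      by (rule ext) (rule sum.swap)
    ultimately show ?thesis unfolding has_sum_def by (simp only:)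
  qed
  thus ?thesis
  proof (rule has_sum_le_finite_sums)
    fix K assume K: "finite K" "K \<subseteq> E"
    have "(\<Sum>e'\<in>K. \<Sum>e\<in>J. (cmod (ipH (D' e) e'))\<^sup>2) = (\<Sum>e'\<in>K. \<Sum>e\<in>J. (cmod (ipH (D e') e))\<^sup>2)"
    proof (intro sum.cong refl)
      fix e' e assume "e' \<in> K" "e \<in> J"
      hence "ipH (D e') e = cnj (ipH (D' e) e')"
        using adj[of e' e] K J EH by (subst ip_commute[symmetric]) auto
      thus "(cmod (ipH (D' e) e'))\<^sup>2 = (cmod (ipH (D e') e))\<^sup>2" by simp
    qed
    also have "\<dots> \<le> (\<Sum>e'\<in>K. nsq nu13 (D e'))"
      using K EH by (intro sum_mono Bessel[OF onb_orthonormal[OF E] J] H13_L2 D) auto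
    also have "\<dots> \<le> \<epsilon>" by (rule bd[OF K])
    finally show "(\<Sum>e'\<in>K. \<Sum>e\<in>J. (cmod (ipH (D' e) e'))\<^sup>2) \<le> \<epsilon>" .
  qed
qed

lemma onb_pi13:
  assumes g: "g \<in> SL2R" and E: "onb E"
  shows "onb (pi13 g ` E)"
  unfolding onb_def
proof (intro conjI ballI impI)
  have EH: "E \<subseteq> H13" using E by (simp add: onb_def)
  show "pi13 g ` E \<subseteq> H13" using EH pi13_H13[OF g] by auto
  fix e f assume "e \<in> pi13 g ` E" "f \<in> pi13 g ` E"
  then obtain e' f' where ef: "e = pi13 g e'" "f = pi13 g f'" "e' \<in> E" "f' \<in> E" by auto
  hence "e = f \<longleftrightarrow> e' = f'" using pi13_inverse'[OF g] EH by (metis subset_iff)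
  thus "ipH e f = (if e = f then 1 else 0)"
    using ef E pi13_ip[OF g subsetD[OF EH ef(3)] subsetD[OF EH ef(4)]] by (simp add: onb_def)
next
  have EH: "E \<subseteq> H13" using E by (simp add: onb_def)
  fix \<xi> assume \<xi>: "\<xi> \<in> H13" and 0: "\<forall>e\<in>pi13 g ` E. ipH \<xi> e = 0"
  have "ipH (pi13 (matrix_inv g) \<xi>) e = 0" if "e \<in> E" for e
    using 0 that EH by (subst pi13_adjoint[OF g \<xi>]) auto
  hence "pi13 (matrix_inv g) \<xi> = (\<lambda>_. 0)"
    using E pi13_H13[OF SL2R_inv[OF g] \<xi>] by (auto simp: onb_def)
  hence "\<xi> = pi13 g (\<lambda>_. 0)" using pi13_inverse[OF g \<xi>] by simp
  thus "\<xi> = (\<lambda>_. 0)" by (simp add: pi13_def fun_eq_iff)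
qed

lemma norm_triangle3: "norm (x + y + z) \<le> norm x + norm y + norm (z :: 'a :: real_normed_vector)"
  using norm_triangle_ineq[of "x + y" z] norm_triangle_ineq[of x y] by linarith

text \<open>Cauchy-Schwarz for the Hilbert-Schmidt inner product, truncated to finitely many basis
  vectors.\<close>

lemma sum_cmod_ip_le:
  assumes "\<And>e. e \<in> J \<Longrightarrow> x e \<in> L2 M" "\<And>e. e \<in> J \<Longrightarrow> y e \<in> L2 M"
    and "(\<Sum>e\<in>J. nsq M (x e)) \<le> p" "(\<Sum>e\<in>J. nsq M (y e)) \<le> q"
  shows "(\<Sum>e\<in>J. cmod (ip M (x e) (y e))) \<le> sqrt p * sqrt q"
proof -
  have "(\<Sum>e\<in>J. cmod (ip M (x e) (y e))) \<le> (\<Sum>e\<in>J. \<bar>sqrt (nsq M (x e))\<bar> * \<bar>sqrt (nsq M (y e))\<bar>)"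
    using assms(1,2) by (intro sum_mono) (simp add: cmod_ip_le)
  also have "\<dots> \<le> L2_set (\<lambda>e. sqrt (nsq M (x e))) J * L2_set (\<lambda>e. sqrt (nsq M (y e))) J"
    by (rule L2_set_mult_ineq)
  also have "\<dots> = sqrt (\<Sum>e\<in>J. nsq M (x e)) * sqrt (\<Sum>e\<in>J. nsq M (y e))" by (simp add: L2_set_def)
  also have "\<dots> \<le> sqrt p * sqrt q"
    using assms(3,4) order_trans[OF sum_nonneg assms(3)] by (intro mult_mono) (auto intro!: sum_nonneg)
  finally show ?thesis .
qed

lemma pi13_scale: "pi13 g (\<lambda>z. a * f z) = (\<lambda>z. a * pi13 g f z)"
  by (simp add: pi13_def fun_eq_iff)

text \<open>Conjugating the rank one operator of \<eta> by a unitary gives the rank one operator of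
  the image of \<eta>.\<close>

lemma rank_one_sandwich:
  assumes g: "g \<in> SL2R" and \<eta>: "\<eta> \<in> H13" and \<xi>: "\<xi> \<in> H13"
  shows "pi13 g (\<lambda>z. ipH (pi13 (matrix_inv g) \<xi>) \<eta> * \<eta> z) = (\<lambda>z. ipH \<xi> (pi13 g \<eta>) * pi13 g \<eta> z)"
  unfolding pi13_adjoint[OF g \<xi> \<eta>] by (rule pi13_scale)

text \<open>The summand is <P e, Q e> for the rank one operators P of \<open>pi13 g \<eta>\<close>
  and Q of \<eta>, so the sum is Tr (Q P); Parseval evaluates it.\<close>

lemma rank_one_trace:
  assumes E: "onb E" and g: "g \<in> SL2R" and \<eta>: "\<eta> \<in> H13"
  shows "((\<lambda>e. ipH e (pi13 g \<eta>) * ipH (pi13 g \<eta>) \<eta> * ipH \<eta> e) has_sum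
    of_real ((cmod (ipH (pi13 g \<eta>) \<eta>))\<^sup>2)) E"
proof -
  have "((\<lambda>e. (ipH \<eta> e * ipH e (pi13 g \<eta>)) * ipH (pi13 g \<eta>) \<eta>) has_sum
      ipH \<eta> (pi13 g \<eta>) * ipH (pi13 g \<eta>) \<eta>) E"
    by (intro has_sum_cmult_left Parseval E \<eta> H13_L2 pi13_H13 g)
  also have "ipH \<eta> (pi13 g \<eta>) * ipH (pi13 g \<eta>) \<eta> = of_real ((cmod (ipH (pi13 g \<eta>) \<eta>))\<^sup>2)"
    by (subst ip_commute[of nu13 \<eta>]) (simp add: mult.commute[of "cnj _"] mult_cnj_self)
  finally show ?thesis by (simp add: mult_ac)
qed

text \<open>In a fixed basis the trace becomes the sum of \<open>ipH (a n e) (b n e)\<close>, a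
  Hilbert-Schmidt inner product of two convergent families. Continuity of that product gives the
  limit, and \<open>rank_one_trace\<close> identifies it.\<close>

lemma toeplitz_trace_tendsto:
  assumes g: "g \<in> SL2R" and \<eta>: "\<eta> \<in> H13" and f: "\<And>n. f n \<in> L2 hyp_area"
    and T: "\<And>\<xi>. \<xi> \<in> H13 \<Longrightarrow> T \<xi> = (\<lambda>z. ipH \<xi> \<eta> * \<eta> z)"
    and lim: "(\<lambda>n. hs_normsq (\<lambda>\<xi> z. toeplitz (f n) \<xi> z - T \<xi> z)) \<longlonglongrightarrow> 0"
    and tr: "\<And>n. has_trace (toeplitz (f n) \<circ> op_adjoint (toeplitz (translate g (f n)))) (\<tau> n)"
  shows "\<tau> \<longlonglongrightarrow> of_real ((cmod (ipH (pi13 g \<eta>) \<eta>))\<^sup>2)" (is "_ \<longlonglongrightarrow> ?t")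
proof -
  let ?h = "matrix_inv g"
  have h: "?h \<in> SL2R" by (rule SL2R_inv[OF g])
  obtain E where E: "onb E" using onb_exists by blast
  have EH: "E \<subseteq> H13" using E by (simp add: onb_def)
  \<comment> \<open>Conjugation by \<open>pi13 g\<close> replaces the basis E by this one, so the
    estimates for b are needed in two bases.\<close>
  define E' where "E' = pi13 ?h ` E"
  have E': "onb E'" unfolding E'_def by (rule onb_pi13[OF h E])
  define \<delta> where "\<delta> n = enn2real (hs_normsq (\<lambda>\<xi> z. toeplitz (f n) \<xi> z - T \<xi> z))" for n
  have \<delta>0: "\<delta> \<longlonglongrightarrow> 0" unfolding \<delta>_def using tendsto_enn2real[of _ 0] lim by simp
  \<comment> \<open>Where the norm is infinite, \<open>enn2real\<close> yields 0 and \<delta> bounds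
    nothing; the main estimate is therefore claimed only eventually.\<close>
  have fin: "\<forall>\<^sub>F n in sequentially. hs_normsq (\<lambda>\<xi> z. toeplitz (f n) \<xi> z - T \<xi> z) < top"
    using order_tendstoD(2)[OF lim, of top] by simp
  have TH: "T \<xi> \<in> H13" if "\<xi> \<in> H13" for \<xi> unfolding T[OF that] by (rule H13_scale[OF \<eta>])
  have Tsym: "ipH (T \<xi>) \<psi> = ipH \<xi> (T \<psi>)" if "\<xi> \<in> H13" "\<psi> \<in> H13" for \<xi> \<psi>
    using that \<eta> by (simp add: T ip_scale_left ip_scale_right H13_L2 ip_commute[of nu13 \<eta>])
  \<comment> \<open>The squared Hilbert-Schmidt norm of the rank one operator T.\<close>
  define A where "A = (nsq nu13 \<eta>)\<^sup>2"
  have TA: "(\<Sum>e\<in>J. nsq nu13 (T e)) \<le> A" if "onb X" "finite J" "J \<subseteq> X" for X J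
  proof -
    have XH: "X \<subseteq> H13" using that by (simp add: onb_def)
    have "(\<Sum>e\<in>J. nsq nu13 (T e)) = (\<Sum>e\<in>J. (cmod (ipH \<eta> e))\<^sup>2) * nsq nu13 \<eta>"
      unfolding sum_distrib_right
    proof (intro sum.cong refl)
      fix e assume "e \<in> J"
      hence "e \<in> H13" using that XH by auto
      have "cmod (ipH e \<eta>) = cmod (ipH \<eta> e)" by (subst ip_commute) simp
      thus "nsq nu13 (T e) = (cmod (ipH \<eta> e))\<^sup>2 * nsq nu13 \<eta>"
        unfolding T[OF \<open>e \<in> H13\<close>] nsq_scale by simp
    qed
    also have "\<dots> \<le> nsq nu13 \<eta> * nsq nu13 \<eta>"
      by (intro mult_right_mono Bessel[OF onb_orthonormal[OF that(1)] that(2,3)] H13_L2 \<eta>) simp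
    finally show ?thesis by (simp add: A_def power2_eq_square)
  qed
  \<comment> \<open>b is the adjoint of \<open>toeplitz (f n)\<close> and a its conjugate by
    \<open>pi13 g\<close>; the respective limits are T, which is symmetric, and a0.\<close>
  define b where "b n \<xi> = toeplitz (\<lambda>z. cnj (f n z)) \<xi>" for n \<xi>
  have bH: "b n \<xi> \<in> H13" if "\<xi> \<in> H13" for n \<xi>
    unfolding b_def by (intro toeplitz_H13 L2_cnj f that)
  define a where "a n e = pi13 g (b n (pi13 ?h e))" for n e
  define a0 where "a0 e = pi13 g (T (pi13 ?h e))" for e
  have aH: "a n e \<in> H13" "a0 e \<in> H13" if "e \<in> H13" for n e
    unfolding a_def a0_def using that by (auto intro!: pi13_H13 g h bH TH)
  \<comment> \<open>With a = a0 + x and b = T + y, the difference <a, b> - <a0, T> is <x, y> + <x,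
    T> + <a0, y>, where x and y have squared norm at most \<delta> and T and a0 at most A.\<close>
  have main: "norm (\<tau> n - ?t) \<le> \<delta> n + 2 * (sqrt (\<delta> n) * sqrt A)"
    if n: "hs_normsq (\<lambda>\<xi> z. toeplitz (f n) \<xi> z - T \<xi> z) < top" for n
  proof -
    have \<delta>: "hs_normsq (\<lambda>\<xi> z. toeplitz (f n) \<xi> z - T \<xi> z) \<le> ennreal (\<delta> n)" "\<delta> n \<ge> 0"
      unfolding \<delta>_def using n by simp_all
    have adj: "(\<Sum>e\<in>J. nsq nu13 (\<lambda>z. b n e z - T e z)) \<le> \<delta> n" if X: "onb X" and J: "finite J" "J \<subseteq> X" for X J
    proof (rule hs_adjoint_finite_sum[where D = "\<lambda>\<xi> z. toeplitz (f n) \<xi> z - T \<xi> z" and E = X])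
      show "(\<Sum>e\<in>K. nsq nu13 (\<lambda>z. toeplitz (f n) e z - T e z)) \<le> \<delta> n" if "finite K" "K \<subseteq> X" for K
        by (rule hs_normsq_finite_sum[OF \<delta> X that])
      fix \<xi> \<psi> assume "\<xi> \<in> H13" "\<psi> \<in> H13"
      thus "ipH (\<lambda>z. toeplitz (f n) \<xi> z - T \<xi> z) \<psi> = ipH \<xi> (\<lambda>z. b n \<psi> z - T \<psi> z)"
        using f bH[of \<psi> n]
        by (simp add: ip_diff_left ip_diff_right H13_L2 TH toeplitz_H13 toeplitz_cnj Tsym b_def)
    qed (use X J in \<open>auto intro!: H13_diff TH bH toeplitz_H13 f\<close>)
    have adj': "(\<Sum>e\<in>J. nsq nu13 (\<lambda>z. a n e z - a0 e z)) \<le> \<delta> n" if J: "finite J" "J \<subseteq> E" for J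
    proof -
      have "nsq nu13 (\<lambda>z. a n e z - a0 e z) = nsq nu13 (\<lambda>z. b n (pi13 ?h e) z - T (pi13 ?h e) z)"
        if "e \<in> J" for e
      proof -
        have "pi13 ?h e \<in> H13" using that J EH by (auto intro: pi13_H13 h)
        hence H: "(\<lambda>z. b n (pi13 ?h e) z - T (pi13 ?h e) z) \<in> H13" by (intro H13_diff bH TH)
        have "(\<lambda>z. a n e z - a0 e z) = pi13 g (\<lambda>z. b n (pi13 ?h e) z - T (pi13 ?h e) z)"
          by (auto simp: a_def a0_def pi13_def diff_divide_distrib)
        thus ?thesis using pi13_ip[OF g H H] by (simp add: nsq_eq_ip)
      qed
      hence "(\<Sum>e\<in>J. nsq nu13 (\<lambda>z. a n e z - a0 e z)) =
          (\<Sum>e\<in>J. nsq nu13 (\<lambda>z. b n (pi13 ?h e) z - T (pi13 ?h e) z))" by (rule sum.cong[OF refl])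
      also have "\<dots> = (\<Sum>e\<in>pi13 ?h ` J. nsq nu13 (\<lambda>z. b n e z - T e z))"
      proof (rule sum.reindex_cong[symmetric, OF _ refl refl])
        show "inj_on (pi13 ?h) J"
          by (rule inj_on_inverseI[of _ "pi13 g"]) (use J EH pi13_inverse[OF g] in auto)
      qed
      also have "\<dots> \<le> \<delta> n" using J by (intro adj[OF E']) (auto simp: E'_def)
      finally show ?thesis .
    qed
    have a0A: "(\<Sum>e\<in>J. nsq nu13 (a0 e)) \<le> A" if J: "finite J" "J \<subseteq> E" for J
    proof -
      have "nsq nu13 (a0 e) = nsq nu13 (T (pi13 ?h e))" if "e \<in> J" for e
        unfolding a0_def nsq_eq_ip using that J EH by (subst pi13_ip[OF g]) (auto intro!: TH pi13_H13 h)
      hence "(\<Sum>e\<in>J. nsq nu13 (a0 e)) = (\<Sum>e\<in>J. nsq nu13 (T (pi13 ?h e)))" by (rule sum.cong[OF refl])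
      also have "\<dots> = (\<Sum>e\<in>pi13 ?h ` J. nsq nu13 (T e))"
      proof (rule sum.reindex_cong[symmetric, OF _ refl refl])
        show "inj_on (pi13 ?h) J"
          by (rule inj_on_inverseI[of _ "pi13 g"]) (use J EH pi13_inverse[OF g] in auto)
      qed
      also have "\<dots> \<le> A" using J by (intro TA[OF E']) (auto simp: E'_def)
      finally show ?thesis .
    qed
    \<comment> \<open>Covariance turns the adjoint of the translated operator into a, and moving
      \<open>toeplitz (f n)\<close> to the other side of the inner product produces b.\<close>
    have "((\<lambda>e. ipH ((toeplitz (f n) \<circ> op_adjoint (toeplitz (translate g (f n)))) e) e) has_sum \<tau> n) E"
      using tr E by (auto simp: has_trace_def)
    also have "?this \<longleftrightarrow> ((\<lambda>e. ipH (a n e) (b n e)) has_sum \<tau> n) E"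
    proof (rule has_sum_cong)
      fix e assume "e \<in> E"
      hence e: "e \<in> H13" using EH by auto
      have "op_adjoint (toeplitz (translate g (f n))) e = toeplitz (translate g (\<lambda>z. cnj (f n z))) e"
        by (subst op_adjoint_toeplitz[OF translate_L2[OF g f] e]) (simp add: translate_def)
      also have "\<dots> = a n e"
        unfolding a_def b_def by (rule toeplitz_translate[OF g L2_cnj[OF f] e])
      finally show "ipH ((toeplitz (f n) \<circ> op_adjoint (toeplitz (translate g (f n)))) e) e = ipH (a n e) (b n e)"
        by (simp add: toeplitz_cnj[OF f aH(1)[OF e] e] b_def)
    qed
    finally have 1: "((\<lambda>e. ipH (a n e) (b n e)) has_sum \<tau> n) E" .
    have 2: "((\<lambda>e. ipH (a0 e) (T e)) has_sum ?t) E"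
    proof (rule has_sum_cong[THEN iffD1, OF _ rank_one_trace[OF E g \<eta>]])
      fix e assume "e \<in> E"
      hence e: "e \<in> H13" using EH by auto
      have "a0 e = (\<lambda>z. ipH e (pi13 g \<eta>) * pi13 g \<eta> z)"
        unfolding a0_def T[OF pi13_H13[OF h e]] by (rule rank_one_sandwich[OF g \<eta> e])
      thus "ipH e (pi13 g \<eta>) * ipH (pi13 g \<eta>) \<eta> * ipH \<eta> e = ipH (a0 e) (T e)"
        using \<eta> pi13_H13[OF g \<eta>]
        by (simp add: T[OF e] ip_scale_left ip_scale_right H13_L2 L2_scale ip_commute[of nu13 \<eta> e])
    qed
    show ?thesis
    proof (rule tendsto_upperbound)
      show "((\<lambda>J. norm ((\<Sum>e\<in>J. ipH (a n e) (b n e)) - (\<Sum>e\<in>J. ipH (a0 e) (T e)))) \<longlongrightarrow> norm (\<tau> n - ?t))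
          (finite_subsets_at_top E)"
        using 1 2 unfolding has_sum_def by (intro tendsto_norm tendsto_diff)
      show "\<forall>\<^sub>F J in finite_subsets_at_top E.
          norm ((\<Sum>e\<in>J. ipH (a n e) (b n e)) - (\<Sum>e\<in>J. ipH (a0 e) (T e))) \<le> \<delta> n + 2 * (sqrt (\<delta> n) * sqrt A)"
      proof (rule eventually_finite_subsets_at_top_weakI)
        fix J assume J: "finite J" "J \<subseteq> E"
        let ?x = "\<lambda>e z. a n e z - a0 e z" and ?y = "\<lambda>e z. b n e z - T e z"
        have L: "a n e \<in> L2 nu13" "a0 e \<in> L2 nu13" "b n e \<in> L2 nu13" "T e \<in> L2 nu13"
          "?x e \<in> L2 nu13" "?y e \<in> L2 nu13" if "e \<in> J" for e
          using that J EH by (auto intro!: H13_L2 H13_diff aH bH TH)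
        have "ipH (a n e) (b n e) - ipH (a0 e) (T e) = ipH (?x e) (?y e) + ipH (?x e) (T e) + ipH (a0 e) (?y e)"
          if "e \<in> J" for e
          using L[OF that] by (simp add: ip_diff_left ip_diff_right)
        hence eq: "(\<Sum>e\<in>J. ipH (a n e) (b n e)) - (\<Sum>e\<in>J. ipH (a0 e) (T e)) =
            (\<Sum>e\<in>J. ipH (?x e) (?y e) + ipH (?x e) (T e) + ipH (a0 e) (?y e))"
          unfolding sum_subtractf[symmetric] by (rule sum.cong[OF refl])
        have "norm ((\<Sum>e\<in>J. ipH (a n e) (b n e)) - (\<Sum>e\<in>J. ipH (a0 e) (T e))) \<le>
            (\<Sum>e\<in>J. norm (ipH (?x e) (?y e) + ipH (?x e) (T e) + ipH (a0 e) (?y e)))"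
          unfolding eq by (rule norm_sum)
        also have "\<dots> \<le> (\<Sum>e\<in>J. cmod (ipH (?x e) (?y e)) + cmod (ipH (?x e) (T e)) + cmod (ipH (a0 e) (?y e)))"
          by (intro sum_mono norm_triangle3)
        also have "\<dots> = (\<Sum>e\<in>J. cmod (ipH (?x e) (?y e))) + (\<Sum>e\<in>J. cmod (ipH (?x e) (T e)))
            + (\<Sum>e\<in>J. cmod (ipH (a0 e) (?y e)))"
          by (simp add: sum.distrib)
        also have "\<dots> \<le> sqrt (\<delta> n) * sqrt (\<delta> n) + sqrt (\<delta> n) * sqrt A + sqrt A * sqrt (\<delta> n)"
          by (intro add_mono sum_cmod_ip_le L adj' adj[OF E] TA[OF E] a0A J)
        finally show "norm ((\<Sum>e\<in>J. ipH (a n e) (b n e)) - (\<Sum>e\<in>J. ipH (a0 e) (T e))) \<le>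
            \<delta> n + 2 * (sqrt (\<delta> n) * sqrt A)"
          using \<delta>(2) by (simp add: mult.commute[of "sqrt A"])
      qed
    qed simp
  qed
  have "(\<lambda>n. \<tau> n - ?t) \<longlonglongrightarrow> 0"
  proof (rule Lim_null_comparison)
    show "\<forall>\<^sub>F n in sequentially. norm (\<tau> n - ?t) \<le> \<delta> n + 2 * (sqrt (\<delta> n) * sqrt A)"
      using fin by eventually_elim (rule main)
    have "(\<lambda>n. \<delta> n + 2 * (sqrt (\<delta> n) * sqrt A)) \<longlonglongrightarrow> 0 + 2 * (sqrt 0 * sqrt A)"
      by (intro tendsto_intros \<delta>0)
    thus "(\<lambda>n. \<delta> n + 2 * (sqrt (\<delta> n) * sqrt A)) \<longlonglongrightarrow> 0" by simp
  qed
  thus ?thesis by (simp add: LIM_zero_iff)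
qed

section \<open>The square root of the Berezin transform\<close>

lemma scale_measure_eq_density: "scale_measure r M = density M (\<lambda>_. r)"
  by (rule measure_eqI) (simp_all add: emeasure_density_const)

context
  fixes c :: real
  assumes c: "c > 0"
begin

abbreviation "scaled_hyp \<equiv> scale_measure (ennreal c) hyp_area"

lemma integral_scaled_hyp:
  fixes f :: "complex \<Rightarrow> 'a :: {banach, second_countable_topology}"
  assumes "f \<in> borel_measurable borel"
  shows "(LINT z|scaled_hyp. f z) = c *\<^sub>R (LINT z|hyp_area. f z)"
  unfolding scale_measure_eq_density using assms c by (subst integral_density) auto

lemma integrable_scaled_hyp:
  fixes f :: "complex \<Rightarrow> 'a :: {banach, second_countable_topology}"
  assumes "f \<in> borel_measurable borel"
  shows "integrable scaled_hyp f \<longleftrightarrow> integrable hyp_area f"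
proof -
  have "integrable scaled_hyp f \<longleftrightarrow> integrable hyp_area (\<lambda>z. c *\<^sub>R f z)"
    unfolding scale_measure_eq_density using assms c by (subst integrable_density) auto
  also have "\<dots> \<longleftrightarrow> integrable hyp_area f"
    using c integrable_scaleR_right[of "1 / c" hyp_area "\<lambda>z. c *\<^sub>R f z"] by auto
  finally show ?thesis .
qed

lemma L2_scaled_hyp: "L2 scaled_hyp = L2 hyp_area"
proof -
  have "integrable scaled_hyp (\<lambda>z. (cmod (f z))\<^sup>2) \<longleftrightarrow> integrable hyp_area (\<lambda>z. (cmod (f z))\<^sup>2)"
    if [measurable]: "f \<in> borel_measurable borel" for f :: "complex \<Rightarrow> complex"
    by (rule integrable_scaled_hyp) measurable
  thus ?thesis by (auto simp: L2_def cong: measurable_cong_sets)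
qed

lemma ip_scaled_hyp:
  assumes "f \<in> L2 hyp_area" "g \<in> L2 hyp_area"
  shows "ip scaled_hyp f g = of_real c * ip hyp_area f g"
proof -
  have [measurable]: "f \<in> borel_measurable borel" "(\<lambda>z. cnj (g z)) \<in> borel_measurable borel"
    using L2_hyp_measurable[OF assms(1)] L2_hyp_measurable[OF L2_cnj[OF assms(2)]] by auto
  show ?thesis unfolding ip_def by (subst integral_scaled_hyp) (measurable, simp add: scaleR_conv_of_real)
qed

lemma nsq_scaled_hyp: "f \<in> L2 hyp_area \<Longrightarrow> nsq scaled_hyp f = c * nsq hyp_area f"
  by (simp add: nsq_eq_ip ip_scaled_hyp)

lemma L2_tendsto_scaled_hyp:
  assumes "\<And>n. h n \<in> L2 hyp_area" "k \<in> L2 hyp_area"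
  shows "L2_tendsto scaled_hyp h k \<longleftrightarrow> (\<lambda>n. nsq hyp_area (\<lambda>z. h n z - k z)) \<longlonglongrightarrow> 0"
proof -
  have "L2_tendsto scaled_hyp h k \<longleftrightarrow> (\<lambda>n. c * nsq hyp_area (\<lambda>z. h n z - k z)) \<longlonglongrightarrow> 0"
    unfolding L2_tendsto_def nsq_def[symmetric] using assms by (simp add: nsq_scaled_hyp L2_diff)
  also have "\<dots> \<longleftrightarrow> (\<lambda>n. nsq hyp_area (\<lambda>z. h n z - k z)) \<longlonglongrightarrow> 0"
    using c tendsto_mult_left_iff[of c _ 0] by simp
  finally show ?thesis .
qed

end

lemma ip_tendsto:
  assumes L: "\<And>n. h n \<in> L2 M" "\<And>n. k n \<in> L2 M" "h0 \<in> L2 M" "k0 \<in> L2 M"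
    and h: "(\<lambda>n. nsq M (\<lambda>z. h n z - h0 z)) \<longlonglongrightarrow> 0"
    and k: "(\<lambda>n. nsq M (\<lambda>z. k n z - k0 z)) \<longlonglongrightarrow> 0"
  shows "(\<lambda>n. ip M (h n) (k n)) \<longlonglongrightarrow> ip M h0 k0"
proof -
  let ?x = "\<lambda>n z. h n z - h0 z" and ?y = "\<lambda>n z. k n z - k0 z"
  let ?r = "\<lambda>n. sqrt (nsq M (?x n)) * sqrt (nsq M (?y n)) + sqrt (nsq M (?x n)) * sqrt (nsq M k0)
    + sqrt (nsq M h0) * sqrt (nsq M (?y n))"
  have "(\<lambda>n. ip M (h n) (k n) - ip M h0 k0) \<longlonglongrightarrow> 0"
  proof (rule Lim_null_comparison)
    show "\<forall>\<^sub>F n in sequentially. norm (ip M (h n) (k n) - ip M h0 k0) \<le> ?r n"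
    proof (rule always_eventually, rule allI)
      fix n
      have eq: "ip M (h n) (k n) - ip M h0 k0 = ip M (?x n) (?y n) + ip M (?x n) k0 + ip M h0 (?y n)"
        using L by (simp add: ip_diff_left ip_diff_right L2_diff)
      have "norm (ip M (h n) (k n) - ip M h0 k0) \<le> cmod (ip M (?x n) (?y n)) + cmod (ip M (?x n) k0) + cmod (ip M h0 (?y n))"
        unfolding eq by (rule norm_triangle3)
      also have "\<dots> \<le> ?r n" by (intro add_mono cmod_ip_le L2_diff L)
      finally show "norm (ip M (h n) (k n) - ip M h0 k0) \<le> ?r n" .
    qed
    have "?r \<longlonglongrightarrow> sqrt 0 * sqrt 0 + sqrt 0 * sqrt (nsq M k0) + sqrt (nsq M h0) * sqrt 0"
      by (intro tendsto_intros h k)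
    thus "?r \<longlonglongrightarrow> 0" by simp
  qed
  thus ?thesis by (simp add: LIM_zero_iff)
qed

section \<open>The inverse of the square root of B\<close>

locale berezin_root =
  fixes c :: real and B S :: graph
  assumes c: "c > 0"
    and berezin: "berezin_operator (scale_measure (ennreal c) hyp_area) B"
    and root: "positive_sqrt (scale_measure (ennreal c) hyp_area) S B"
begin

abbreviation "M \<equiv> scale_measure (ennreal c) hyp_area"

lemmas L2_M = L2_scaled_hyp[OF c] and ip_M = ip_scaled_hyp[OF c] and L2_tendsto_M = L2_tendsto_scaled_hyp[OF c]

lemma S_selfadjoint: "positive_selfadjoint M S" and S_square: "S O S = B"
  using root by (simp_all add: positive_sqrt_def)

lemma S_graph: "S = {(u, v). u \<in> L2 M \<and> v \<in> L2 M \<and> (\<forall>(f, g)\<in>S. ip M g u = ip M f v)}"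
  using S_selfadjoint unfolding positive_selfadjoint_def by (elim conjE)

lemma S_graphD:
  "(u, v) \<in> S \<Longrightarrow> u \<in> L2 M \<and> v \<in> L2 M \<and> (\<forall>(f, g)\<in>S. ip M g u = ip M f v)"
  by (drule subsetD[OF equalityD1[OF S_graph]]) simp

lemma S_L2: "(h, f) \<in> S \<Longrightarrow> h \<in> L2 hyp_area" "(h, f) \<in> S \<Longrightarrow> f \<in> L2 hyp_area"
  using S_graphD[of h f] by (simp_all add: L2_M)

lemma S_sym:
  assumes "(h, f) \<in> S" "(h', f') \<in> S"
  shows "ip hyp_area f h' = ip hyp_area h f'"
proof -
  have "ip M f h' = ip M h f'" using S_graphD[OF assms(2)] assms(1) by auto
  thus ?thesis using c assms by (simp add: ip_M S_L2)
qed

lemma S_pos: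
  assumes "(h, f) \<in> S"
  shows "0 \<le> Re (ip hyp_area h f)"
proof -
  have "\<forall>(f, g)\<in>S. ip M g f \<in> \<real> \<and> Re (ip M g f) \<ge> 0"
    using S_selfadjoint unfolding positive_selfadjoint_def by (elim conjE)
  hence "0 \<le> Re (ip M f h)" using assms by auto
  hence "0 \<le> Re (ip hyp_area f h)" using c assms by (simp add: ip_M S_L2 zero_le_mult_iff)
  thus ?thesis by (subst ip_commute) simp
qed

lemma B_S:
  assumes "(u, f) \<in> B"
  obtains w where "(u, w) \<in> S" "(w, f) \<in> S"
proof -
  have "(u, f) \<in> S O S" using assms S_square by simp
  thus ?thesis using that by blast
qed

lemma B_range:
  assumes "f \<in> L2 hyp_area" "g \<in> L2 hyp_area"
  obtains u where "(u, f) \<in> B" "has_trace (toeplitz f \<circ> op_adjoint (toeplitz g)) (ip M u g)"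
proof -
  have "\<forall>f\<in>L2 M. \<forall>g\<in>L2 M. \<exists>u. (f, u) \<in> B\<inverse> \<and>
      has_trace (toeplitz f \<circ> op_adjoint (toeplitz g)) (ip M u g)"
    using berezin unfolding berezin_operator_def by (elim conjE)
  thus ?thesis using assms that unfolding L2_M converse_iff by metis
qed

lemma B_translate:
  assumes "g \<in> SL2R" "(u, f) \<in> B"
  shows "(translate g u, translate g f) \<in> B"
proof -
  have "\<forall>g\<in>SL2R. \<forall>(f, h)\<in>B. (translate g f, translate g h) \<in> B"
    using berezin unfolding berezin_operator_def by (elim conjE)
  thus ?thesis using assms by auto
qed

text \<open>The trace clause makes B surjective onto L2, and B = \<open>S O S\<close>; so the
  inverse of S is defined everywhere.\<close>

lemma S_range:
  assumes "f \<in> L2 hyp_area"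
  obtains h where "(h, f) \<in> S"
proof -
  obtain u where "(u, f) \<in> B" using B_range[OF assms assms] .
  thus ?thesis by (rule B_S) (rule that)
qed

text \<open>The bounded operator \<open>S\<inverse>\<close>, on classes modulo equality almost everywhere.\<close>

definition R :: "l2 \<Rightarrow> l2" where
  "R x = abs_l2 (SOME h. (h, rep_l2 x) \<in> S)"

text \<open>Independence of the chosen preimage and of the representative: by symmetry of S, the
  inner product of h with any g = S k is that of f with k, and every g has this form.\<close>

lemma R_abs:
  assumes hf: "(h, f) \<in> S"
  shows "R (abs_l2 f) = abs_l2 h"
proof -
  define f0 h0 where "f0 = rep_l2 (abs_l2 f)" and "h0 = (SOME h. (h, f0) \<in> S)"
  have f: "f \<in> L2 hyp_area" "h \<in> L2 hyp_area" using S_L2 hf by auto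
  have f0: "f0 \<in> L2 hyp_area" "AE z in hyp_area. f0 z = f z"
    unfolding f0_def by (rule rep_l2_L2, rule rep_abs_l2[OF f(1)])
  obtain h1 where "(h1, f0) \<in> S" using S_range[OF f0(1)] .
  hence h0: "(h0, f0) \<in> S" unfolding h0_def by (rule someI[of "\<lambda>h. (h, f0) \<in> S"])
  have "abs_l2 h0 = abs_l2 h"
  proof (rule vector_eq_rdot[THEN iffD1], rule allI)
    fix y
    obtain g where g: "g \<in> L2 hyp_area" "y = abs_l2 g" by (rule l2_cases)
    obtain k where k: "(k, g) \<in> S" using S_range[OF g(1)] .
    have "ip hyp_area h0 g = ip hyp_area f0 k" using S_sym[OF h0 k] by simp
    also have "\<dots> = ip hyp_area f k"
      using S_L2[OF k] by (intro ip_cong_AE f0 f) auto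
    also have "\<dots> = ip hyp_area h g" by (rule S_sym[OF hf k])
    finally show "abs_l2 h0 \<bullet> y = abs_l2 h \<bullet> y"
      using S_L2[OF h0] f g by (simp add: inner_abs_l2)
  qed
  thus ?thesis by (simp add: R_def h0_def f0_def)
qed

lemma R_cases:
  obtains h f where "(h, f) \<in> S" "x = abs_l2 f" "R x = abs_l2 h"
proof -
  obtain f where f: "f \<in> L2 hyp_area" "x = abs_l2 f" by (rule l2_cases)
  obtain h where "(h, f) \<in> S" using S_range[OF f(1)] .
  thus ?thesis using that f(2) R_abs by blast
qed

lemma R_sym: "R x \<bullet> y = x \<bullet> R y"
proof -
  obtain h f where 1: "(h, f) \<in> S" "x = abs_l2 f" "R x = abs_l2 h" by (rule R_cases)
  obtain k g where 2: "(k, g) \<in> S" "y = abs_l2 g" "R y = abs_l2 k" by (rule R_cases)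
  show ?thesis
    unfolding 1(3) 2(3) unfolding 1(2) 2(2)
    using S_sym[OF 1(1) 2(1)] S_L2[OF 1(1)] S_L2[OF 2(1)] by (simp add: inner_abs_l2)
qed

lemma R_pos: "0 \<le> R x \<bullet> x"
proof -
  obtain h f where 1: "(h, f) \<in> S" "x = abs_l2 f" "R x = abs_l2 h" by (rule R_cases)
  show ?thesis
    unfolding 1(3) unfolding 1(2) using S_pos[OF 1(1)] S_L2[OF 1(1)] by (simp add: inner_abs_l2)
qed

lemma R_square:
  assumes "(u, f) \<in> B"
  shows "R (R (abs_l2 f)) = abs_l2 u"
proof -
  obtain w where "(u, w) \<in> S" "(w, f) \<in> S" using assms by (rule B_S)
  thus ?thesis by (simp add: R_abs)
qed

text \<open>The trace formula turns \<open>\<parallel>S\<inverse> f\<parallel>\<^sup>2 = \<langle>B\<inverse> f, f\<rangle>\<close> into a Hilbert--Schmidt norm.\<close>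

lemma R_norm_sq: "c * (norm (R x))\<^sup>2 \<le> bergman_const * (norm x)\<^sup>2"
proof -
  obtain f where f: "f \<in> L2 hyp_area" "x = abs_l2 f" by (rule l2_cases)
  obtain u where u: "(u, f) \<in> B" "has_trace (toeplitz f \<circ> op_adjoint (toeplitz f)) (ip M u f)"
    using B_range[OF f(1) f(1)] .
  obtain w where w: "(u, w) \<in> S" "(w, f) \<in> S" using u(1) by (rule B_S)
  obtain E where E: "onb E" using onb_exists by blast
  have EH: "E \<subseteq> H13" using E by (simp add: onb_def)
  let ?f = "\<lambda>z. cnj (f z)"
  \<comment> \<open>Each diagonal coefficient is the squared norm of the adjoint at e, and the
    adjoint is the Toeplitz operator of the conjugate symbol, so \<open>toeplitz_hs_bound\<close>
    applies.\<close>
  have "ipH ((toeplitz f \<circ> op_adjoint (toeplitz f)) e) e = of_real (nsq nu13 (toeplitz ?f e))" if "e \<in> H13" for e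
    using that f by (simp add: op_adjoint_toeplitz toeplitz_cnj toeplitz_H13 L2_cnj ip_self)
  hence "((\<lambda>e. complex_of_real (nsq nu13 (toeplitz ?f e))) has_sum ip M u f) E"
    using u(2) E EH unfolding has_trace_def by (subst has_sum_cong[where g = "\<lambda>e. ipH ((toeplitz f \<circ> op_adjoint (toeplitz f)) e) e"]) (auto simp del: o_apply)
  from has_sum_Re[OF this] have "((\<lambda>e. nsq nu13 (toeplitz ?f e)) has_sum Re (ip M u f)) E" by simp
  hence "Re (ip M u f) \<le> bergman_const * nsq hyp_area ?f"
    by (rule has_sum_le_finite_sums) (rule toeplitz_hs_bound[OF L2_cnj[OF f(1)] onb_orthonormal[OF E]])
  also have "nsq hyp_area ?f = nsq hyp_area f" by (simp add: nsq_def)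
  also have "ip M u f = of_real c * ip hyp_area w w"
    using S_sym[OF w] S_L2[OF w(1)] f by (simp add: ip_M)
  finally have "c * nsq hyp_area w \<le> bergman_const * nsq hyp_area f" by (simp add: ip_self)
  thus ?thesis using R_abs[OF w(2)] S_L2[OF w(2)] f by (simp add: norm_abs_l2)
qed

text \<open>The added 1 makes the constant strictly positive, as \<open>positive_sqrt_unique\<close>
  demands.\<close>

lemma R_bounded: "norm (R x) \<le> (sqrt (bergman_const / c) + 1) * norm x"
proof -
  have "(norm (R x))\<^sup>2 \<le> (bergman_const / c) * (norm x)\<^sup>2"
    using R_norm_sq[of x] c by (simp add: field_simps)
  from real_le_rsqrt[OF this] have "norm (R x) \<le> sqrt (bergman_const / c) * norm x"
    unfolding real_sqrt_mult by simp
  thus ?thesis by (simp add: distrib_right add_increasing2)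
qed

text \<open>Uniqueness of the positive square root of \<open>B\<inverse>\<close> passes the invariance of \<open>B\<close> on to \<open>S\<close>.\<close>

lemma R_translate:
  assumes g: "g \<in> SL2R"
  shows "R (l2_translate g x) = l2_translate g (R x)"
proof -
  let ?U = "l2_translate g" and ?V = "l2_translate (matrix_inv g)"
  have h: "matrix_inv g \<in> SL2R" by (rule SL2R_inv[OF g])
  have UV: "?U (?V x) = x" and VU: "?V (?U x) = x" for x
    using l2_translate_inverse[OF g] l2_translate_inverse[OF h] by (simp_all add: matrix_inv_inv[OF g])
  have adj: "?U x \<bullet> y = x \<bullet> ?V y" for x y by (rule l2_translate_inner_inv[OF g])
  have sym: "?U (R (?V x)) \<bullet> y = x \<bullet> ?U (R (?V y))" for x y
    by (simp add: adj R_sym) (metis adj inner_commute)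
  \<comment> \<open>Both R and its conjugate by the translation are positive square roots of the
    inverse of B: invariance of B makes their squares agree.\<close>
  have "R (?U x) = ?U (R (?V (?U x)))"
  proof (rule positive_sqrt_unique[of R "sqrt (bergman_const / c) + 1" "\<lambda>x. ?U (R (?V x))"])
    show "linear R" by (rule symmetric_imp_linear) (rule R_sym)
    show "linear (\<lambda>x. ?U (R (?V x)))" by (rule symmetric_imp_linear) (rule sym)
    show "0 \<le> ?U (R (?V x)) \<bullet> x" for x by (simp add: adj R_pos)
    show "norm (?U (R (?V x))) \<le> (sqrt (bergman_const / c) + 1) * norm x" for x
      using R_bounded[of "?V x"] by (simp add: norm_l2_translate g h)
    show "sqrt (bergman_const / c) + 1 > 0" using c bergman_const_nonneg by (intro add_nonneg_pos) auto
    fix x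
    obtain f where f: "f \<in> L2 hyp_area" "?V x = abs_l2 f" by (rule l2_cases)
    obtain u where u: "(u, f) \<in> B" using B_range[OF f(1) f(1)] .
    have uL: "u \<in> L2 hyp_area" by (rule B_S[OF u]) (rule S_L2(1))
    have "x = abs_l2 (translate g f)" using l2_translate_abs[OF g f(1)] by (simp add: f(2)[symmetric] UV)
    hence "R (R x) = abs_l2 (translate g u)" using R_square[OF B_translate[OF g u]] by simp
    also have "\<dots> = ?U (R (R (?V x)))" by (simp add: f(2) R_square[OF u] l2_translate_abs[OF g uL])
    finally show "R (R x) = ?U (R (?V (?U (R (?V x)))))" by (simp add: VU)
  qed (rule R_sym sym R_pos R_bounded)+
  thus ?thesis by (simp add: VU)
qed

text \<open>R commutes with translations as a map of classes, which identifies the preimage k up to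
  equality almost everywhere.\<close>

lemma S_translate:
  assumes g: "g \<in> SL2R" and hf: "(h, f) \<in> S"
  obtains k where "(k, translate g f) \<in> S" "AE z in hyp_area. k z = translate g h z"
proof -
  obtain k where k: "(k, translate g f) \<in> S" using S_range[OF translate_L2[OF g S_L2(2)[OF hf]]] .
  have "abs_l2 k = R (l2_translate g (abs_l2 f))"
    using R_abs[OF k] l2_translate_abs[OF g S_L2(2)[OF hf]] by simp
  also have "\<dots> = abs_l2 (translate g h)"
    by (simp add: R_translate[OF g] R_abs[OF hf] l2_translate_abs[OF g S_L2(1)[OF hf]])
  finally show ?thesis
    using that[OF k] abs_l2_eq_iff[OF S_L2(1)[OF k] translate_L2[OF g S_L2(1)[OF hf]]] by simp
qed

text \<open>With u = S^(-1) w and w = S^(-1) f = h almost everywhere, symmetry gives <u, S k> = <w,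
  k> = <h, k>: the inverse of B cancels the two factors S.\<close>

lemma ip_inverse_B:
  assumes hf: "(h, f) \<in> S" and uf: "(u, f) \<in> B" and kg: "(k, g) \<in> S"
  shows "ip M u g = ip M h k"
proof -
  obtain w where w: "(u, w) \<in> S" "(w, f) \<in> S" using uf by (rule B_S)
  have "AE z in hyp_area. w z = h z"
    using R_abs[OF w(2)] R_abs[OF hf] abs_l2_eq_iff[OF S_L2(1)[OF w(2)] S_L2(1)[OF hf]] by simp
  hence "ip hyp_area w k = ip hyp_area h k"
    using S_L2 w hf kg by (intro ip_cong_AE) auto
  thus ?thesis using S_sym[OF w(1) kg] S_L2 w hf kg by (simp add: ip_M)
qed

lemma ip_M_tendsto:
  assumes "\<And>n. (hn n, fn n) \<in> S" "\<And>n. (kn n, gn n) \<in> S" "h \<in> L2 hyp_area" "k \<in> L2 hyp_area"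
    and "L2_tendsto M hn h" "L2_tendsto M kn k"
  shows "(\<lambda>n. ip M (hn n) (kn n)) \<longlonglongrightarrow> ip M h k"
  using assms S_L2(1)[OF assms(1)] S_L2(1)[OF assms(2)]
  by (intro ip_tendsto) (auto simp: L2_M L2_tendsto_def nsq_def)

text \<open>By \<open>ip_inverse_B\<close> every admissible choice of sequences produces the inner
  products of hn and kn, so the limit is forced; the given sequences show that one exists.\<close>

lemma binv_form_eq:
  assumes hf: "\<And>n. (hn n, fn n) \<in> S" and kg: "\<And>n. (kn n, gn n) \<in> S"
    and hk: "h \<in> L2 hyp_area" "k \<in> L2 hyp_area"
    and lim: "L2_tendsto M hn h" "L2_tendsto M kn k"
  shows "binv_form M B S h k = ip M h k"
  unfolding binv_form_def
proof (rule the_equality)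
  have "\<exists>u. (u, fn n) \<in> B" for n
    by (rule B_range[OF S_L2(2)[OF hf] S_L2(2)[OF hf]]) (rule exI)
  then obtain un where un: "\<And>n. (un n, fn n) \<in> B" by metis
  have "(\<lambda>n. ip M (un n) (gn n)) \<longlonglongrightarrow> ip M h k"
    using ip_M_tendsto[OF hf kg hk lim] by (simp add: ip_inverse_B[OF hf un kg])
  thus "\<exists>hn fn un kn gn.
     (\<forall>n. (hn n, fn n) \<in> S \<and> (fn n, un n) \<in> B\<inverse> \<and> (kn n, gn n) \<in> S) \<and>
     L2_tendsto M hn h \<and> L2_tendsto M kn k \<and> (\<lambda>n. ip M (un n) (gn n)) \<longlonglongrightarrow> ip M h k"
    using hf un kg lim by (intro exI[of _ hn] exI[of _ fn] exI[of _ un] exI[of _ kn] exI[of _ gn]) auto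
next
  fix v
  assume "\<exists>hn fn un kn gn.
     (\<forall>n. (hn n, fn n) \<in> S \<and> (fn n, un n) \<in> B\<inverse> \<and> (kn n, gn n) \<in> S) \<and>
     L2_tendsto M hn h \<and> L2_tendsto M kn k \<and> (\<lambda>n. ip M (un n) (gn n)) \<longlonglongrightarrow> v"
  then obtain hn fn un kn gn where
    "\<forall>n. (hn n, fn n) \<in> S \<and> (un n, fn n) \<in> B \<and> (kn n, gn n) \<in> S"
    and lims: "L2_tendsto M hn h" "L2_tendsto M kn k" "(\<lambda>n. ip M (un n) (gn n)) \<longlonglongrightarrow> v"
    unfolding converse_iff by (elim exE conjE) (rule that)
  hence *: "(hn n, fn n) \<in> S" "(un n, fn n) \<in> B" "(kn n, gn n) \<in> S" for n by blast+
  have "(\<lambda>n. ip M (un n) (gn n)) \<longlonglongrightarrow> ip M h k"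
    using ip_M_tendsto[OF *(1,3) hk lims(1,2)] by (simp add: ip_inverse_B[OF *(1,2,3)])
  with lims(3) show "v = ip M h k" by (rule LIMSEQ_unique)
qed

text \<open>The traces of T_f times the adjoint of T_{g f}, with f = \<open>fn n\<close>, have two
  limits: one from Hilbert-Schmidt convergence to the rank one operator, one from the trace formula
  with \<open>ip_inverse_B\<close>.\<close>

lemma rank_one_toeplitz_half:
  assumes T: "(h, T) \<in> toeplitz_half M S" and \<eta>: "\<eta> \<in> H13"
    and T_proj: "\<forall>\<xi>\<in>H13. T \<xi> = (\<lambda>z. ipH \<xi> \<eta> * \<eta> z)"
    and g: "g \<in> SL2R" and k: "k \<in> L2 hyp_area" "AE z in hyp_area. k z = translate g h z"
  shows "binv_form M B S h k = ip M h k"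
    and "of_real ((cmod (ipH (pi13 g \<eta>) \<eta>))\<^sup>2) = ip M h k"
proof -
  obtain hn fn where hf: "\<And>n. (hn n, fn n) \<in> S" and lim: "L2_tendsto M hn h"
    and hs: "(\<lambda>n. hs_normsq (\<lambda>\<xi> z. toeplitz (fn n) \<xi> z - T \<xi> z)) \<longlonglongrightarrow> 0" and h: "h \<in> L2 hyp_area"
    using T unfolding toeplitz_half_def L2_M by blast
  note hL = S_L2(1)[OF hf] and fL = S_L2(2)[OF hf]
  have "\<exists>k. (k, translate g (fn n)) \<in> S \<and> (AE z in hyp_area. k z = translate g (hn n) z)" for n
    by (rule S_translate[OF g hf]) blast
  then obtain kn where kn: "\<And>n. (kn n, translate g (fn n)) \<in> S"
    "\<And>n. AE z in hyp_area. kn n z = translate g (hn n) z" by metis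
  note kL = S_L2(1)[OF kn(1)]
  \<comment> \<open>Translation is isometric, so kn approaches k exactly as fast as hn approaches
    h.\<close>
  have "nsq hyp_area (\<lambda>z. kn n z - k z) = nsq hyp_area (\<lambda>z. hn n z - h z)" for n
  proof -
    let ?d = "\<lambda>z. hn n z - h z"
    have d: "?d \<in> L2 hyp_area" by (rule L2_diff[OF hL h])
    have "AE z in hyp_area. kn n z - k z = translate g ?d z"
      using kn(2)[of n] k(2) by eventually_elim (simp add: translate_def)
    hence "nsq hyp_area (\<lambda>z. kn n z - k z) = nsq hyp_area (translate g ?d)"
      by (rule nsq_cong_AE[OF _ L2_diff[OF kL k(1)] translate_L2[OF g d]])
    thus ?thesis by (simp add: nsq_eq_ip translate_ip[OF g d d])
  qed
  hence limk: "L2_tendsto M kn k"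
    using lim by (simp add: L2_tendsto_M hL h kL k(1))
  show "binv_form M B S h k = ip M h k"
    by (rule binv_form_eq[OF hf kn(1) h k(1) lim limk])
  have "\<exists>u. (u, fn n) \<in> B \<and>
      has_trace (toeplitz (fn n) \<circ> op_adjoint (toeplitz (translate g (fn n)))) (ip M u (translate g (fn n)))" for n
    by (rule B_range[OF fL translate_L2[OF g fL]]) blast
  then obtain un where un: "\<And>n. (un n, fn n) \<in> B"
    "\<And>n. has_trace (toeplitz (fn n) \<circ> op_adjoint (toeplitz (translate g (fn n)))) (ip M (un n) (translate g (fn n)))"
    by metis
  have "(\<lambda>n. ip M (un n) (translate g (fn n))) \<longlonglongrightarrow> of_real ((cmod (ipH (pi13 g \<eta>) \<eta>))\<^sup>2)"
    using T_proj by (intro toeplitz_trace_tendsto[OF g \<eta> fL _ hs un(2)]) auto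
  moreover have "(\<lambda>n. ip M (un n) (translate g (fn n))) \<longlonglongrightarrow> ip M h k"
    using ip_M_tendsto[OF hf kn(1) h k(1) lim limk] by (simp add: ip_inverse_B[OF hf un(1) kn(1)])
  ultimately show "of_real ((cmod (ipH (pi13 g \<eta>) \<eta>))\<^sup>2) = ip M h k" by (rule LIMSEQ_unique)
qed

end

section \<open>Indicators, rank one traces and the conclusion\<close>

lemma indicator_L2_hyp:
  assumes "A \<in> sets borel" "emeasure hyp_area A < \<infinity>"
  shows "indicator A \<in> L2 hyp_area"
proof -
  have "(\<lambda>z. (cmod (indicator A z))\<^sup>2) = (indicator A :: complex \<Rightarrow> real)"
    by (auto simp: indicator_def)
  thus ?thesis using assms by (auto simp: L2_def)
qed

lemma ip_indicator:
  assumes "A \<in> sets M" "C \<in> sets M"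
  shows "ip M (indicator A) (indicator C) = of_real (measure M (C \<inter> A))"
proof -
  have "indicator A z * cnj (indicator C z) = complex_of_real (indicator (C \<inter> A) z)" for z
    by (auto simp: indicator_def)
  thus ?thesis using assms by (simp add: ip_def)
qed

text \<open>With T of rank one, both diagonal sums are Parseval sums, with the same value in every
  orthonormal basis.\<close>

lemma has_trace_rank_one:
  assumes g: "g \<in> SL2R" and \<eta>: "\<eta> \<in> H13" and T: "\<forall>\<xi>\<in>H13. T \<xi> = (\<lambda>z. ipH \<xi> \<eta> * \<eta> z)"
  shows "has_trace (pi13 g \<circ> T) (ipH (pi13 g \<eta>) \<eta>)"
    and "has_trace (T \<circ> pi13 g \<circ> T \<circ> inv_into H13 (pi13 g)) (of_real ((cmod (ipH (pi13 g \<eta>) \<eta>))\<^sup>2))"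
proof -
  note \<eta>' = pi13_H13[OF g \<eta>]
  show "has_trace (pi13 g \<circ> T) (ipH (pi13 g \<eta>) \<eta>)"
    unfolding has_trace_def
  proof (intro allI impI)
    fix E assume E: "onb E"
    show "((\<lambda>e. ipH ((pi13 g \<circ> T) e) e) has_sum ipH (pi13 g \<eta>) \<eta>) E"
    proof (rule has_sum_cong[THEN iffD1, OF _ Parseval[OF E \<eta>' H13_L2[OF \<eta>]]])
      fix e assume "e \<in> E"
      hence "e \<in> H13" using E by (auto simp: onb_def)
      thus "ipH (pi13 g \<eta>) e * ipH e \<eta> = ipH ((pi13 g \<circ> T) e) e"
        using T \<eta>' by (simp add: pi13_scale ip_scale_left H13_L2)
    qed
  qed
  show "has_trace (T \<circ> pi13 g \<circ> T \<circ> inv_into H13 (pi13 g)) (of_real ((cmod (ipH (pi13 g \<eta>) \<eta>))\<^sup>2))"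
    unfolding has_trace_def
  proof (intro allI impI)
    fix E assume E: "onb E"
    show "((\<lambda>e. ipH ((T \<circ> pi13 g \<circ> T \<circ> inv_into H13 (pi13 g)) e) e) has_sum
        of_real ((cmod (ipH (pi13 g \<eta>) \<eta>))\<^sup>2)) E"
    proof (rule has_sum_cong[THEN iffD1, OF _ rank_one_trace[OF E g \<eta>]])
      fix e assume "e \<in> E"
      hence e: "e \<in> H13" using E by (auto simp: onb_def)
      have "(T \<circ> pi13 g \<circ> T \<circ> inv_into H13 (pi13 g)) e = T (\<lambda>z. ipH e (pi13 g \<eta>) * pi13 g \<eta> z)"
        using T pi13_H13[OF SL2R_inv[OF g] e] by (simp add: inv_into_pi13[OF g e] rank_one_sandwich[OF g \<eta> e])
      also have "\<dots> = (\<lambda>z. (ipH e (pi13 g \<eta>) * ipH (pi13 g \<eta>) \<eta>) * \<eta> z)"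
        using T \<eta> \<eta>' by (simp add: H13_scale ip_scale_left H13_L2)
      finally show "ipH e (pi13 g \<eta>) * ipH (pi13 g \<eta>) \<eta> * ipH \<eta> e =
          ipH ((T \<circ> pi13 g \<circ> T \<circ> inv_into H13 (pi13 g)) e) e"
        using \<eta> e by (simp add: ip_scale_left H13_L2)
    qed
  qed
qed

theorem mainTheorem8:
  fixes p :: nat and G :: "mat2 set" and F :: "complex set"
    and \<mu>0 :: "complex measure" and c :: ennreal
    and B Bhalf :: graph and T :: op and \<eta> :: "complex \<Rightarrow> complex"
    and t :: "mat2 \<Rightarrow> complex" and \<phi>0 :: "mat2 \<Rightarrow> real"
  assumes G: "prime p \<and> G = PGL2_lifts (Z_inv p) \<or> G = PGL2_lifts \<rat>"
    and F: "fundamental_domain F"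
    and mu: "\<mu>0 = scale_measure c hyp_area" "emeasure \<mu>0 F = 1"
    and B: "berezin_operator \<mu>0 B"
    and Bhalf: "positive_sqrt \<mu>0 Bhalf B"
    and T: "(indicator F, T) \<in> toeplitz_half \<mu>0 Bhalf"
    and eta: "\<eta> \<in> H13" "wandering \<eta>"
    and T_proj: "\<forall>\<xi>\<in>H13. T \<xi> = (\<lambda>z. ipH \<xi> \<eta> * \<eta> z)"
    and t: "\<forall>\<theta>\<in>G. t \<theta> = ipH (pi13 \<theta> \<eta>) \<eta>"
    and phi: "\<forall>\<theta>\<in>G. \<phi>0 \<theta> = (cmod (t \<theta>))\<^sup>2"
  shows "\<forall>\<theta>\<in>G.
      has_trace (T \<circ> pi13 \<theta> \<circ> T \<circ> inv_into H13 (pi13 \<theta>)) (of_real (\<phi>0 \<theta>)) \<and>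
      of_real (\<phi>0 \<theta>) = binv_form \<mu>0 B Bhalf (indicator F) (indicator (mob \<theta> ` F)) \<and>
      \<phi>0 \<theta> = measure \<mu>0 (mob \<theta> ` F \<inter> F) \<and>
      has_trace (pi13 \<theta> \<circ> T) (t \<theta>)"
proof
  fix \<theta> assume "\<theta> \<in> G"
  hence \<theta>: "\<theta> \<in> SL2R" using G PGL2_lifts_subset by blast
  have F': "F \<in> sets borel" "F \<subseteq> UHP" using F by (auto simp: fundamental_domain_def)
  \<comment> \<open>The normalization forces c to be positive and finite, hence a real constant as
    in \<open>berezin_root\<close>, and F to have finite invariant area, so that its indicator is
    square integrable.\<close>
  have cF: "c * emeasure hyp_area F = 1" using mu by simp
  hence "c \<noteq> 0" "c \<noteq> \<infinity>" "emeasure hyp_area F \<noteq> \<infinity>"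
    by (auto simp: ennreal_top_mult ennreal_mult_top split: if_splits)
  then obtain r where r: "c = ennreal r" "r > 0"
    by (metis ennreal_cases ennreal_neg infinity_ennreal_def linorder_not_le)
  interpret berezin_root r B Bhalf
    using r B Bhalf by unfold_locales (simp_all add: mu)
  have \<mu>0: "\<mu>0 = scale_measure (ennreal r) hyp_area" by (simp add: mu r)
  have \<theta>F: "mob \<theta> ` F \<in> sets borel" by (rule mob_image_borel[OF \<theta> F'(2,1)])
  have AE: "AE z in hyp_area. indicator (mob \<theta> ` F) z = translate \<theta> (indicator F) z"
    using AE_hyp_UHP
    by eventually_elim (simp add: mob_image_eq[OF \<theta> F'(2)] translate_def indicator_def)
  have FL: "indicator F \<in> L2 hyp_area"
    using \<open>emeasure hyp_area F \<noteq> \<infinity>\<close> by (intro indicator_L2_hyp F') (simp add: top.not_eq_extremum)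
  have \<theta>FL: "indicator (mob \<theta> ` F) \<in> L2 hyp_area"
  proof -
    have "integrable hyp_area (\<lambda>z. (cmod (translate \<theta> (indicator F) z))\<^sup>2)"
      by (rule L2_integrable[OF translate_L2[OF \<theta> FL]])
    hence "integrable hyp_area (\<lambda>z. (cmod (indicator (mob \<theta> ` F) z))\<^sup>2)"
      using AE \<theta>F L2_measurable[OF translate_L2[OF \<theta> FL]]
      by (subst integrable_cong_AE[where g = "\<lambda>z. (cmod (translate \<theta> (indicator F) z))\<^sup>2"]) auto
    thus ?thesis using \<theta>F by (simp add: L2_def)
  qed
  have tr: "t \<theta> = ipH (pi13 \<theta> \<eta>) \<eta>" "\<phi>0 \<theta> = (cmod (ipH (pi13 \<theta> \<eta>) \<eta>))\<^sup>2"
    using t phi \<open>\<theta> \<in> G\<close> by auto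
  note main = rank_one_toeplitz_half[OF T[unfolded \<mu>0] eta(1) T_proj \<theta> \<theta>FL AE, folded \<mu>0]
  have "ip \<mu>0 (indicator F) (indicator (mob \<theta> ` F)) = of_real (measure \<mu>0 (mob \<theta> ` F \<inter> F))"
    using F' \<theta>F by (intro ip_indicator) (simp_all add: \<mu>0)
  with main(2) have m: "\<phi>0 \<theta> = measure \<mu>0 (mob \<theta> ` F \<inter> F)"
    by (simp only: tr of_real_eq_iff)
  show "has_trace (T \<circ> pi13 \<theta> \<circ> T \<circ> inv_into H13 (pi13 \<theta>)) (of_real (\<phi>0 \<theta>)) \<and>
      of_real (\<phi>0 \<theta>) = binv_form \<mu>0 B Bhalf (indicator F) (indicator (mob \<theta> ` F)) \<and>
      \<phi>0 \<theta> = measure \<mu>0 (mob \<theta> ` F \<inter> F) \<and>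
      has_trace (pi13 \<theta> \<circ> T) (t \<theta>)"
    using has_trace_rank_one[OF \<theta> eta(1) T_proj] main m
    by (intro conjI) (simp_all only: tr)
qed

end
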